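(* The action $A$ of the half-Lie group $\mathcal{G}^k=G\ltimes\mathrm{Diff}_{C_0^k}(\mathbb{R}^d)$ on $\tilde{\mathcal{Q}}=G\times\mathcal{Q}$ given by $A((g,\varphi),(h,q))=(gh,\,g\cdot(\varphi\cdot q))$ satisfies the following conditions: 1. The action $A:\mathcal{G}^k\times\tilde{\mathcal{Q}}\to\tilde{\mathcal{Q}}$ is continuous. 2. For every $(h,q)\in\tilde{\mathcal{Q}}$, the mapping $A_{(h,q)}:\mathcal{G}^k\to\tilde{\mathcal{Q}}$, $(g,\varphi)\mapsto(gh,g\cdot(\varphi\cdot q))$ is smooth; denote by $\xi_{(h,q)}=d_{(e_G,\mathrm{id})}A_{(h,q)}$ its derivative at the identity, called the infinitesimal action. 3. For every integer $l>0$, the mappings $$A:\mathcal{G}^{k+l}\times\tilde{\mathcal{Q}}\to\tilde{\mathcal{Q}},\quad ((g,\varphi),(h,q))\mapsto(gh,g\cdot(\varphi\cdot q))$$ and $$\xi:T_{(e_G,\mathrm{id})}\mathcal{G}^{k+l}\times\tilde{\mathcal{Q}}\to T\tilde{\mathcal{Q}},\quad ((X,u),(h,q))\mapsto(Xh,\,X\cdot q+u\cdot q)$$ are $C^l$.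
   Context: Let $d,k\ge 1$ be integers. $C_0^k(\mathbb{R}^d,\mathbb{R}^d)$ is the Banach space of $C^k$ maps vanishing at infinity together with all their derivatives up to order $k$. $\mathrm{Diff}_{C_0^k}(\mathbb{R}^d)=(\mathrm{id}+C_0^k(\mathbb{R}^d,\mathbb{R}^d))\cap \mathrm{Diff}^1(\mathbb{R}^d)$ is an open subset of an affine Banach space, hence a Banach manifold, and a group under composition, with $T_{\mathrm{id}}\mathrm{Diff}_{C_0^k}(\mathbb{R}^d)=C_0^k(\mathbb{R}^d,\mathbb{R}^d)$. $G$ is a finite-dimensional Lie group with identity $e_G$ and Lie algebra $\mathfrak g$. Standing assumptions on $G$: (a) $G$ acts smoothly via diffeomorphisms on $\mathbb{R}^d$, denoted $g\cdot x$. (b) There is a continuous right action $\rho$ of $G$ on $\mathrm{Diff}_{C_0^k}(\mathbb{R}^d)$ by smooth automorphisms: $\rho_{gh}(\varphi)=\rho_h(\rho_g(\varphi))$, $\rho_g(\varphi\circ\psi)=\rho_g(\varphi)\circ\rho_g(\psi)$, $\rho_g(\varphi)(x)=g^{-1}\cdot\varphi(g\cdot x)$ for all $x\in\mathbb{R}^d$, and each $\varphi\mapsto\rho_g(\varphi)$ is a smooth diffeomorphism of $\mathrm{Diff}_{C_0^k}(\mathbb{R}^d)$. (c) For every integer $l\ge0$, $\rho$ induces a continuous action on $\mathrm{Diff}_{C_0^{k+l}}(\mathbb{R}^d)$ by smooth diffeomorphisms, and $G\times\mathrm{Diff}_{C_0^{k+l}}(\mathbb{R}^d)\to\mathrm{Diff}_{C_0^k}(\mathbb{R}^d)$,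 $(g,\varphi)\mapsto\rho_g(\varphi)$, is $C^l$. $\mathcal{G}^k=G\ltimes\mathrm{Diff}_{C_0^k}(\mathbb{R}^d)$ has the product manifold structure and composition law $(g,\varphi)(g',\varphi')=(gg',\rho_{g'}(\varphi)\circ\varphi')$; it is a half-Lie group, i.e. a topological group and Banach manifold whose right translations are smooth. $\mathcal{Q}$ is a Banach manifold on which $\mathrm{Diff}_{C_0^k}(\mathbb{R}^d)$ acts, with: $(\varphi,q)\mapsto\varphi\cdot q$ continuous; for each $q$, $\varphi\mapsto\varphi\cdot q$ is $C^\infty$, with differential at $\mathrm{id}$ denoted $u\mapsto u\cdot q$ for $u\in C_0^k(\mathbb{R}^d,\mathbb{R}^d)$; for every $l>0$ the maps $\mathrm{Diff}_{C_0^{k+l}}(\mathbb{R}^d)\times\mathcal{Q}\to\mathcal{Q}$, $(\varphi,q)\mapsto\varphi\cdot q$, and $C_0^{k+l}(\mathbb{R}^d,\mathbb{R}^d)\times\mathcal{Q}\to T\mathcal{Q}$, $(u,q)\mapsto u\cdot q$, are $C^l$. Moreover $G$ acts smoothly via diffeomorphisms on $\mathcal{Q}$, with infinitesimal action $X\cdot q$ for $X\in\mathfrak g$, and the compatibility condition $\varphi\cdot(g\cdot q)=g\cdot(\rho_g(\varphi)\cdot q)$ holds for all $g\in G$, $\varphi\in \mathrm{Diff}_{C_0^k}(\mathbb{R}^d)$, $q\in\mathcal{Q}$. $Xh=d_{e_G}R_h(X)$ where $R_h:g\mapsto gh$ in $G$. *)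

theory Defs
  imports "HOL-Analysis.Analysis" "HOL-Algebra.Group_Action"
begin

section \<open>Normed spaces given by a carrier and a norm\<close>

text \<open>
  The spaces \<open>C_0^k\<close> depend on the number \<open>k\<close>, hence they cannot be types of class
  \<open>banach\<close>.  A normed space is a linear subspace of a real vector space together with its own norm,
  which is unrelated to any norm that the ambient type may carry.
\<close>

record 'v nspace =
  nscar :: "'v set"
  nsnorm :: "'v \<Rightarrow> real"

text \<open>The distance is cut off outside the carrier because \<open>Metric_space\<close> requires symmetry and
  nonnegativity on the whole type.\<close>

definition ndist :: "'v::real_vector nspace \<Rightarrow> 'v \<Rightarrow> 'v \<Rightarrow> real" where
  "ndist E x y = (if x \<in> nscar E \<and> y \<in> nscar E then nsnorm E (x - y) else 0)"

definition ntop :: "'v::real_vector nspace \<Rightarrow> 'v topology" where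
  "ntop E = Metric_space.mtopology (nscar E) (ndist E)"

definition banach_space :: "'v::real_vector nspace \<Rightarrow> bool" where
  "banach_space E \<longleftrightarrow>
     subspace (nscar E) \<and>
     (\<forall>x\<in>nscar E. 0 \<le> nsnorm E x \<and> (nsnorm E x = 0 \<longleftrightarrow> x = 0)) \<and>
     (\<forall>x\<in>nscar E. \<forall>c. nsnorm E (c *\<^sub>R x) = \<bar>c\<bar> * nsnorm E x) \<and>
     (\<forall>x\<in>nscar E. \<forall>y\<in>nscar E. nsnorm E (x + y) \<le> nsnorm E x + nsnorm E y) \<and>
     Metric_space.mcomplete (nscar E) (ndist E)"

definition finite_dim :: "'v::real_vector nspace \<Rightarrow> bool" where
  "finite_dim E \<longleftrightarrow> (\<exists>B. finite B \<and> nscar E = span B)"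

definition prod_ns :: "'v nspace \<Rightarrow> 'w nspace \<Rightarrow> ('v \<times> 'w) nspace" where
  "prod_ns E F = \<lparr>nscar = nscar E \<times> nscar F, nsnorm = (\<lambda>(x, y). max (nsnorm E x) (nsnorm F y))\<rparr>"

definition std_ns :: "'v::real_normed_vector nspace" where
  "std_ns = \<lparr>nscar = UNIV, nsnorm = norm\<rparr>"

section \<open>Maps of class \<open>C^l\<close> between normed spaces\<close>

text \<open>
  Iterating the Frechet derivative leads to the spaces \<open>L(E, L(E, \<dots> L(E, F)))\<close>, which are identified
  as usual with the bounded \<open>m\<close>-linear maps \<open>E^m \<rightarrow> F\<close> with the operator norm; the arguments are
  passed as a list of length \<open>m\<close>, the newest direction of differentiation first.
\<close>

definition args :: "'e nspace \<Rightarrow> nat \<Rightarrow> 'e list set" where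
  "args E m = {vs. length vs = m \<and> set vs \<subseteq> nscar E}"

text \<open>\<open>opnorm_le E F m T c\<close>: the operator norm of \<open>T\<close> is at most \<open>c\<close>.\<close>

definition opnorm_le :: "'e nspace \<Rightarrow> 'f nspace \<Rightarrow> nat \<Rightarrow> ('e list \<Rightarrow> 'f) \<Rightarrow> real \<Rightarrow> bool" where
  "opnorm_le E F m T c \<longleftrightarrow>
     (\<forall>vs\<in>args E m. nsnorm F (T vs) \<le> c * prod_list (map (nsnorm E) vs))"

definition bounded_multilinear ::
  "'e::real_vector nspace \<Rightarrow> 'f::real_vector nspace \<Rightarrow> nat \<Rightarrow> ('e list \<Rightarrow> 'f) \<Rightarrow> bool" where
  "bounded_multilinear E F m T \<longleftrightarrow>
     (\<forall>vs\<in>args E m. T vs \<in> nscar F) \<and>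
     (\<forall>vs\<in>args E m. \<forall>i<m. \<forall>v\<in>nscar E. \<forall>w\<in>nscar E. \<forall>a b.
        T (vs[i := a *\<^sub>R v + b *\<^sub>R w]) = a *\<^sub>R T (vs[i := v]) + b *\<^sub>R T (vs[i := w])) \<and>
     (\<exists>c. opnorm_le E F m T c)"

text \<open>For \<open>U\<close> open in \<open>E\<close>: \<open>f\<close> is \<open>l\<close> times continuously Frechet differentiable on \<open>U\<close>, where
  \<open>D j x\<close> is the \<open>j\<close>-th derivative at \<open>x\<close>.\<close>

definition Ck_on ::
  "'e::real_vector nspace \<Rightarrow> 'f::real_vector nspace \<Rightarrow> nat \<Rightarrow> 'e set \<Rightarrow> ('e \<Rightarrow> 'f) \<Rightarrow> bool" where
  "Ck_on E F l U f \<longleftrightarrow>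
     (\<exists>D :: nat \<Rightarrow> 'e \<Rightarrow> 'e list \<Rightarrow> 'f.
        (\<forall>x\<in>U. D 0 x [] = f x) \<and>
        (\<forall>j\<le>l. \<forall>x\<in>U. bounded_multilinear E F j (D j x)) \<and>
        (\<forall>j<l. \<forall>x\<in>U. \<forall>\<epsilon>>0. \<exists>\<delta>>0. \<forall>y\<in>U. nsnorm E (y - x) < \<delta> \<longrightarrow>
           opnorm_le E F j (\<lambda>vs. D j y vs - D j x vs - D (Suc j) x ((y - x) # vs))
             (\<epsilon> * nsnorm E (y - x))) \<and>
        (\<forall>x\<in>U. \<forall>\<epsilon>>0. \<exists>\<delta>>0. \<forall>y\<in>U. nsnorm E (y - x) < \<delta> \<longrightarrow>
           opnorm_le E F l (\<lambda>vs. D l y vs - D l x vs) \<epsilon>))"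

definition has_nderiv ::
  "'e::real_vector nspace \<Rightarrow> 'f::real_vector nspace \<Rightarrow> 'e set \<Rightarrow> ('e \<Rightarrow> 'f) \<Rightarrow> 'e \<Rightarrow> ('e \<Rightarrow> 'f) \<Rightarrow> bool" where
  "has_nderiv E F U f x L \<longleftrightarrow>
     (\<forall>v\<in>nscar E. L v \<in> nscar F) \<and>
     (\<forall>v\<in>nscar E. \<forall>w\<in>nscar E. \<forall>a b. L (a *\<^sub>R v + b *\<^sub>R w) = a *\<^sub>R L v + b *\<^sub>R L w) \<and>
     (\<exists>c. \<forall>v\<in>nscar E. nsnorm F (L v) \<le> c * nsnorm E v) \<and>
     (\<forall>\<epsilon>>0. \<exists>\<delta>>0. \<forall>y\<in>U. nsnorm E (y - x) < \<delta> \<longrightarrow>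
        nsnorm F (f y - f x - L (y - x)) \<le> \<epsilon> * nsnorm E (y - x))"

text \<open>The Frechet derivative at a point of the open set \<open>U\<close>; unique on the carrier of \<open>E\<close>.\<close>

definition nderiv ::
  "'e::real_vector nspace \<Rightarrow> 'f::real_vector nspace \<Rightarrow> 'e set \<Rightarrow> ('e \<Rightarrow> 'f) \<Rightarrow> 'e \<Rightarrow> 'e \<Rightarrow> 'f" where
  "nderiv E F U f x = (SOME L. has_nderiv E F U f x L)"

section \<open>Banach manifolds\<close>

text \<open>
  A set with an indexed atlas of charts \<open>cmap M i : cdom M i \<rightarrow> nscar (model M)\<close>.  The topology is the
  one for which the charts are homeomorphisms onto their images.
\<close>

record ('m, 'i, 'e) mfd =
  pts :: "'m set"
  model :: "'e nspace"
  idx :: "'i set"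
  cdom :: "'i \<Rightarrow> 'm set"
  cmap :: "'i \<Rightarrow> 'm \<Rightarrow> 'e"

definition mtop :: "('m, 'i, 'e::real_vector) mfd \<Rightarrow> 'm topology" where
  "mtop M = topology (\<lambda>W. W \<subseteq> pts M \<and>
     (\<forall>i\<in>idx M. \<exists>V. openin (ntop (model M)) V \<and>
        W \<inter> cdom M i = {x \<in> cdom M i. cmap M i x \<in> V}))"

definition cinv :: "('m, 'i, 'e) mfd \<Rightarrow> 'i \<Rightarrow> 'e \<Rightarrow> 'm" where
  "cinv M i = inv_into (cdom M i) (cmap M i)"

definition banach_manifold :: "('m, 'i, 'e::real_vector) mfd \<Rightarrow> bool" where
  "banach_manifold M \<longleftrightarrow>
     banach_space (model M) \<and>
     pts M = (\<Union>i\<in>idx M. cdom M i) \<and>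
     (\<forall>i\<in>idx M. inj_on (cmap M i) (cdom M i)) \<and>
     (\<forall>i\<in>idx M. openin (ntop (model M)) (cmap M i ` cdom M i)) \<and>
     (\<forall>i\<in>idx M. \<forall>j\<in>idx M. openin (ntop (model M)) (cmap M i ` (cdom M i \<inter> cdom M j))) \<and>
     (\<forall>i\<in>idx M. \<forall>j\<in>idx M. \<forall>l.
        Ck_on (model M) (model M) l (cmap M i ` (cdom M i \<inter> cdom M j)) (cmap M j \<circ> cinv M i)) \<and>
     Hausdorff_space (mtop M)"

definition prodM :: "('m, 'i, 'e) mfd \<Rightarrow> ('n, 'j, 'f) mfd \<Rightarrow> ('m \<times> 'n, 'i \<times> 'j, 'e \<times> 'f) mfd" where
  "prodM M N = \<lparr>pts = pts M \<times> pts N, model = prod_ns (model M) (model N), idx = idx M \<times> idx N,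
     cdom = (\<lambda>(i, j). cdom M i \<times> cdom N j),
     cmap = (\<lambda>(i, j) (x, y). (cmap M i x, cmap N j y))\<rparr>"

text \<open>A normed space as a manifold with one chart.\<close>

definition linM :: "'e nspace \<Rightarrow> ('e, unit, 'e) mfd" where
  "linM E = \<lparr>pts = nscar E, model = E, idx = UNIV, cdom = (\<lambda>_. nscar E), cmap = (\<lambda>_ x. x)\<rparr>"

text \<open>The domain and the values of the coordinate representation of \<open>f : M \<rightarrow> N\<close> in charts \<open>i\<close>, \<open>j\<close>.\<close>

definition rep_dom :: "('m, 'i, 'e) mfd \<Rightarrow> ('n, 'j, 'f) mfd \<Rightarrow> ('m \<Rightarrow> 'n) \<Rightarrow> 'i \<Rightarrow> 'j \<Rightarrow> 'e set" where
  "rep_dom M N f i j = cmap M i ` {x \<in> cdom M i. f x \<in> cdom N j}"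

definition rep_map :: "('m, 'i, 'e) mfd \<Rightarrow> ('n, 'j, 'f) mfd \<Rightarrow> ('m \<Rightarrow> 'n) \<Rightarrow> 'i \<Rightarrow> 'j \<Rightarrow> 'e \<Rightarrow> 'f" where
  "rep_map M N f i j = cmap N j \<circ> f \<circ> cinv M i"

definition Ck_map ::
  "nat \<Rightarrow> ('m, 'i, 'e::real_vector) mfd \<Rightarrow> ('n, 'j, 'f::real_vector) mfd \<Rightarrow> ('m \<Rightarrow> 'n) \<Rightarrow> bool" where
  "Ck_map l M N f \<longleftrightarrow> continuous_map (mtop M) (mtop N) f \<and>
     (\<forall>i\<in>idx M. \<forall>j\<in>idx N.
        Ck_on (model M) (model N) l (rep_dom M N f i j) (rep_map M N f i j))"

definition smooth_map ::
  "('m, 'i, 'e::real_vector) mfd \<Rightarrow> ('n, 'j, 'f::real_vector) mfd \<Rightarrow> ('m \<Rightarrow> 'n) \<Rightarrow> bool" where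
  "smooth_map M N f \<longleftrightarrow> (\<forall>l. Ck_map l M N f)"

definition diffeo ::
  "('m, 'i, 'e::real_vector) mfd \<Rightarrow> ('n, 'j, 'f::real_vector) mfd \<Rightarrow> ('m \<Rightarrow> 'n) \<Rightarrow> bool" where
  "diffeo M N f \<longleftrightarrow> bij_betw f (pts M) (pts N) \<and> smooth_map M N f \<and>
     smooth_map N M (inv_into (pts M) f)"

section \<open>Tangent bundles\<close>

definition idx_at :: "('m, 'i, 'e) mfd \<Rightarrow> 'm \<Rightarrow> 'i set" where
  "idx_at M x = {i \<in> idx M. x \<in> cdom M i}"

text \<open>
  A tangent vector at \<open>x\<close> is a pair \<open>(x, v)\<close>, where \<open>v i\<close> is the coordinate vector in the chart \<open>i\<close>
  around \<open>x\<close>, and these transform by the derivatives of the chart changes; that is, \<open>v\<close> is the usual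
  equivalence class of pairs (chart, vector), regarded as a function of the chart.
\<close>

type_synonym ('m, 'i, 'e) tvec = "'m \<times> ('i \<Rightarrow> 'e)"

definition tspace :: "('m, 'i, 'e::real_vector) mfd \<Rightarrow> 'm \<Rightarrow> ('m, 'i, 'e) tvec set" where
  "tspace M x = {(x, v) | v. v \<in> extensional (idx_at M x) \<and>
     (\<forall>i\<in>idx_at M x. v i \<in> nscar (model M)) \<and>
     (\<forall>i\<in>idx_at M x. \<forall>j\<in>idx_at M x.
        v j = nderiv (model M) (model M) (cmap M i ` (cdom M i \<inter> cdom M j)) (cmap M j \<circ> cinv M i)
                (cmap M i x) (v i))}"

definition TM :: "('m, 'i, 'e::real_vector) mfd \<Rightarrow> (('m, 'i, 'e) tvec, 'i, 'e \<times> 'e) mfd" where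
  "TM M = \<lparr>pts = (\<Union>x\<in>pts M. tspace M x), model = prod_ns (model M) (model M), idx = idx M,
     cdom = (\<lambda>i. \<Union>x\<in>cdom M i. tspace M x),
     cmap = (\<lambda>i (x, v). (cmap M i x, v i))\<rparr>"

text \<open>A single tangent space as a manifold; the charts are linear isomorphisms onto the model space.\<close>

definition tspaceM :: "('m, 'i, 'e::real_vector) mfd \<Rightarrow> 'm \<Rightarrow> (('m, 'i, 'e) tvec, 'i, 'e) mfd" where
  "tspaceM M x = \<lparr>pts = tspace M x, model = model M, idx = idx_at M x,
     cdom = (\<lambda>i. tspace M x), cmap = (\<lambda>i (y, v). v i)\<rparr>"

text \<open>Sum of two tangent vectors at the same point.\<close>

definition tadd ::
  "('m, 'i, 'e::real_vector) mfd \<Rightarrow> ('m, 'i, 'e) tvec \<Rightarrow> ('m, 'i, 'e) tvec \<Rightarrow> ('m, 'i, 'e) tvec" where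
  "tadd M X Y = (fst X, restrict (\<lambda>i. snd X i + snd Y i) (idx_at M (fst X)))"

text \<open>The tangent map; it does not depend on the chart \<open>i\<close> around the base point.\<close>

definition tmap ::
  "('m, 'i, 'e::real_vector) mfd \<Rightarrow> ('n, 'j, 'f::real_vector) mfd \<Rightarrow> ('m \<Rightarrow> 'n) \<Rightarrow>
     ('m, 'i, 'e) tvec \<Rightarrow> ('n, 'j, 'f) tvec" where
  "tmap M N f X = (let x = fst X; i = (SOME i. i \<in> idx_at M x) in
     (f x, restrict (\<lambda>j. nderiv (model M) (model N) (rep_dom M N f i j) (rep_map M N f i j)
                           (cmap M i x) (snd X i)) (idx_at N (f x))))"

text \<open>The canonical identification \<open>T_x M \<times> T_y N = T_(x,y) (M \<times> N)\<close>.\<close>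

definition tpair ::
  "('m, 'i, 'e) mfd \<Rightarrow> ('n, 'j, 'f) mfd \<Rightarrow> ('m, 'i, 'e) tvec \<Rightarrow> ('n, 'j, 'f) tvec \<Rightarrow>
     ('m \<times> 'n, 'i \<times> 'j, 'e \<times> 'f) tvec" where
  "tpair M N X Y = ((fst X, fst Y),
     restrict (\<lambda>(i, j). (snd X i, snd Y j)) (idx_at M (fst X) \<times> idx_at N (fst Y)))"

section \<open>Lie groups and smooth actions\<close>

definition lie_group :: "('g, 'z) monoid_scheme \<Rightarrow> ('g, 'i, 'a::real_vector) mfd \<Rightarrow> bool" where
  "lie_group G M \<longleftrightarrow> group G \<and> pts M = carrier G \<and> banach_manifold M \<and> finite_dim (model M) \<and>
     smooth_map (prodM M M) M (\<lambda>(g, h). g \<otimes>\<^bsub>G\<^esub> h) \<and> smooth_map M M (m_inv G)"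

text \<open>\<open>group_action\<close> wants maps that are extensional on the set acted upon.\<close>

definition acts_on :: "('g, 'z) monoid_scheme \<Rightarrow> 'm set \<Rightarrow> ('g \<Rightarrow> 'm \<Rightarrow> 'm) \<Rightarrow> bool" where
  "acts_on G S a \<longleftrightarrow> group_action G S (\<lambda>g. restrict (a g) S)"

definition smooth_action ::
  "('g, 'z) monoid_scheme \<Rightarrow> ('g, 'i, 'a::real_vector) mfd \<Rightarrow> ('m, 'j, 'e::real_vector) mfd \<Rightarrow>
     ('g \<Rightarrow> 'm \<Rightarrow> 'm) \<Rightarrow> bool" where
  "smooth_action G MG M a \<longleftrightarrow> acts_on G (pts M) a \<and>
     smooth_map (prodM MG M) M (\<lambda>(g, x). a g x) \<and> (\<forall>g\<in>carrier G. diffeo M M (a g))"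

section \<open>The spaces \<open>C_0^k\<close> and the groups of diffeomorphisms\<close>

text \<open>\<open>pderivs f [v1, \<dots>, vj]\<close> is the iterated directional derivative of \<open>f\<close> in directions
  \<open>vj, \<dots>, v1\<close>; for lists of standard basis vectors these are the partial derivatives.\<close>

primrec pderivs :: "('v::real_normed_vector \<Rightarrow> 'w::real_normed_vector) \<Rightarrow> 'v list \<Rightarrow> 'v \<Rightarrow> 'w" where
  "pderivs f [] = f"
| "pderivs f (v # vs) = (\<lambda>x. frechet_derivative (pderivs f vs) (at x) v)"

definition multi_idx :: "nat \<Rightarrow> (real^'n) list set" where
  "multi_idx k = {vs. length vs \<le> k \<and> set vs \<subseteq> Basis}"

text \<open>
  A function vanishing at infinity is bounded, so \<open>C_0^k\<close> is a linear subspace of the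
  space of bounded continuous functions.  It carries the norm \<open>max_{|\<alpha>| \<le> k} sup |\<partial>^\<alpha> u|\<close>.
\<close>

definition C0 :: "nat \<Rightarrow> ((real^'n) \<Rightarrow>\<^sub>C (real^'n)) nspace" where
  "C0 k = \<lparr>nscar = {u. Ck_on std_ns std_ns k UNIV (apply_bcontfun u) \<and>
                      (\<forall>vs\<in>multi_idx k. (pderivs (apply_bcontfun u) vs \<longlongrightarrow> 0) at_infinity)},
     nsnorm = (\<lambda>u. SUP (vs, x)\<in>multi_idx k \<times> UNIV. norm (pderivs (apply_bcontfun u) vs x))\<rparr>"

definition Diff1 :: "((real^'n) \<Rightarrow> (real^'n)) set" where
  "Diff1 = {\<phi>. bij \<phi> \<and> Ck_on std_ns std_ns 1 UNIV \<phi> \<and> Ck_on std_ns std_ns 1 UNIV (inv_into UNIV \<phi>)}"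

definition DiffC0 :: "nat \<Rightarrow> ((real^'n) \<Rightarrow> (real^'n)) set" where
  "DiffC0 k = {\<phi>. \<exists>u\<in>nscar (C0 k). \<phi> = (\<lambda>x. x + apply_bcontfun u x)} \<inter> Diff1"

definition DiffM :: "nat \<Rightarrow> ((real^'n) \<Rightarrow> (real^'n), unit, (real^'n) \<Rightarrow>\<^sub>C (real^'n)) mfd" where
  "DiffM k = \<lparr>pts = DiffC0 k, model = C0 k, idx = UNIV, cdom = (\<lambda>_. DiffC0 k),
     cmap = (\<lambda>_ \<phi>. Bcontfun (\<lambda>x. \<phi> x - x))\<rparr>"

definition DiffG :: "nat \<Rightarrow> ((real^'n) \<Rightarrow> (real^'n)) monoid" where
  "DiffG k = \<lparr>carrier = DiffC0 k, mult = (\<circ>), one = id\<rparr>"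

text \<open>The identification of \<open>C_0^k\<close> with the tangent space of the diffeomorphism group at \<open>id\<close>.\<close>

definition tid :: "((real^'n) \<Rightarrow>\<^sub>C (real^'n)) \<Rightarrow>
    ((real^'n) \<Rightarrow> (real^'n), unit, (real^'n) \<Rightarrow>\<^sub>C (real^'n)) tvec" where
  "tid u = (id, \<lambda>_. u)"

section \<open>The semidirect product and its action\<close>

definition semidirect ::
  "('g, 'z) monoid_scheme \<Rightarrow> ('g \<Rightarrow> ((real^'n) \<Rightarrow> (real^'n)) \<Rightarrow> ((real^'n) \<Rightarrow> (real^'n))) \<Rightarrow> nat \<Rightarrow>
     ('g \<times> ((real^'n) \<Rightarrow> (real^'n))) monoid" where
  "semidirect G \<rho> k = \<lparr>carrier = carrier G \<times> DiffC0 k,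
     mult = (\<lambda>(g, \<phi>) (g', \<phi>'). (g \<otimes>\<^bsub>G\<^esub> g', \<rho> g' \<phi> \<circ> \<phi>')),
     one = (\<one>\<^bsub>G\<^esub>, id)\<rparr>"

definition semi_act ::
  "('g, 'z) monoid_scheme \<Rightarrow> ('g \<Rightarrow> 'q \<Rightarrow> 'q) \<Rightarrow> (((real^'n) \<Rightarrow> (real^'n)) \<Rightarrow> 'q \<Rightarrow> 'q) \<Rightarrow>
     'g \<times> ((real^'n) \<Rightarrow> (real^'n)) \<Rightarrow> 'g \<times> 'q \<Rightarrow> 'g \<times> 'q" where
  "semi_act G aG aD = (\<lambda>(g, \<phi>) (h, q). (g \<otimes>\<^bsub>G\<^esub> h, aG g (aD \<phi> q)))"

text \<open>\<open>u \<cdot> q\<close>, the differential at \<open>id\<close> of \<open>\<phi> \<mapsto> \<phi> \<cdot> q\<close> on the group of order \<open>k\<close>.\<close>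

definition infD :: "nat \<Rightarrow> ('q, 'j, 'e::real_vector) mfd \<Rightarrow> (((real^'n) \<Rightarrow> (real^'n)) \<Rightarrow> 'q \<Rightarrow> 'q) \<Rightarrow>
    ((real^'n) \<Rightarrow>\<^sub>C (real^'n)) \<Rightarrow> 'q \<Rightarrow> ('q, 'j, 'e) tvec" where
  "infD k Q aD u q = tmap (DiffM k) Q (\<lambda>\<phi>. aD \<phi> q) (tid u)"

text \<open>\<open>X \<cdot> q\<close>, the differential at the identity of \<open>g \<mapsto> g \<cdot> q\<close>.\<close>

definition infG :: "('g, 'i, 'a::real_vector) mfd \<Rightarrow> ('q, 'j, 'e::real_vector) mfd \<Rightarrow>
    ('g \<Rightarrow> 'q \<Rightarrow> 'q) \<Rightarrow> ('g, 'i, 'a) tvec \<Rightarrow> 'q \<Rightarrow> ('q, 'j, 'e) tvec" where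
  "infG MG Q aG X q = tmap MG Q (\<lambda>g. aG g q) X"

text \<open>\<open>X h\<close>, the differential at the identity of the right translation \<open>g \<mapsto> g h\<close>.\<close>

definition rtransl :: "('g, 'z) monoid_scheme \<Rightarrow> ('g, 'i, 'a::real_vector) mfd \<Rightarrow>
    ('g, 'i, 'a) tvec \<Rightarrow> 'g \<Rightarrow> ('g, 'i, 'a) tvec" where
  "rtransl G MG X h = tmap MG MG (\<lambda>g. g \<otimes>\<^bsub>G\<^esub> h) X"

end

theory Submission
  imports Defs
begin

text \<open>
  In charts the action is composed of the multiplication of \<open>G\<close>, the action of \<open>G\<close> on \<open>Q\<close> and the
  action of the diffeomorphisms on \<open>Q\<close>, so its regularity follows from the chain rule for \<open>C^l\<close> maps
  between normed spaces; \<open>\<rho>\<close> enters only through the algebra of the semidirect product.  The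
  infinitesimal action is a sum of partial derivatives.  The two that come from \<open>G\<close> are derivatives
  of smooth maps in a fixed point of \<open>G\<close> and are jointly smooth, because the derivative of a \<open>C^(l+1)\<close>
  map is of class \<open>C^l\<close> in point and direction; the third one is of class \<open>C^l\<close> by assumption.
\<close>

text \<open>The spaces \<open>C0 k\<close> are carriers inside one type of bounded continuous
  functions, so calculus is set up for subspaces with a norm of their own. Derivatives there are
  determined only at interior points, and every comparison of charts or tangent vectors rests on
  that uniqueness. Hence the u for which id + u is a diffeomorphism must be shown to form an open
  set of \<open>C0 k\<close>. The bridge is the inequality c |x - y| <= |f x - f y| with c > 0:
  every f = id + u in \<open>Diff1\<close> with u in \<open>C0 k\<close> satisfies it, it survives
  C^1-small changes of u with c/2 in place of c, and conversely it forces a C^1 map of R^n to lie in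
  \<open>Diff1\<close>. The splitting of the infinitesimal action is linearity of one derivative:
  (v, u) = (v, 0) + (0, u), and on each of the two slices through the identity the factor held fixed
  acts trivially. Tangent vectors are families over all charts tied together by the derivatives of
  the chart changes, so their equality needs to be checked in one chart only.\<close>

section \<open>Normed spaces on a carrier and their open sets\<close>

locale normed =
  fixes E :: "'v::real_vector nspace"
  assumes sub: "subspace (nscar E)"
    and nonneg [simp]: "x \<in> nscar E \<Longrightarrow> 0 \<le> nsnorm E x"
    and eq0: "x \<in> nscar E \<Longrightarrow> nsnorm E x = 0 \<longleftrightarrow> x = 0"
    and hom: "x \<in> nscar E \<Longrightarrow> nsnorm E (c *\<^sub>R x) = \<bar>c\<bar> * nsnorm E x"
    and tri: "x \<in> nscar E \<Longrightarrow> y \<in> nscar E \<Longrightarrow> nsnorm E (x + y) \<le> nsnorm E x + nsnorm E y"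
begin

lemma zero_in [simp, intro]: "0 \<in> nscar E" by (rule subspace_0[OF sub])
lemma add_in [simp, intro]: "x \<in> nscar E \<Longrightarrow> y \<in> nscar E \<Longrightarrow> x + y \<in> nscar E"
  by (rule subspace_add[OF sub])
lemma diff_in [simp, intro]: "x \<in> nscar E \<Longrightarrow> y \<in> nscar E \<Longrightarrow> x - y \<in> nscar E"
  by (rule subspace_diff[OF sub])
lemma scale_in [simp, intro]: "x \<in> nscar E \<Longrightarrow> c *\<^sub>R x \<in> nscar E"
  by (rule subspace_scale[OF sub])
lemma norm0 [simp]: "nsnorm E 0 = 0" using eq0 by simp
lemma norm_minus: "x \<in> nscar E \<Longrightarrow> nsnorm E (- x) = nsnorm E x"
  using hom[of x "-1"] by simp
lemma norm_commute: "x \<in> nscar E \<Longrightarrow> y \<in> nscar E \<Longrightarrow> nsnorm E (x - y) = nsnorm E (y - x)"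
  using norm_minus[of "x - y"] by simp
lemma tri_diff: "x \<in> nscar E \<Longrightarrow> y \<in> nscar E \<Longrightarrow> nsnorm E (x - y) \<le> nsnorm E x + nsnorm E y"
  using tri[of x "-y"] norm_minus[of y] scale_in[of y "-1"] by simp
lemma tri3: "x \<in> nscar E \<Longrightarrow> y \<in> nscar E \<Longrightarrow> z \<in> nscar E \<Longrightarrow>
    nsnorm E (x - z) \<le> nsnorm E (x - y) + nsnorm E (y - z)"
  using tri[of "x - y" "y - z"] by simp

end

lemma banach_normed: "banach_space E \<Longrightarrow> normed E"
  unfolding banach_space_def by unfold_locales auto

text \<open>The open sets of \<open>ntop E\<close> in terms of the norm alone, without the cut-off
  that \<open>ndist\<close> makes off the carrier.\<close>

definition nopen :: "'v::real_vector nspace \<Rightarrow> 'v set \<Rightarrow> bool" where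
  "nopen E V \<longleftrightarrow> V \<subseteq> nscar E \<and> (\<forall>x\<in>V. \<exists>\<delta>>0. \<forall>y\<in>nscar E. nsnorm E (y - x) < \<delta> \<longrightarrow> y \<in> V)"

lemma normed_metric: assumes "normed E" shows "Metric_space (nscar E) (ndist E)"
proof -
  interpret normed E by fact
  show ?thesis
    by unfold_locales (auto simp: ndist_def norm_commute eq0 tri3)
qed

lemma openin_ntop: assumes "normed E" shows "openin (ntop E) V \<longleftrightarrow> nopen E V"
proof -
  interpret normed E by fact
  interpret M: Metric_space "nscar E" "ndist E" by (rule normed_metric[OF assms])
  have "M.mball x r \<subseteq> V \<longleftrightarrow> (\<forall>y\<in>nscar E. nsnorm E (y - x) < r \<longrightarrow> y \<in> V)" if "x \<in> nscar E" for x r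
    using that by (auto simp: M.mball_def ndist_def norm_commute[of x])
  then show ?thesis
    unfolding ntop_def M.openin_mtopology nopen_def by (meson subset_iff)
qed

lemma nopen_Int: "nopen E V \<Longrightarrow> nopen E W \<Longrightarrow> nopen E (V \<inter> W)"
  unfolding nopen_def
  apply (intro conjI ballI)
   apply blast
  subgoal for x
    apply (elim conjE)
    apply (drule bspec[of V _ x], blast)
    apply (drule bspec[of W _ x], blast)
    apply (elim exE conjE)
    subgoal for d e by (rule exI[of _ "min d e"]) auto
    done
  done

lemma nopen_local: "(\<And>x. x \<in> U \<Longrightarrow> \<exists>W\<subseteq>U. x \<in> W \<and> nopen E W) \<Longrightarrow> nopen E U"
  unfolding nopen_def by (meson subset_iff)

lemma nopen_car: "nopen E (nscar E)"
  unfolding nopen_def by (auto intro: exI[of _ 1])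

lemma nopen_sub: "nopen E V \<Longrightarrow> V \<subseteq> nscar E" by (auto simp: nopen_def)

section \<open>Relative neighbourhoods of a point\<close>

text \<open>A filter, so that several epsilon-delta estimates combine by
  \<open>eventually_elim\<close> without minima of radii. The point x is not removed, since
  remainder terms vanish there for a linear derivative.\<close>

definition nbhd :: "'v::real_vector nspace \<Rightarrow> 'v set \<Rightarrow> 'v \<Rightarrow> 'v filter" where
  "nbhd E U x = (INF \<delta>\<in>{0<..}. principal {y\<in>U. nsnorm E (y - x) < \<delta>})"

lemma ev_nbhd: "eventually P (nbhd E U x) \<longleftrightarrow> (\<exists>\<delta>>0. \<forall>y\<in>U. nsnorm E (y - x) < \<delta> \<longrightarrow> P y)"
  unfolding nbhd_def
  apply (subst eventually_INF_base)
    apply (force)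
  subgoal for a b by (rule bexI[of _ "min a b"]) auto
  apply (auto simp: eventually_principal)
  done

lemma ev_nbhd_in: "eventually (\<lambda>y. y \<in> U) (nbhd E U x)"
  unfolding ev_nbhd by (auto intro: exI[of _ 1])

lemma ev_nbhd_lt: "e > 0 \<Longrightarrow> eventually (\<lambda>y. nsnorm E (y - x) < e) (nbhd E U x)"
  unfolding ev_nbhd by auto

lemma nbhd_mono: "W \<subseteq> U \<Longrightarrow> nbhd E W x \<le> nbhd E U x"
  unfolding le_filter_def ev_nbhd by blast

text \<open>An open part W of U contains a whole ball of the carrier around x, so U and W have the
  same small neighbourhoods of x. This makes all later notions local.\<close>

lemma nbhd_local: assumes "nopen E W" "x \<in> W" "U \<subseteq> nscar E" "W \<subseteq> U" shows "nbhd E W x = nbhd E U x"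
proof (rule antisym)
  show "nbhd E W x \<le> nbhd E U x" by (rule nbhd_mono) fact
  obtain d where d: "d > 0" "\<forall>y\<in>nscar E. nsnorm E (y - x) < d \<longrightarrow> y \<in> W"
    using assms unfolding nopen_def by blast
  show "nbhd E U x \<le> nbhd E W x" unfolding le_filter_def ev_nbhd
  proof (intro allI impI)
    fix P assume "\<exists>\<delta>>0. \<forall>y\<in>W. nsnorm E (y - x) < \<delta> \<longrightarrow> P y"
    then obtain e where "e > 0" "\<forall>y\<in>W. nsnorm E (y - x) < e \<longrightarrow> P y" by blast
    then show "\<exists>\<delta>>0. \<forall>y\<in>U. nsnorm E (y - x) < \<delta> \<longrightarrow> P y"
      using d assms by (intro exI[of _ "min d e"]) auto
  qed
qed

abbreviation pnorm :: "'v nspace \<Rightarrow> 'v list \<Rightarrow> real" where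
  "pnorm E vs \<equiv> prod_list (map (nsnorm E) vs)"

lemma args_Nil [simp]: "vs \<in> args E 0 \<longleftrightarrow> vs = []" by (auto simp: args_def)
lemma args_Cons [simp]: "v # vs \<in> args E (Suc m) \<longleftrightarrow> v \<in> nscar E \<and> vs \<in> args E m" by (auto simp: args_def)
lemma args_SucE: "vs \<in> args E (Suc m) \<Longrightarrow> \<exists>v vs'. vs = v # vs' \<and> v \<in> nscar E \<and> vs' \<in> args E m"
  by (cases vs) (auto simp: args_def)
lemma args_upd [simp, intro]: "vs \<in> args E m \<Longrightarrow> v \<in> nscar E \<Longrightarrow> vs[i := v] \<in> args E m"
  using set_update_subset_insert[of vs i v] by (auto simp: args_def)

lemma (in normed) pnorm_nonneg: "vs \<in> args E m \<Longrightarrow> 0 \<le> pnorm E vs"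
  by (induction vs arbitrary: m) (auto simp: args_def)

section \<open>Mixed multilinear maps\<close>

text \<open>
  The derivatives of a composite \<open>g \<circ> f\<close> arise from those of \<open>g\<close> by inserting derivatives of \<open>f\<close> into
  some of the arguments.  A mixed multilinear map keeps the arguments \<open>ws\<close> in \<open>F\<close> that are still to be
  filled in apart from the arguments \<open>vs\<close> in \<open>E\<close>.  All the maps that occur then have the same type, and
  the chain rule is an induction on the order which never meets Faa di Bruno's formula.
\<close>

definition multilin :: "'e::real_vector nspace \<Rightarrow> 'f::real_vector nspace \<Rightarrow> nat \<Rightarrow> ('e list \<Rightarrow> 'f) \<Rightarrow> bool" where
  "multilin E F m T \<longleftrightarrow>
     (\<forall>vs\<in>args E m. T vs \<in> nscar F) \<and>
     (\<forall>vs\<in>args E m. \<forall>i<m. \<forall>v\<in>nscar E. \<forall>w\<in>nscar E. \<forall>a b.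
        T (vs[i := a *\<^sub>R v + b *\<^sub>R w]) = a *\<^sub>R T (vs[i := v]) + b *\<^sub>R T (vs[i := w]))"

text \<open>The values are required to lie in the carrier of \<open>G\<close>, unlike in
  \<open>opnorm_le\<close>: the triangle inequality is available only there, so two bounds can be
  added without further membership conditions.\<close>

definition mixed_le :: "'e nspace \<Rightarrow> 'f nspace \<Rightarrow> 'g nspace \<Rightarrow> nat \<Rightarrow> nat \<Rightarrow> ('f list \<Rightarrow> 'e list \<Rightarrow> 'g) \<Rightarrow> real \<Rightarrow> bool" where
  "mixed_le E F G m n T c \<longleftrightarrow> (\<forall>ws\<in>args F m. \<forall>vs\<in>args E n.
      T ws vs \<in> nscar G \<and> nsnorm G (T ws vs) \<le> c * (pnorm F ws * pnorm E vs))"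

definition mixed_ml :: "'e::real_vector nspace \<Rightarrow> 'f::real_vector nspace \<Rightarrow> 'g::real_vector nspace \<Rightarrow> nat \<Rightarrow> nat
    \<Rightarrow> ('f list \<Rightarrow> 'e list \<Rightarrow> 'g) \<Rightarrow> bool" where
  "mixed_ml E F G m n T \<longleftrightarrow> (\<forall>vs\<in>args E n. multilin F G m (\<lambda>ws. T ws vs)) \<and>
     (\<forall>ws\<in>args F m. multilin E G n (T ws)) \<and> (\<exists>c. mixed_le E F G m n T c)"

lemma multilin_cong: assumes "normed E" "\<And>vs. vs \<in> args E m \<Longrightarrow> T vs = T' vs" shows "multilin E F m T \<longleftrightarrow> multilin E F m T'"
proof -
  interpret normed E by fact
  show ?thesis using assms(2) by (auto simp: multilin_def)
qed

lemma mixed_le_cong: "(\<And>ws vs. ws \<in> args F m \<Longrightarrow> vs \<in> args E n \<Longrightarrow> T ws vs = T' ws vs) \<Longrightarrow>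
   mixed_le E F G m n T c \<longleftrightarrow> mixed_le E F G m n T' c"
  by (auto simp: mixed_le_def)

lemma mixed_ml_cong: assumes "normed E" "normed F"
    "\<And>ws vs. ws \<in> args F m \<Longrightarrow> vs \<in> args E n \<Longrightarrow> T ws vs = T' ws vs"
  shows "mixed_ml E F G m n T \<longleftrightarrow> mixed_ml E F G m n T'"
proof -
  have "multilin F G m (\<lambda>ws. T ws vs) \<longleftrightarrow> multilin F G m (\<lambda>ws. T' ws vs)" if "vs \<in> args E n" for vs
    by (rule multilin_cong) (use assms that in auto)
  moreover have "multilin E G n (T ws) \<longleftrightarrow> multilin E G n (T' ws)" if "ws \<in> args F m" for ws
    by (rule multilin_cong) (use assms that in auto)
  moreover have "mixed_le E F G m n T c \<longleftrightarrow> mixed_le E F G m n T' c" for c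
    by (rule mixed_le_cong) (use assms in auto)
  ultimately show ?thesis unfolding mixed_ml_def by auto
qed

lemma mixed_ml_in: "mixed_ml E F G m n T \<Longrightarrow> ws \<in> args F m \<Longrightarrow> vs \<in> args E n \<Longrightarrow> T ws vs \<in> nscar G"
  by (auto simp: mixed_ml_def mixed_le_def)

lemma mixed_ml_lin0w: assumes "mixed_ml E F G (Suc m) n T" "v \<in> nscar F" "w \<in> nscar F" "ws \<in> args F m" "vs \<in> args E n"
  shows "T ((a *\<^sub>R v + b *\<^sub>R w) # ws) vs = a *\<^sub>R T (v # ws) vs + b *\<^sub>R T (w # ws) vs"
proof -
  have "multilin F G (Suc m) (\<lambda>ws. T ws vs)" using assms by (auto simp: mixed_ml_def)
  moreover have "v # ws \<in> args F (Suc m)" using assms by auto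
  ultimately show ?thesis using assms unfolding multilin_def by fastforce
qed

lemma mixed_ml_lin0v: assumes "mixed_ml E F G m (Suc n) T" "v \<in> nscar E" "w \<in> nscar E" "ws \<in> args F m" "vs \<in> args E n"
  shows "T ws ((a *\<^sub>R v + b *\<^sub>R w) # vs) = a *\<^sub>R T ws (v # vs) + b *\<^sub>R T ws (w # vs)"
proof -
  have "multilin E G (Suc n) (T ws)" using assms by (auto simp: mixed_ml_def)
  moreover have "v # vs \<in> args E (Suc n)" using assms by auto
  ultimately show ?thesis using assms unfolding multilin_def by fastforce
qed

text \<open>The roles stay fixed: differentiation takes place in E, open arguments lie in F, values
  in G.\<close>

locale normed3 = E: normed E + F: normed F + G: normed G
  for E :: "'e::real_vector nspace" and F :: "'f::real_vector nspace" and G :: "'g::real_vector nspace"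
begin

lemma pn2_nonneg: "ws \<in> args F m \<Longrightarrow> vs \<in> args E n \<Longrightarrow> 0 \<le> pnorm F ws * pnorm E vs"
  by (simp add: E.pnorm_nonneg F.pnorm_nonneg)

lemma mixed_le_mono: "mixed_le E F G m n T c \<Longrightarrow> c \<le> d \<Longrightarrow> mixed_le E F G m n T d"
  unfolding mixed_le_def using pn2_nonneg by (meson mult_right_mono order_trans)

lemma mixed_le_add: "mixed_le E F G m n T c \<Longrightarrow> mixed_le E F G m n T' d \<Longrightarrow> mixed_le E F G m n (\<lambda>ws vs. T ws vs + T' ws vs) (c + d)"
  unfolding mixed_le_def
  apply (intro ballI conjI)
   apply (auto)[1]
  apply (rule order_trans[OF G.tri])
  apply (auto simp: distrib_right intro: add_mono)
  done

text \<open>Bounds are later multiplied with other estimates, where a negative one would reverse the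
  inequality.\<close>

lemma mixed_ml_bound: assumes "mixed_ml E F G m n T" shows "\<exists>c\<ge>0. mixed_le E F G m n T c"
proof -
  obtain c where "mixed_le E F G m n T c" using assms by (auto simp: mixed_ml_def)
  then have "mixed_le E F G m n T (max c 0)" by (rule mixed_le_mono) simp
  then show ?thesis by (intro exI[of _ "max c 0"]) auto
qed

lemma multilin_add: "multilin F G m T \<Longrightarrow> multilin F G m T' \<Longrightarrow> multilin F G m (\<lambda>vs. T vs + T' vs)"
  unfolding multilin_def by (auto simp: algebra_simps)

lemma multilin_add': "multilin E G m T \<Longrightarrow> multilin E G m T' \<Longrightarrow> multilin E G m (\<lambda>vs. T vs + T' vs)"
  unfolding multilin_def by (auto simp: algebra_simps)

lemma mixed_ml_add: "mixed_ml E F G m n T \<Longrightarrow> mixed_ml E F G m n T' \<Longrightarrow> mixed_ml E F G m n (\<lambda>ws vs. T ws vs + T' ws vs)"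
  unfolding mixed_ml_def
  apply (elim conjE exE)
  apply (intro conjI ballI)
    apply (rule multilin_add; blast)
   apply (rule multilin_add'; blast)
  apply (rule exI, rule mixed_le_add; assumption)
  done

lemma mixed_ml_scale: assumes "mixed_ml E F G m n T" shows "mixed_ml E F G m n (\<lambda>ws vs. c *\<^sub>R T ws vs)"
proof -
  obtain d where "mixed_le E F G m n T d" using assms by (auto simp: mixed_ml_def)
  then have "mixed_le E F G m n (\<lambda>ws vs. c *\<^sub>R T ws vs) (\<bar>c\<bar> * d)"
    unfolding mixed_le_def by (auto simp: G.hom mult.assoc mult_left_mono)
  then show ?thesis using assms unfolding mixed_ml_def multilin_def by (auto simp: algebra_simps)
qed

lemma mixed_ml_diff: assumes "mixed_ml E F G m n T" "mixed_ml E F G m n T'" shows "mixed_ml E F G m n (\<lambda>ws vs. T ws vs - T' ws vs)"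
  using mixed_ml_add[OF assms(1) mixed_ml_scale[OF assms(2), of "-1"]] by simp

text \<open>In a remainder estimate the newest direction is the fixed vector y - x; with it frozen,
  the derivative is again a mixed map of the order of the original one.\<close>

lemma mixed_ml_tail: assumes T: "mixed_ml E F G m (Suc n) T" and h: "h \<in> nscar E" shows "mixed_ml E F G m n (\<lambda>ws vs. T ws (h # vs))"
proof -
  obtain c where c: "mixed_le E F G m (Suc n) T c" using assms by (auto simp: mixed_ml_def)
  have "mixed_le E F G m n (\<lambda>ws vs. T ws (h # vs)) (c * nsnorm E h)" unfolding mixed_le_def
  proof (intro ballI)
    fix ws vs assume "ws \<in> args F m" "vs \<in> args E n"
    then show "T ws (h # vs) \<in> nscar G \<and> nsnorm G (T ws (h # vs)) \<le> c * nsnorm E h * (pnorm F ws * pnorm E vs)"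
      using c[unfolded mixed_le_def, rule_format, of ws "h # vs"] h by (auto simp: mult_ac)
  qed
  moreover have "multilin F G m (\<lambda>ws. T ws (h # vs))" if "vs \<in> args E n" for vs
    using T h that unfolding mixed_ml_def by auto
  moreover have "multilin E G n (\<lambda>vs. T ws (h # vs))" if w: "ws \<in> args F m" for ws
    unfolding multilin_def
  proof (intro conjI ballI allI impI)
    fix vs i v u a b assume *: "vs \<in> args E n" "i < n" "v \<in> nscar E" "u \<in> nscar E"
    have "multilin E G (Suc n) (T ws)" using T w unfolding mixed_ml_def by auto
    moreover have "h # vs \<in> args E (Suc n)" "Suc i < Suc n" using * h by auto
    ultimately have "T ws ((h # vs)[Suc i := a *\<^sub>R v + b *\<^sub>R u]) = a *\<^sub>R T ws ((h # vs)[Suc i := v]) + b *\<^sub>R T ws ((h # vs)[Suc i := u])"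
      using *(3,4) unfolding multilin_def by blast
    then show "T ws (h # vs[i := a *\<^sub>R v + b *\<^sub>R u]) = a *\<^sub>R T ws (h # vs[i := v]) + b *\<^sub>R T ws (h # vs[i := u])" by simp
  next
    fix vs assume "vs \<in> args E n" then show "T ws (h # vs) \<in> nscar G" using mixed_ml_in[OF T w] h by auto
  qed
  ultimately show ?thesis unfolding mixed_ml_def by blast
qed

end

section \<open>Mixed maps of class \<open>C^p\<close>\<close>

definition mixed_cont where
  "mixed_cont E F G U m n R \<longleftrightarrow> (\<forall>x\<in>U. \<forall>\<epsilon>>0. \<forall>\<^sub>F y in nbhd E U x. mixed_le E F G m n (\<lambda>ws vs. R y ws vs - R x ws vs) \<epsilon>)"

text \<open>The remainder is measured in the operator norm, i.e. uniformly in all other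
  arguments.\<close>

definition mixed_diff where
  "mixed_diff E F G U m n R R' \<longleftrightarrow> (\<forall>x\<in>U. \<forall>\<epsilon>>0. \<forall>\<^sub>F y in nbhd E U x.
      mixed_le E F G m n (\<lambda>ws vs. R y ws vs - R x ws vs - R' x ws ((y - x) # vs)) (\<epsilon> * nsnorm E (y - x)))"

text \<open>Each order only claims that some derivative exists, itself of class one lower. Product
  and chain rule then become inductions on p over all maps at once, whereas the sequences of
  derivatives in \<open>Ck_on\<close> would have to be written down explicitly.\<close>

primrec mixed_Ck :: "'e::real_vector nspace \<Rightarrow> 'f::real_vector nspace \<Rightarrow> 'g::real_vector nspace \<Rightarrow> 'e set \<Rightarrow> nat \<Rightarrow>
    nat \<Rightarrow> nat \<Rightarrow> ('e \<Rightarrow> 'f list \<Rightarrow> 'e list \<Rightarrow> 'g) \<Rightarrow> bool" where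
  "mixed_Ck E F G U 0 = (\<lambda>m n R. (\<forall>x\<in>U. mixed_ml E F G m n (R x)) \<and> mixed_cont E F G U m n R)"
| "mixed_Ck E F G U (Suc p) = (\<lambda>m n R. (\<forall>x\<in>U. mixed_ml E F G m n (R x)) \<and>
     (\<exists>R'. mixed_diff E F G U m n R R' \<and> mixed_Ck E F G U p m (Suc n) R'))"

lemma mixed_Ck_ml: "mixed_Ck E F G U p m n R \<Longrightarrow> x \<in> U \<Longrightarrow> mixed_ml E F G m n (R x)"
  by (cases p) auto

lemma mixed_Ck_SucE: assumes "mixed_Ck E F G U (Suc p) m n R"
  obtains R' where "mixed_diff E F G U m n R R'" "mixed_Ck E F G U p m (Suc n) R'"
  using assms unfolding mixed_Ck.simps by blast

lemma mixed_Ck_SucI: "(\<And>x. x \<in> U \<Longrightarrow> mixed_ml E F G m n (R x)) \<Longrightarrow> mixed_diff E F G U m n R R' \<Longrightarrow> mixed_Ck E F G U p m (Suc n) R' \<Longrightarrow> mixed_Ck E F G U (Suc p) m n R"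
  unfolding mixed_Ck.simps by blast

lemma mixed_cont_cong:
  assumes "\<And>x ws vs. x \<in> U \<Longrightarrow> ws \<in> args F m \<Longrightarrow> vs \<in> args E n \<Longrightarrow> R x ws vs = S x ws vs"
    "mixed_cont E F G U m n R"
  shows "mixed_cont E F G U m n S"
  unfolding mixed_cont_def
proof (intro ballI allI impI)
  fix x e assume "x \<in> U" "(e::real) > 0"
  then have "\<forall>\<^sub>F y in nbhd E U x. mixed_le E F G m n (\<lambda>ws vs. R y ws vs - R x ws vs) e"
    using assms(2) unfolding mixed_cont_def by blast
  then show "\<forall>\<^sub>F y in nbhd E U x. mixed_le E F G m n (\<lambda>ws vs. S y ws vs - S x ws vs) e"
    using ev_nbhd_in
    by eventually_elim (use assms(1) \<open>x \<in> U\<close> in \<open>auto simp: mixed_le_def\<close>)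
qed

lemma mixed_diff_cong:
  assumes "\<And>x ws vs. x \<in> U \<Longrightarrow> ws \<in> args F m \<Longrightarrow> vs \<in> args E n \<Longrightarrow> R x ws vs = S x ws vs"
    "U \<subseteq> nscar E" "normed E"
    "\<And>x ws vs. x \<in> U \<Longrightarrow> ws \<in> args F m \<Longrightarrow> vs \<in> args E (Suc n) \<Longrightarrow> R' x ws vs = S' x ws vs"
    "mixed_diff E F G U m n R R'"
  shows "mixed_diff E F G U m n S S'"
  unfolding mixed_diff_def
proof (intro ballI allI impI)
  interpret normed E by fact
  fix x e assume "x \<in> U" "(e::real) > 0"
  then have "\<forall>\<^sub>F y in nbhd E U x. mixed_le E F G m n (\<lambda>ws vs. R y ws vs - R x ws vs - R' x ws ((y - x) # vs)) (e * nsnorm E (y - x))"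
    using assms(5) unfolding mixed_diff_def by blast
  then show "\<forall>\<^sub>F y in nbhd E U x. mixed_le E F G m n (\<lambda>ws vs. S y ws vs - S x ws vs - S' x ws ((y - x) # vs)) (e * nsnorm E (y - x))"
    using ev_nbhd_in
  proof eventually_elim
    case (elim y)
    then have "y - x \<in> nscar E" using \<open>x \<in> U\<close> assms(2) by auto
    with elim show ?case using assms(1,4) \<open>x \<in> U\<close> by (auto simp: mixed_le_def)
  qed
qed

lemma mixed_Ck_cong:
  assumes eq: "\<And>x ws vs. x \<in> U \<Longrightarrow> ws \<in> args F m \<Longrightarrow> vs \<in> args E n \<Longrightarrow> R x ws vs = S x ws vs"
    and U: "U \<subseteq> nscar E" and E: "normed E" and F: "normed F"
    and mixed_Ck: "mixed_Ck E F G U p m n R"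
  shows "mixed_Ck E F G U p m n S"
proof -
  have b: "mixed_ml E F G m n (S x)" if "x \<in> U" for x
  proof -
    have "mixed_ml E F G m n (R x) \<longleftrightarrow> mixed_ml E F G m n (S x)" by (rule mixed_ml_cong) (use E F eq that in auto)
    then show ?thesis using mixed_Ck_ml[OF mixed_Ck that] by simp
  qed
  show ?thesis
  proof (cases p)
    case 0
    then show ?thesis using mixed_Ck mixed_cont_cong[OF eq] b by auto
  next
    case (Suc q)
    then obtain R' where "mixed_diff E F G U m n R R'" "mixed_Ck E F G U q m (Suc n) R'" using mixed_Ck by auto
    moreover have "mixed_diff E F G U m n S R'"
      by (rule mixed_diff_cong[OF _ U E refl]) (use eq calculation in auto)
    ultimately show ?thesis using b unfolding Suc by (intro mixed_Ck_SucI) auto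
  qed
qed

context normed3
begin

text \<open>The operator norm c of the derivative bounds the linear term; with remainder constant 1
  the difference is at most (1 + c) |y - x|, whence the radius e / (1 + c).\<close>

lemma mixed_diff_imp_mixed_cont:
  assumes "U \<subseteq> nscar E" "mixed_diff E F G U m n R R'" "\<And>x. x \<in> U \<Longrightarrow> mixed_ml E F G m (Suc n) (R' x)"
  shows "mixed_cont E F G U m n R"
  unfolding mixed_cont_def
proof (intro ballI allI impI)
  fix x e assume x: "x \<in> U" and e: "(e::real) > 0"
  obtain c where c: "c \<ge> 0" "mixed_le E F G m (Suc n) (R' x) c" using mixed_ml_bound assms(3) x by blast
  have "\<forall>\<^sub>F y in nbhd E U x. mixed_le E F G m n (\<lambda>ws vs. R y ws vs - R x ws vs - R' x ws ((y - x) # vs)) (1 * nsnorm E (y - x))"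
    using assms(2) x unfolding mixed_diff_def by (meson zero_less_one)
  moreover have "\<forall>\<^sub>F y in nbhd E U x. nsnorm E (y - x) < e / (1 + c)" by (rule ev_nbhd_lt) (use e c in auto)
  ultimately show "\<forall>\<^sub>F y in nbhd E U x. mixed_le E F G m n (\<lambda>ws vs. R y ws vs - R x ws vs) e"
    using ev_nbhd_in
  proof eventually_elim
    case (elim y)
    have yx: "y - x \<in> nscar E" using elim x assms by auto
    have "mixed_le E F G m n (\<lambda>ws vs. R' x ws ((y - x) # vs)) (c * nsnorm E (y - x))"
      unfolding mixed_le_def
    proof (intro ballI)
      fix ws vs assume "ws \<in> args F m" "vs \<in> args E n"
      then show "R' x ws ((y - x) # vs) \<in> nscar G \<and> nsnorm G (R' x ws ((y - x) # vs)) \<le> c * nsnorm E (y - x) * (pnorm F ws * pnorm E vs)"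
        using c(2)[unfolded mixed_le_def, rule_format, of ws "(y - x) # vs"] yx by (auto simp: mult_ac)
    qed
    from mixed_le_add[OF elim(1) this]
    have "mixed_le E F G m n (\<lambda>ws vs. R y ws vs - R x ws vs) (1 * nsnorm E (y - x) + c * nsnorm E (y - x))" by simp
    moreover have "1 * nsnorm E (y - x) + c * nsnorm E (y - x) \<le> e"
      using elim(2) c(1) by (auto simp: field_simps)
    ultimately show ?case by (rule mixed_le_mono)
  qed
qed

lemma mixed_Ck_mixed_cont: assumes "U \<subseteq> nscar E" "mixed_Ck E F G U p m n R" shows "mixed_cont E F G U m n R"
proof (cases p)
  case 0
  then show ?thesis using assms by auto
next
  case (Suc q)
  then obtain R' where "mixed_diff E F G U m n R R'" "mixed_Ck E F G U q m (Suc n) R'"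
    using assms(2) mixed_Ck_SucE by blast
  then show ?thesis using mixed_diff_imp_mixed_cont[OF assms(1)] mixed_Ck_ml[of E F G U q m "Suc n" R'] by blast
qed

lemma mixed_Ck_SucD: assumes "U \<subseteq> nscar E" shows "mixed_Ck E F G U (Suc p) m n R \<Longrightarrow> mixed_Ck E F G U p m n R"
proof (induction p arbitrary: n R)
  case 0
  have "mixed_cont E F G U m n R" by (rule mixed_Ck_mixed_cont[OF assms 0])
  then show ?case using 0 by auto
next
  case (Suc p)
  from Suc.prems obtain R' where R': "mixed_diff E F G U m n R R'" "mixed_Ck E F G U (Suc p) m (Suc n) R'"
    by (rule mixed_Ck_SucE)
  show ?case by (rule mixed_Ck_SucI[OF mixed_Ck_ml[OF Suc.prems] R'(1) Suc.IH[OF R'(2)]])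
qed

lemma mixed_Ck_le: assumes "U \<subseteq> nscar E" "mixed_Ck E F G U p m n R" "q \<le> p" shows "mixed_Ck E F G U q m n R"
  using assms(3)
proof (induction rule: inc_induct)
  case base
  show ?case by fact
next
  case (step q)
  show ?case by (rule mixed_Ck_SucD[OF assms(1) step.IH])
qed

lemma mixed_cont_add: assumes "mixed_cont E F G U m n R" "mixed_cont E F G U m n S"
  shows "mixed_cont E F G U m n (\<lambda>x ws vs. R x ws vs + S x ws vs)"
  unfolding mixed_cont_def
proof (intro ballI allI impI)
  fix x e assume x: "x \<in> U" and e: "(e::real) > 0"
  have "\<forall>\<^sub>F y in nbhd E U x. mixed_le E F G m n (\<lambda>ws vs. R y ws vs - R x ws vs) (e/2)"
    "\<forall>\<^sub>F y in nbhd E U x. mixed_le E F G m n (\<lambda>ws vs. S y ws vs - S x ws vs) (e/2)"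
    using assms x e unfolding mixed_cont_def by (meson half_gt_zero)+
  then show "\<forall>\<^sub>F y in nbhd E U x. mixed_le E F G m n (\<lambda>ws vs. R y ws vs + S y ws vs - (R x ws vs + S x ws vs)) e"
  proof eventually_elim
    case (elim y)
    from mixed_le_add[OF this] show ?case by (simp add: algebra_simps)
  qed
qed

lemma mixed_diff_add: assumes "mixed_diff E F G U m n R R'" "mixed_diff E F G U m n S S'"
  shows "mixed_diff E F G U m n (\<lambda>x ws vs. R x ws vs + S x ws vs) (\<lambda>x ws vs. R' x ws vs + S' x ws vs)"
  unfolding mixed_diff_def
proof (intro ballI allI impI)
  fix x e assume x: "x \<in> U" and e: "(e::real) > 0"
  have "\<forall>\<^sub>F y in nbhd E U x. mixed_le E F G m n (\<lambda>ws vs. R y ws vs - R x ws vs - R' x ws ((y - x) # vs)) (e/2 * nsnorm E (y - x))"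
    "\<forall>\<^sub>F y in nbhd E U x. mixed_le E F G m n (\<lambda>ws vs. S y ws vs - S x ws vs - S' x ws ((y - x) # vs)) (e/2 * nsnorm E (y - x))"
    using assms x e unfolding mixed_diff_def by (meson half_gt_zero)+
  then show "\<forall>\<^sub>F y in nbhd E U x. mixed_le E F G m n (\<lambda>ws vs. R y ws vs + S y ws vs - (R x ws vs + S x ws vs) -
         (R' x ws ((y - x) # vs) + S' x ws ((y - x) # vs))) (e * nsnorm E (y - x))"
  proof eventually_elim
    case (elim y)
    have "e/2 * nsnorm E (y - x) + e/2 * nsnorm E (y - x) = e * nsnorm E (y - x)" by (simp add: field_simps)
    with mixed_le_add[OF elim] show ?case by (simp add: algebra_simps)
  qed
qed

lemma mixed_Ck_add: assumes "U \<subseteq> nscar E" shows "mixed_Ck E F G U p m n R \<Longrightarrow> mixed_Ck E F G U p m n S \<Longrightarrow>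
    mixed_Ck E F G U p m n (\<lambda>x ws vs. R x ws vs + S x ws vs)"
proof (induction p arbitrary: n R S)
  case 0
  then show ?case by (auto intro: mixed_cont_add mixed_ml_add)
next
  case (Suc p)
  obtain R' where R': "mixed_diff E F G U m n R R'" "mixed_Ck E F G U p m (Suc n) R'"
    using Suc.prems(1) by (rule mixed_Ck_SucE)
  obtain S' where S': "mixed_diff E F G U m n S S'" "mixed_Ck E F G U p m (Suc n) S'"
    using Suc.prems(2) by (rule mixed_Ck_SucE)
  show ?case
    by (rule mixed_Ck_SucI[OF mixed_ml_add[OF mixed_Ck_ml[OF Suc.prems(1)] mixed_Ck_ml[OF Suc.prems(2)]] mixed_diff_add[OF R'(1) S'(1)] Suc.IH[OF R'(2) S'(2)]])
qed

end

section \<open>Insertion into an argument\<close>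

fun sel :: "bool list \<Rightarrow> 'a list \<Rightarrow> 'a list" where
  "sel (b # bs) (v # vs) = (if b then v # sel bs vs else sel bs vs)"
| "sel _ _ = []"

abbreviation nbs :: "bool list \<Rightarrow> bool list" where "nbs bs \<equiv> map Not bs"

abbreviation cnt :: "bool list \<Rightarrow> nat" where "cnt bs \<equiv> length (filter id bs)"

lemma sel_args: "vs \<in> args E (length bs) \<Longrightarrow> sel bs vs \<in> args E (cnt bs)"
  by (induction bs vs rule: sel.induct) (auto simp: args_def)

lemma sel_pnorm: "length vs = length bs \<Longrightarrow> pnorm E vs = pnorm E (sel bs vs) * pnorm E (sel (nbs bs) vs)"
  by (induction bs vs rule: sel.induct) auto

text \<open>Every position of the full list lies in exactly one of the two sublists, so changing one
  argument changes one argument of one factor. This yields linearity of inserted maps slot by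
  slot.\<close>

lemma sel_upd: "length vs = length bs \<Longrightarrow> i < length bs \<Longrightarrow>
   (if bs ! i then (\<exists>r<cnt bs. \<forall>v. sel bs (vs[i := v]) = (sel bs vs)[r := v]) else (\<forall>v. sel bs (vs[i := v]) = sel bs vs))"
proof (induction bs vs arbitrary: i rule: sel.induct)
  case (1 b bs v vs)
  show ?case
  proof (cases i)
    case 0
    then show ?thesis by auto
  next
    case (Suc j)
    then have IH: "if bs ! j then (\<exists>r<cnt bs. \<forall>v. sel bs (vs[j := v]) = (sel bs vs)[r := v]) else (\<forall>v. sel bs (vs[j := v]) = sel bs vs)"
      using 1 by (cases b) auto
    show ?thesis
    proof (cases "bs ! j")
      case True
      with IH obtain r where "r < cnt bs" "\<forall>v. sel bs (vs[j := v]) = (sel bs vs)[r := v]" by auto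
      \<comment> \<open>A marked head moves the position in the sublist up by one.\<close>
      then show ?thesis using Suc True
        by (cases b) (auto intro: exI[of _ "Suc r"] exI[of _ r])
    next
      case False
      then show ?thesis using IH Suc by auto
    qed
  qed
qed auto

lemma sel_upd1: assumes "length vs = length bs" "i < length bs" "bs ! i"
  obtains r where "r < cnt bs" "\<And>v. sel bs (vs[i := v]) = (sel bs vs)[r := v]"
    "\<And>v. sel (nbs bs) (vs[i := v]) = sel (nbs bs) vs"
  using sel_upd[of vs bs i] sel_upd[of vs "nbs bs" i] assms by auto

lemma sel_upd0: assumes "length vs = length bs" "i < length bs" "\<not> bs ! i"
  obtains r where "r < cnt (nbs bs)" "\<And>v. sel (nbs bs) (vs[i := v]) = (sel (nbs bs) vs)[r := v]"
    "\<And>v. sel bs (vs[i := v]) = sel bs vs"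
  using sel_upd[of vs bs i] sel_upd[of vs "nbs bs" i] assms by auto

text \<open>The list \<open>bs\<close> marks the arguments that are handed to \<open>B\<close>.  In this way the newest direction of
  differentiation stays in front, whichever of the two factors it belongs to.\<close>

definition insert_arg :: "bool list \<Rightarrow> ('f list \<Rightarrow> 'e list \<Rightarrow> 'g) \<Rightarrow> ('h list \<Rightarrow> 'e list \<Rightarrow> 'f) \<Rightarrow> 'f list \<Rightarrow> 'e list \<Rightarrow> 'g" where
  "insert_arg bs T B ws vs = T (B [] (sel bs vs) # ws) (sel (nbs bs) vs)"

lemma args_len: "vs \<in> args E n \<Longrightarrow> length vs = n" by (simp add: args_def)

context normed3
begin

text \<open>The product of the norms of all arguments is the product over the marked ones times that
  over the others (\<open>sel_pnorm\<close>), so the operator norms multiply. The sign of c matters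
  because the bound of \<open>B\<close> is used underneath that of \<open>T\<close>.\<close>

lemma insert_arg_bd:
  assumes T: "mixed_le E F G (Suc m) (cnt (nbs bs)) T c" and B: "mixed_le E H F 0 (cnt bs) B d" and c: "0 \<le> c"
  shows "mixed_le E F G m (length bs) (insert_arg bs T B) (c * d)"
  unfolding mixed_le_def
proof (intro ballI)
  fix ws vs assume w: "ws \<in> args F m" and v: "vs \<in> args E (length bs)"
  have s: "sel bs vs \<in> args E (cnt bs)" "sel (nbs bs) vs \<in> args E (cnt (nbs bs))"
    using sel_args[of vs E bs] sel_args[of vs E "nbs bs"] v by auto
  have b: "B [] (sel bs vs) \<in> nscar F" "nsnorm F (B [] (sel bs vs)) \<le> d * pnorm E (sel bs vs)"
    using B s(1) unfolding mixed_le_def by auto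
  have t: "insert_arg bs T B ws vs \<in> nscar G"
    "nsnorm G (insert_arg bs T B ws vs) \<le> c * (pnorm F (B [] (sel bs vs) # ws) * pnorm E (sel (nbs bs) vs))"
    using T[unfolded mixed_le_def, rule_format, of "B [] (sel bs vs) # ws" "sel (nbs bs) vs"] s(2) b(1) w
    by (simp_all add: insert_arg_def)
  note t(2)
  also have "c * (pnorm F (B [] (sel bs vs) # ws) * pnorm E (sel (nbs bs) vs))
     = c * (nsnorm F (B [] (sel bs vs)) * (pnorm F ws * pnorm E (sel (nbs bs) vs)))" by (simp add: mult_ac)
  also have "\<dots> \<le> c * ((d * pnorm E (sel bs vs)) * (pnorm F ws * pnorm E (sel (nbs bs) vs)))"
    by (intro mult_left_mono mult_right_mono c b pn2_nonneg[OF w s(2)])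
  also have "\<dots> = c * d * (pnorm F ws * pnorm E vs)"
    using sel_pnorm[of vs bs E] args_len[OF v] by (simp add: mult_ac)
  finally show "insert_arg bs T B ws vs \<in> nscar G \<and> nsnorm G (insert_arg bs T B ws vs) \<le> c * d * (pnorm F ws * pnorm E vs)"
    using t by auto
qed

lemma insert_arg_ml:
  assumes T: "mixed_ml E F G (Suc m) (cnt (nbs bs)) T" and B: "mixed_ml E H F 0 (cnt bs) B"
  shows "mixed_ml E F G m (length bs) (insert_arg bs T B)"
proof -
  obtain c where c: "c \<ge> 0" "mixed_le E F G (Suc m) (cnt (nbs bs)) T c" using mixed_ml_bound[OF T] by auto
  obtain d where d: "mixed_le E H F 0 (cnt bs) B d" using B unfolding mixed_ml_def by auto
  have bd: "mixed_le E F G m (length bs) (insert_arg bs T B) (c * d)" by (rule insert_arg_bd[OF c(2) d c(1)])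
  have s: "sel bs vs \<in> args E (cnt bs)" "sel (nbs bs) vs \<in> args E (cnt (nbs bs))" if "vs \<in> args E (length bs)" for vs
    using sel_args[of vs E bs] sel_args[of vs E "nbs bs"] that by auto
  have Bm: "multilin E F (cnt bs) (B [])" using B unfolding mixed_ml_def by auto
  have Bin: "B [] vs \<in> nscar F" if "vs \<in> args E (cnt bs)" for vs using Bm that unfolding multilin_def by auto
  have in_G: "insert_arg bs T B ws vs \<in> nscar G" if "ws \<in> args F m" "vs \<in> args E (length bs)" for ws vs
    using bd that unfolding mixed_le_def by auto
  have "multilin F G m (\<lambda>ws. insert_arg bs T B ws vs)" if v: "vs \<in> args E (length bs)" for vs
    unfolding multilin_def
  proof (intro conjI ballI allI impI)
    fix ws i v w a b assume *: "ws \<in> args F m" "i < m" "v \<in> nscar F" "w \<in> nscar F"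
    have "multilin F G (Suc m) (\<lambda>ws. T ws (sel (nbs bs) vs))" using T s[OF v] unfolding mixed_ml_def by auto
    moreover have "B [] (sel bs vs) # ws \<in> args F (Suc m)" using * Bin s[OF v] by auto
    moreover have "Suc i < Suc m" using * by auto
    ultimately have "T ((B [] (sel bs vs) # ws)[Suc i := a *\<^sub>R v + b *\<^sub>R w]) (sel (nbs bs) vs) =
        a *\<^sub>R T ((B [] (sel bs vs) # ws)[Suc i := v]) (sel (nbs bs) vs) + b *\<^sub>R T ((B [] (sel bs vs) # ws)[Suc i := w]) (sel (nbs bs) vs)"
      using *(3,4) unfolding multilin_def by blast
    then show "insert_arg bs T B (ws[i := a *\<^sub>R v + b *\<^sub>R w]) vs = a *\<^sub>R insert_arg bs T B (ws[i := v]) vs + b *\<^sub>R insert_arg bs T B (ws[i := w]) vs"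
      unfolding insert_arg_def by simp
  qed (use in_G v in auto)
  moreover have "multilin E G (length bs) (insert_arg bs T B ws)" if w: "ws \<in> args F m" for ws
    unfolding multilin_def
  proof (intro conjI ballI allI impI)
    fix vs i v u a b assume *: "vs \<in> args E (length bs)" "i < length bs" "v \<in> nscar E" "u \<in> nscar E"
    show "insert_arg bs T B ws (vs[i := a *\<^sub>R v + b *\<^sub>R u]) = a *\<^sub>R insert_arg bs T B ws (vs[i := v]) + b *\<^sub>R insert_arg bs T B ws (vs[i := u])"
    \<comment> \<open>A marked argument acts linearly through \<open>B\<close> and then through the
      first slot of \<open>T\<close>; an unmarked one directly through \<open>T\<close>.\<close>
    proof (cases "bs ! i")
      case True
      obtain r where r: "r < cnt bs" "\<And>v. sel bs (vs[i := v]) = (sel bs vs)[r := v]"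
         "\<And>v. sel (nbs bs) (vs[i := v]) = sel (nbs bs) vs" using sel_upd1[OF args_len[OF *(1)] *(2) True] by metis
      have "B [] ((sel bs vs)[r := a *\<^sub>R v + b *\<^sub>R u]) = a *\<^sub>R B [] ((sel bs vs)[r := v]) + b *\<^sub>R B [] ((sel bs vs)[r := u])"
        using Bm s[OF *(1)] r(1) *(3,4) unfolding multilin_def by blast
      then show ?thesis unfolding insert_arg_def r
        using mixed_ml_lin0w[OF T _ _ w s(2)[OF *(1)]] Bin s(1)[OF *(1)] *(3,4) by simp
    next
      case False
      obtain r where r: "r < cnt (nbs bs)" "\<And>v. sel (nbs bs) (vs[i := v]) = (sel (nbs bs) vs)[r := v]"
         "\<And>v. sel bs (vs[i := v]) = sel bs vs" using sel_upd0[OF args_len[OF *(1)] *(2) False] by metis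
      have "multilin E G (cnt (nbs bs)) (T (B [] (sel bs vs) # ws))"
        using T Bin s(1)[OF *(1)] w unfolding mixed_ml_def by auto
      then show ?thesis unfolding insert_arg_def r using s(2)[OF *(1)] r(1) *(3,4) unfolding multilin_def by blast
    qed
  qed (use in_G w in auto)
  ultimately show ?thesis unfolding mixed_ml_def using bd by blast
qed

lemma insert_arg_diff_eq:
  assumes T: "mixed_ml E F G (Suc m) (cnt (nbs bs)) T" and B: "mixed_ml E H F 0 (cnt bs) B" "mixed_ml E H F 0 (cnt bs) B'"
    and w: "ws \<in> args F m" and v: "vs \<in> args E (length bs)"
  shows "insert_arg bs T (\<lambda>ws vs. B ws vs - B' ws vs) ws vs = insert_arg bs T B ws vs - insert_arg bs T B' ws vs"
proof -
  have s: "sel bs vs \<in> args E (cnt bs)" "sel (nbs bs) vs \<in> args E (cnt (nbs bs))"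
    using sel_args[of vs E bs] sel_args[of vs E "nbs bs"] v by auto
  then have "B [] (sel bs vs) \<in> nscar F" "B' [] (sel bs vs) \<in> nscar F" using B mixed_ml_in by (metis args_Nil)+
  from mixed_ml_lin0w[OF T this w s(2), of 1 "-1"] show ?thesis unfolding insert_arg_def by simp
qed

text \<open>Write R y (A y) - R x (A x) as (R y - R x) (A y) + R x (A y - A x).\<close>

lemma insert_arg_mixed_cont:
  assumes U: "U \<subseteq> nscar E" and R: "\<And>x. x \<in> U \<Longrightarrow> mixed_ml E F G (Suc m) (cnt (nbs bs)) (R x)"
    and A: "\<And>x. x \<in> U \<Longrightarrow> mixed_ml E H F 0 (cnt bs) (A x)" and H: "normed H"
    and Rc: "mixed_cont E F G U (Suc m) (cnt (nbs bs)) R" and Ac: "mixed_cont E H F U 0 (cnt bs) A"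
  shows "mixed_cont E F G U m (length bs) (\<lambda>x. insert_arg bs (R x) (A x))"
  unfolding mixed_cont_def
proof (intro ballI allI impI)
  interpret A: normed3 E H F by (intro normed3.intro E.normed_axioms F.normed_axioms H)
  fix x e assume x: "x \<in> U" and e: "(e::real) > 0"
  obtain c where c: "c \<ge> 0" "mixed_le E F G (Suc m) (cnt (nbs bs)) (R x) c" using mixed_ml_bound[OF R[OF x]] by auto
  obtain d where d: "d \<ge> 0" "mixed_le E H F 0 (cnt bs) (A x) d" using A.mixed_ml_bound[OF A[OF x]] by auto
  \<comment> \<open>The cap 1 keeps the norm of A y at most d + 1, the factor that e1 divides out;
    each of the two terms then costs at most e/2.\<close>
  define e2 where "e2 = min 1 (e / (2 * (c + 1)))"
  define e1 where "e1 = e / (2 * (d + 1))"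
  have pos: "e1 > 0" "e2 > 0" using e c d by (auto simp: e1_def e2_def)
  have "\<forall>\<^sub>F y in nbhd E U x. mixed_le E F G (Suc m) (cnt (nbs bs)) (\<lambda>ws vs. R y ws vs - R x ws vs) e1"
    using Rc x pos unfolding mixed_cont_def by blast
  moreover have "\<forall>\<^sub>F y in nbhd E U x. mixed_le E H F 0 (cnt bs) (\<lambda>ws vs. A y ws vs - A x ws vs) e2"
    using Ac x pos unfolding mixed_cont_def by blast
  ultimately show "\<forall>\<^sub>F y in nbhd E U x. mixed_le E F G m (length bs) (\<lambda>ws vs. insert_arg bs (R y) (A y) ws vs - insert_arg bs (R x) (A x) ws vs) e"
    using ev_nbhd_in
  proof eventually_elim
    case (elim y)
    have "mixed_le E H F 0 (cnt bs) (A y) (d + e2)"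
      using A.mixed_le_add[OF d(2) elim(2)] by simp
    from insert_arg_bd[OF elim(1) this] have 1: "mixed_le E F G m (length bs) (insert_arg bs (\<lambda>ws vs. R y ws vs - R x ws vs) (A y)) (e1 * (d + e2))"
      using pos by simp
    have 2: "mixed_le E F G m (length bs) (insert_arg bs (R x) (\<lambda>ws vs. A y ws vs - A x ws vs)) (c * e2)"
      by (rule insert_arg_bd[OF c(2) elim(2) c(1)])
    have "e1 * (d + e2) \<le> e1 * (d + 1)" using pos by (intro mult_left_mono) (auto simp: e2_def)
    also have "\<dots> = e / 2" using d by (simp add: e1_def field_simps)
    finally have "e1 * (d + e2) \<le> e / 2" .
    moreover have "c * e2 \<le> c * (e / (2 * (c + 1)))" using c by (intro mult_left_mono) (auto simp: e2_def)
    moreover have "c * (e / (2 * (c + 1))) \<le> e / 2" using c e by (simp add: field_simps)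
    ultimately have "e1 * (d + e2) + c * e2 \<le> e" by linarith
    from mixed_le_mono[OF mixed_le_add[OF 1 2] this]
    show ?case
      by (subst mixed_le_cong[of F m E _ _ "\<lambda>ws vs. insert_arg bs (\<lambda>ws vs. R y ws vs - R x ws vs) (A y) ws vs + insert_arg bs (R x) (\<lambda>ws vs. A y ws vs - A x ws vs) ws vs"])
        (auto simp: insert_arg_diff_eq[OF R[OF x] A[OF \<open>y \<in> U\<close>] A[OF x]], auto simp: insert_arg_def)
  qed
qed

text \<open>Product rule. With h = y - x the remainder is (R y - R x - R' x h) (A y) + (R' x h) (A y
  - A x) + R x (A y - A x - A' x h). In the derivative the new direction goes either to R' (mark
  False) or to A' (mark True).\<close>

lemma insert_arg_mixed_diff:
  assumes U: "U \<subseteq> nscar E" and R: "\<And>x. x \<in> U \<Longrightarrow> mixed_ml E F G (Suc m) (cnt (nbs bs)) (R x)"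
    and A: "\<And>x. x \<in> U \<Longrightarrow> mixed_ml E H F 0 (cnt bs) (A x)" and H: "normed H"
    and R': "\<And>x. x \<in> U \<Longrightarrow> mixed_ml E F G (Suc m) (Suc (cnt (nbs bs))) (R' x)"
    and A': "\<And>x. x \<in> U \<Longrightarrow> mixed_ml E H F 0 (Suc (cnt bs)) (A' x)"
    and Rd: "mixed_diff E F G U (Suc m) (cnt (nbs bs)) R R'" and Ad: "mixed_diff E H F U 0 (cnt bs) A A'"
  shows "mixed_diff E F G U m (length bs) (\<lambda>x. insert_arg bs (R x) (A x))
     (\<lambda>x ws vs. insert_arg (False # bs) (R' x) (A x) ws vs + insert_arg (True # bs) (R x) (A' x) ws vs)"
  unfolding mixed_diff_def
proof (intro ballI allI impI)
  interpret A: normed3 E H F by (intro normed3.intro E.normed_axioms F.normed_axioms H)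
  fix x e assume x: "x \<in> U" and e: "(e::real) > 0"
  have Ac: "mixed_cont E H F U 0 (cnt bs) A" by (rule A.mixed_diff_imp_mixed_cont[OF U Ad A'])
  obtain c where c: "c \<ge> 0" "mixed_le E F G (Suc m) (cnt (nbs bs)) (R x) c" using mixed_ml_bound[OF R[OF x]] by auto
  obtain c' where c': "c' \<ge> 0" "mixed_le E F G (Suc m) (Suc (cnt (nbs bs))) (R' x) c'" using mixed_ml_bound[OF R'[OF x]] by auto
  obtain d where d: "d \<ge> 0" "mixed_le E H F 0 (cnt bs) (A x) d" using A.mixed_ml_bound[OF A[OF x]] by auto
  \<comment> \<open>One third of e for each of the three terms; the cap in e2 again bounds A y by d
    + 1.\<close>
  define e1 where "e1 = e / (3 * (d + 1))"
  define e2 where "e2 = min 1 (e / (3 * (c' + 1)))"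
  define e3 where "e3 = e / (3 * (c + 1))"
  have pos: "e1 > 0" "e2 > 0" "e3 > 0" using e c d c' by (auto simp: e1_def e2_def e3_def)
  have "\<forall>\<^sub>F y in nbhd E U x. mixed_le E F G (Suc m) (cnt (nbs bs)) (\<lambda>ws vs. R y ws vs - R x ws vs - R' x ws ((y - x) # vs)) (e1 * nsnorm E (y - x))"
    using Rd x pos unfolding mixed_diff_def by blast
  moreover have "\<forall>\<^sub>F y in nbhd E U x. mixed_le E H F 0 (cnt bs) (\<lambda>ws vs. A y ws vs - A x ws vs) e2"
    using Ac x pos unfolding mixed_cont_def by blast
  moreover have "\<forall>\<^sub>F y in nbhd E U x. mixed_le E H F 0 (cnt bs) (\<lambda>ws vs. A y ws vs - A x ws vs - A' x ws ((y - x) # vs)) (e3 * nsnorm E (y - x))"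
    using Ad x pos unfolding mixed_diff_def by blast
  ultimately show "\<forall>\<^sub>F y in nbhd E U x. mixed_le E F G m (length bs) (\<lambda>ws vs. insert_arg bs (R y) (A y) ws vs - insert_arg bs (R x) (A x) ws vs -
       (insert_arg (False # bs) (R' x) (A x) ws ((y - x) # vs) + insert_arg (True # bs) (R x) (A' x) ws ((y - x) # vs))) (e * nsnorm E (y - x))"
    using ev_nbhd_in
  proof eventually_elim
    case (elim y)
    have yx: "y - x \<in> nscar E" using elim x U by auto
    define h where "h = nsnorm E (y - x)"
    have h0: "0 \<le> h" using yx by (simp add: h_def)
    let ?R = "\<lambda>ws vs. R y ws vs - R x ws vs - R' x ws ((y - x) # vs)"
    let ?Rh = "\<lambda>ws vs. R' x ws ((y - x) # vs)"
    let ?A = "\<lambda>ws vs. A y ws vs - A x ws vs"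
    let ?Ah = "\<lambda>ws vs. A' x ws ((y - x) # vs)"
    have "mixed_le E H F 0 (cnt bs) (A y) (d + e2)"
      using A.mixed_le_add[OF d(2) elim(2)] by simp
    from insert_arg_bd[OF elim(1) this] have 1: "mixed_le E F G m (length bs) (insert_arg bs ?R (A y)) (e1 * h * (d + e2))"
      using pos h0 by (simp add: h_def)
    have "mixed_le E F G (Suc m) (cnt (nbs bs)) ?Rh (c' * h)" unfolding mixed_le_def
    proof (intro ballI)
      fix ws vs assume "ws \<in> args F (Suc m)" "vs \<in> args E (cnt (nbs bs))"
      then show "?Rh ws vs \<in> nscar G \<and> nsnorm G (?Rh ws vs) \<le> c' * h * (pnorm F ws * pnorm E vs)"
        using c'(2)[unfolded mixed_le_def, rule_format, of ws "(y - x) # vs"] yx by (auto simp: mult_ac h_def)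
    qed
    from insert_arg_bd[OF this elim(2)] have 2: "mixed_le E F G m (length bs) (insert_arg bs ?Rh ?A) (c' * h * e2)"
      using c' h0 by simp
    have 3: "mixed_le E F G m (length bs) (insert_arg bs (R x) (\<lambda>ws vs. A y ws vs - A x ws vs - A' x ws ((y - x) # vs))) (c * (e3 * h))"
      using insert_arg_bd[OF c(2) elim(3) c(1)] by (simp add: h_def)
    have "e1 * (d + e2) \<le> e1 * (d + 1)" using pos by (intro mult_left_mono) (auto simp: e2_def)
    also have "\<dots> = e / 3" using d by (simp add: e1_def field_simps)
    finally have "e1 * (d + e2) \<le> e / 3" .
    moreover have "c' * e2 \<le> c' * (e / (3 * (c' + 1)))" using c' by (intro mult_left_mono) (auto simp: e2_def)
    moreover have "c' * (e / (3 * (c' + 1))) \<le> e / 3" "c * e3 \<le> e / 3" using c c' e by (simp_all add: field_simps e3_def)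
    ultimately have "e1 * (d + e2) + c' * e2 + c * e3 \<le> e" by linarith
    then have "(e1 * (d + e2) + c' * e2 + c * e3) * h \<le> e * h" using h0 by (intro mult_right_mono)
    then have "e1 * h * (d + e2) + c' * h * e2 + c * (e3 * h) \<le> e * h" by (simp add: algebra_simps)
    from mixed_le_mono[OF mixed_le_add[OF mixed_le_add[OF 1 2] 3] this]
    have fin: "mixed_le E F G m (length bs) (\<lambda>ws vs. insert_arg bs ?R (A y) ws vs + insert_arg bs ?Rh ?A ws vs + insert_arg bs (R x) (\<lambda>ws vs. A y ws vs - A x ws vs - A' x ws ((y - x) # vs)) ws vs) (e * h)" .
    have Rhb: "mixed_ml E F G (Suc m) (cnt (nbs bs)) ?Rh" using mixed_ml_tail[OF R'[OF x] yx] .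
    have Ahb: "mixed_ml E H F 0 (cnt bs) ?Ah" using A.mixed_ml_tail[OF A'[OF x] yx] .
    have Adb: "mixed_ml E H F 0 (cnt bs) ?A" using A.mixed_ml_diff[OF A[OF \<open>y \<in> U\<close>] A[OF x]] .
    show ?case unfolding h_def[symmetric]
      by (rule mixed_le_cong[THEN iffD1, OF _ fin])
       (auto simp: insert_arg_diff_eq[OF R[OF x] Adb Ahb] insert_arg_diff_eq[OF R[OF x] A[OF \<open>y \<in> U\<close>] A[OF x]]
         insert_arg_diff_eq[OF Rhb A[OF \<open>y \<in> U\<close>] A[OF x]], auto simp: insert_arg_def)
  qed
qed

text \<open>Both summands of the product rule are insertions again, with one more mark in front;
  hence the induction on p leaves \<open>bs\<close>, \<open>R\<close> and \<open>A\<close>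
  arbitrary.\<close>

lemma mixed_Ck_insert_arg:
  assumes U: "U \<subseteq> nscar E" and H: "normed H"
  shows "mixed_Ck E F G U p (Suc m) (cnt (nbs bs)) R \<Longrightarrow> mixed_Ck E H F U p 0 (cnt bs) A \<Longrightarrow>
    mixed_Ck E F G U p m (length bs) (\<lambda>x. insert_arg bs (R x) (A x))"
proof (induction p arbitrary: bs R A)
  case 0
  note b = mixed_Ck_ml[OF 0(1)] mixed_Ck_ml[OF 0(2)]
  have "mixed_cont E F G U m (length bs) (\<lambda>x. insert_arg bs (R x) (A x))"
    using 0 b unfolding mixed_Ck.simps by (intro insert_arg_mixed_cont[OF U _ _ H]) blast+
  then show ?case unfolding mixed_Ck.simps using insert_arg_ml[OF b] by blast
next
  case (Suc p)
  interpret A: normed3 E H F by (intro normed3.intro E.normed_axioms F.normed_axioms H)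
  obtain R' where R': "mixed_diff E F G U (Suc m) (cnt (nbs bs)) R R'" "mixed_Ck E F G U p (Suc m) (Suc (cnt (nbs bs))) R'"
    using Suc.prems(1) by (rule mixed_Ck_SucE)
  obtain A' where A': "mixed_diff E H F U 0 (cnt bs) A A'" "mixed_Ck E H F U p 0 (Suc (cnt bs)) A'"
    using Suc.prems(2) by (rule mixed_Ck_SucE)
  have c: "cnt (nbs (False # bs)) = Suc (cnt (nbs bs))" "cnt (False # bs) = cnt bs"
    "cnt (nbs (True # bs)) = cnt (nbs bs)" "cnt (True # bs) = Suc (cnt bs)" by simp_all
  have "mixed_Ck E F G U p m (length (False # bs)) (\<lambda>x. insert_arg (False # bs) (R' x) (A x))"
    by (rule Suc.IH; unfold c) (fact R'(2), rule A.mixed_Ck_SucD[OF U Suc.prems(2)])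
  moreover have "mixed_Ck E F G U p m (length (True # bs)) (\<lambda>x. insert_arg (True # bs) (R x) (A' x))"
    by (rule Suc.IH; unfold c) (rule mixed_Ck_SucD[OF U Suc.prems(1)], fact A'(2))
  ultimately have "mixed_Ck E F G U p m (Suc (length bs)) (\<lambda>x ws vs. insert_arg (False # bs) (R' x) (A x) ws vs + insert_arg (True # bs) (R x) (A' x) ws vs)"
    using mixed_Ck_add[OF U] by simp
  moreover have "mixed_diff E F G U m (length bs) (\<lambda>x. insert_arg bs (R x) (A x))
     (\<lambda>x ws vs. insert_arg (False # bs) (R' x) (A x) ws vs + insert_arg (True # bs) (R x) (A' x) ws vs)"
    using insert_arg_mixed_diff[OF U mixed_Ck_ml[OF Suc.prems(1)] mixed_Ck_ml[OF Suc.prems(2)] H mixed_Ck_ml[OF R'(2)] mixed_Ck_ml[OF A'(2)] R'(1) A'(1)] .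
  ultimately show ?case
    using insert_arg_ml[OF mixed_Ck_ml[OF Suc.prems(1)] mixed_Ck_ml[OF Suc.prems(2)]] by (intro mixed_Ck_SucI) auto
qed

text \<open>The open slots \<open>ws\<close> of the result are those of the derivatives of the outer
  map, not yet filled by derivatives of f. The derivative in E is S' with f' inserted into one
  further slot, so the induction applies the statement to S' with m + 1 open slots and leaves the
  rest to \<open>mixed_Ck_insert_arg\<close>.\<close>

lemma mixed_Ck_comp:
  assumes U: "U \<subseteq> nscar E" and V: "V \<subseteq> nscar F" and f: "f ` U \<subseteq> V" and H: "normed H" and K: "normed K"
  shows "mixed_Ck F K G V p 0 m S \<Longrightarrow> mixed_Ck E H F U p 0 0 (\<lambda>x _ _. f x) \<Longrightarrow> mixed_Ck E F G U p m 0 (\<lambda>x ws _. S (f x) [] ws)"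
proof (induction p arbitrary: m S)
  case (0 m S)
  have "mixed_ml E F G m 0 (\<lambda>ws _. S (f x) [] ws)" if "x \<in> U" for x
    using mixed_Ck_ml[OF 0(1)] f that K unfolding mixed_ml_def by (fastforce simp: multilin_def mixed_le_def)
  moreover have "mixed_cont E F G U m 0 (\<lambda>x ws _. S (f x) [] ws)"
    unfolding mixed_cont_def
  proof (intro ballI allI impI)
    fix x e assume x: "x \<in> U" and e: "(e::real) > 0"
    have "\<forall>\<^sub>F z in nbhd F V (f x). mixed_le F K G 0 m (\<lambda>ws vs. S z ws vs - S (f x) ws vs) e"
      using 0(1) f x e unfolding mixed_Ck.simps mixed_cont_def by blast
    then obtain d where d: "d > 0" "\<And>z. z \<in> V \<Longrightarrow> nsnorm F (z - f x) < d \<Longrightarrow> mixed_le F K G 0 m (\<lambda>ws vs. S z ws vs - S (f x) ws vs) e"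
      unfolding ev_nbhd by blast
    have "\<forall>\<^sub>F y in nbhd E U x. mixed_le E H F 0 0 (\<lambda>ws vs. f y - f x) (d / 2)"
      using 0(2) x d unfolding mixed_Ck.simps mixed_cont_def by (meson half_gt_zero)
    then show "\<forall>\<^sub>F y in nbhd E U x. mixed_le E F G m 0 (\<lambda>ws vs. S (f y) [] ws - S (f x) [] ws) e"
      using ev_nbhd_in
    proof eventually_elim
      case (elim y)
      then have "nsnorm F (f y - f x) < d" using d unfolding mixed_le_def by auto
      then show ?case using d(2)[of "f y"] f elim unfolding mixed_le_def by auto
    qed
  qed
  ultimately show ?case unfolding mixed_Ck.simps by blast
next
  case (Suc p m S)
  interpret A: normed3 E H F by (intro normed3.intro E.normed_axioms F.normed_axioms H)
  interpret B: normed3 F K G by (intro normed3.intro F.normed_axioms G.normed_axioms K)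
  obtain S' where S': "mixed_diff F K G V 0 m S S'" "mixed_Ck F K G V p 0 (Suc m) S'"
    using Suc.prems(1) by (rule mixed_Ck_SucE)
  obtain f' where f': "mixed_diff E H F U 0 0 (\<lambda>x _ _. f x) f'" "mixed_Ck E H F U p 0 (Suc 0) f'"
    using Suc.prems(2) by (rule mixed_Ck_SucE)
  have ml: "mixed_ml E F G m 0 (\<lambda>ws _. S (f x) [] ws)" if "x \<in> U" for x
    using mixed_Ck_ml[OF Suc.prems(1)] f that K unfolding mixed_ml_def by (fastforce simp: multilin_def mixed_le_def)
  have "mixed_Ck E F G U p (Suc m) 0 (\<lambda>x ws _. S' (f x) [] ws)"
    by (rule Suc.IH[OF S'(2) A.mixed_Ck_SucD[OF U Suc.prems(2)]])
  \<comment> \<open>The newest argument of \<open>S'\<close> comes first in its list, exactly the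
    slot that \<open>insert_arg\<close> fills.\<close>
  then have M: "mixed_Ck E F G U p m (length [True]) (\<lambda>x. insert_arg [True] (\<lambda>ws _. S' (f x) [] ws) (f' x))"
    by (intro mixed_Ck_insert_arg[OF U H]) (use f'(2) in auto)
  have "mixed_diff E F G U m 0 (\<lambda>x ws _. S (f x) [] ws) (\<lambda>x. insert_arg [True] (\<lambda>ws _. S' (f x) [] ws) (f' x))"
    unfolding mixed_diff_def
  proof (intro ballI allI impI)
    fix x e assume x: "x \<in> U" and e: "(e::real) > 0"
    then have fx: "f x \<in> V" using f by auto
    have S'b: "mixed_ml F K G 0 (Suc m) (S' (f x))" by (rule mixed_Ck_ml[OF S'(2) fx])
    obtain c where c: "c \<ge> 0" "mixed_le F K G 0 (Suc m) (S' (f x)) c" using B.mixed_ml_bound[OF S'b] by auto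
    have f'b: "mixed_ml E H F 0 1 (f' x)" using mixed_Ck_ml[OF f'(2) x] by simp
    obtain d where d: "d \<ge> 0" "mixed_le E H F 0 1 (f' x) d" using A.mixed_ml_bound[OF f'b] by auto
    \<comment> \<open>The bound e2 <= 1 makes f Lipschitz at x with constant d + 1, which is divided
      out in e1 and in the radius r / (d + 1) below. The remainder splits into that of S and into S'
      applied to that of f, e/2 each.\<close>
    define e1 where "e1 = e / (2 * (d + 1))"
    define e2 where "e2 = min 1 (e / (2 * (c + 1)))"
    have pos: "e1 > 0" "e2 > 0" using e c d by (auto simp: e1_def e2_def)
    have "\<forall>\<^sub>F z in nbhd F V (f x). mixed_le F K G 0 m (\<lambda>ws vs. S z ws vs - S (f x) ws vs - S' (f x) ws ((z - f x) # vs)) (e1 * nsnorm F (z - f x))"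
      using S'(1) fx pos unfolding mixed_diff_def by blast
    then obtain r where r: "r > 0" "\<And>z. z \<in> V \<Longrightarrow> nsnorm F (z - f x) < r \<Longrightarrow>
       mixed_le F K G 0 m (\<lambda>ws vs. S z ws vs - S (f x) ws vs - S' (f x) ws ((z - f x) # vs)) (e1 * nsnorm F (z - f x))"
      unfolding ev_nbhd by blast
    have "\<forall>\<^sub>F y in nbhd E U x. mixed_le E H F 0 0 (\<lambda>ws vs. f y - f x - f' x ws ((y - x) # vs)) (e2 * nsnorm E (y - x))"
      using f'(1) x pos unfolding mixed_diff_def by blast
    moreover have "\<forall>\<^sub>F y in nbhd E U x. nsnorm E (y - x) < r / (d + 1)" by (rule ev_nbhd_lt) (use r d in auto)
    ultimately show "\<forall>\<^sub>F y in nbhd E U x. mixed_le E F G m 0 (\<lambda>ws vs. S (f y) [] ws - S (f x) [] ws -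
                 insert_arg [True] (\<lambda>ws _. S' (f x) [] ws) (f' x) ws ((y - x) # vs)) (e * nsnorm E (y - x))"
      using ev_nbhd_in
    proof eventually_elim
      case (elim y)
      have yx: "y - x \<in> nscar E" using elim x U by auto
      have fy: "f y \<in> V" using elim f by auto
      then have fyc: "f y \<in> nscar F" "f x \<in> nscar F" "f y - f x \<in> nscar F" using V fx by auto
      let ?h = "nsnorm E (y - x)" and ?l = "f' x [] [y - x]"
      have h: "?h \<ge> 0" using yx by simp
      have l: "?l \<in> nscar F" "nsnorm F ?l \<le> d * ?h" using d(2)[unfolded mixed_le_def, rule_format, of "[]" "[y - x]"] yx by (simp_all add: args_def)
      have rem: "nsnorm F (f y - f x - ?l) \<le> e2 * ?h" using elim(1) unfolding mixed_le_def by auto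
      have "nsnorm F (f y - f x) \<le> nsnorm F (f y - f x - ?l) + nsnorm F ?l"
        using F.tri[of "f y - f x - ?l" ?l] fyc l by simp
      also have "\<dots> \<le> e2 * ?h + d * ?h" using rem l by linarith
      also have "\<dots> \<le> 1 * ?h + d * ?h" by (intro add_mono mult_right_mono h) (auto simp: e2_def)
      finally have lip: "nsnorm F (f y - f x) \<le> (d + 1) * ?h" by (simp add: algebra_simps)
      also have "\<dots> < r" using elim(2) d by (simp add: field_simps)
      finally have 1: "mixed_le F K G 0 m (\<lambda>ws vs. S (f y) ws vs - S (f x) ws vs - S' (f x) ws ((f y - f x) # vs)) (e1 * nsnorm F (f y - f x))"
        by (rule r(2)[OF fy])
      have "e1 * nsnorm F (f y - f x) \<le> e1 * ((d + 1) * ?h)" by (intro mult_left_mono lip) (use pos in auto)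
      also have "\<dots> = e / 2 * ?h" using d by (simp add: e1_def field_simps)
      finally have 2: "mixed_le F K G 0 m (\<lambda>ws vs. S (f y) ws vs - S (f x) ws vs - S' (f x) ws ((f y - f x) # vs)) (e / 2 * ?h)"
        by (rule B.mixed_le_mono[OF 1])
      have "mixed_le F K G 0 m (\<lambda>ws vs. S' (f x) ws ((f y - f x - ?l) # vs)) (c * nsnorm F (f y - f x - ?l))"
        unfolding mixed_le_def
      proof (intro ballI)
        fix ws vs assume "ws \<in> args K 0" "vs \<in> args F m"
        then show "S' (f x) ws ((f y - f x - ?l) # vs) \<in> nscar G \<and> nsnorm G (S' (f x) ws ((f y - f x - ?l) # vs))
             \<le> c * nsnorm F (f y - f x - ?l) * (pnorm K ws * pnorm F vs)"
          using c(2)[unfolded mixed_le_def, rule_format, of ws "(f y - f x - ?l) # vs"] fyc l by (auto simp: mult_ac)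
      qed
      moreover have "c * nsnorm F (f y - f x - ?l) \<le> c * (e2 * ?h)" by (intro mult_left_mono rem c)
      moreover have "c * e2 \<le> e / 2"
      proof -
        have "c * e2 \<le> c * (e / (2 * (c + 1)))" using c by (intro mult_left_mono) (auto simp: e2_def)
        also have "\<dots> \<le> e / 2" using c e by (simp add: field_simps)
        finally show ?thesis .
      qed
      then have "c * (e2 * ?h) \<le> e / 2 * ?h" using h by (metis mult.assoc mult_right_mono)
      ultimately have 3: "mixed_le F K G 0 m (\<lambda>ws vs. S' (f x) ws ((f y - f x - ?l) # vs)) (e / 2 * ?h)"
        by (meson B.mixed_le_mono order_trans)
      have "mixed_le F K G 0 m (\<lambda>ws vs. S (f y) ws vs - S (f x) ws vs - S' (f x) ws ((f y - f x) # vs) + S' (f x) ws ((f y - f x - ?l) # vs)) (e / 2 * ?h + e / 2 * ?h)"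
        by (rule B.mixed_le_add[OF 2 3])
      moreover have "S' (f x) [] ((f y - f x - ?l) # vs) = S' (f x) [] ((f y - f x) # vs) - S' (f x) [] (?l # vs)" if "vs \<in> args F m" for vs
        using mixed_ml_lin0v[OF S'b fyc(3) l(1) _ that, of "[]" 1 "-1"] by simp
      ultimately show ?case unfolding mixed_le_def insert_arg_def by (auto simp: mult.commute)
    qed
  qed
  then show ?case using M ml by (intro mixed_Ck_SucI) auto
qed

end

section \<open>Calculus for \<open>Ck_on\<close>\<close>

text \<open>The recursion unrolled: a map put in front of the sequence of its derivative prolongs it
  (\<open>case_nat\<close>), and dropping the first entry shortens it.\<close>

lemma mixed_Ck_seq:
  "mixed_Ck E F G U p m n R \<longleftrightarrow> (\<exists>D. D 0 = R \<and> (\<forall>j\<le>p. \<forall>x\<in>U. mixed_ml E F G m (n + j) (D j x)) \<and>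
     (\<forall>j<p. mixed_diff E F G U m (n + j) (D j) (D (Suc j))) \<and> mixed_cont E F G U m (n + p) (D p))"
proof (induction p arbitrary: n R)
  case 0
  show ?case by (auto intro!: exI[of _ "\<lambda>_. R"])
next
  case (Suc p)
  show ?case
  proof
    assume M: "mixed_Ck E F G U (Suc p) m n R"
    then obtain R' where R': "mixed_diff E F G U m n R R'" "mixed_Ck E F G U p m (Suc n) R'" by (rule mixed_Ck_SucE)
    then obtain D where D: "D 0 = R'" "\<forall>j\<le>p. \<forall>x\<in>U. mixed_ml E F G m (Suc n + j) (D j x)"
      "\<forall>j<p. mixed_diff E F G U m (Suc n + j) (D j) (D (Suc j))" "mixed_cont E F G U m (Suc n + p) (D p)"
      using Suc.IH by blast
    show "\<exists>D. D 0 = R \<and> (\<forall>j\<le>Suc p. \<forall>x\<in>U. mixed_ml E F G m (n + j) (D j x)) \<and>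
     (\<forall>j<Suc p. mixed_diff E F G U m (n + j) (D j) (D (Suc j))) \<and> mixed_cont E F G U m (n + Suc p) (D (Suc p))"
      by (rule exI[of _ "case_nat R D"]) (use D R' mixed_Ck_ml[OF M] in \<open>auto split: nat.splits\<close>)
  next
    assume "\<exists>D. D 0 = R \<and> (\<forall>j\<le>Suc p. \<forall>x\<in>U. mixed_ml E F G m (n + j) (D j x)) \<and>
     (\<forall>j<Suc p. mixed_diff E F G U m (n + j) (D j) (D (Suc j))) \<and> mixed_cont E F G U m (n + Suc p) (D (Suc p))"
    then obtain D where D: "D 0 = R" "\<And>j x. j \<le> Suc p \<Longrightarrow> x \<in> U \<Longrightarrow> mixed_ml E F G m (n + j) (D j x)"
      "\<And>j. j < Suc p \<Longrightarrow> mixed_diff E F G U m (n + j) (D j) (D (Suc j))" "mixed_cont E F G U m (n + Suc p) (D (Suc p))"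
      by blast
    have "mixed_Ck E F G U p m (Suc n) (D 1)" unfolding Suc.IH
      by (rule exI[of _ "\<lambda>j. D (Suc j)"]) (use D(2)[of "Suc _"] D(3)[of "Suc _"] D(4) in auto)
    then show "mixed_Ck E F G U (Suc p) m n R" using D(1) D(2)[of 0] D(3)[of 0] by (intro mixed_Ck_SucI) auto
  qed
qed

lemma std_normed: "normed std_ns"
  unfolding std_ns_def by unfold_locales (auto simp: subspace_UNIV norm_triangle_ineq)

text \<open>For a mixed map without arguments in \<open>F\<close> the choice of \<open>F\<close> is immaterial.\<close>

abbreviation nul :: "real nspace" where "nul \<equiv> std_ns"

text \<open>For m = 0 only the membership of the values separates the two kinds of bounds: on the
  side of \<open>Ck_on\<close> it comes from \<open>bounded_multilinear\<close>, while
  \<open>mixed_le\<close> contains it.\<close>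

lemma Ck_on_mixed_Ck:
  assumes E: "normed E" and F: "normed F" and H: "normed H" and U: "U \<subseteq> nscar E"
  shows "Ck_on E F l U f \<longleftrightarrow> mixed_Ck E H F U l 0 0 (\<lambda>x _ _. f x)"
proof
  interpret E: normed E by fact
  interpret F: normed F by fact
  have b: "mixed_ml E H F 0 n (\<lambda>_. T) \<longleftrightarrow> bounded_multilinear E F n T" for n T
    unfolding mixed_ml_def bounded_multilinear_def multilin_def mixed_le_def opnorm_le_def by auto
  have o: "mixed_le E H F 0 n (\<lambda>_. T) c \<longleftrightarrow> opnorm_le E F n T c" if "\<And>vs. vs \<in> args E n \<Longrightarrow> T vs \<in> nscar F" for T n c
    using that unfolding mixed_le_def opnorm_le_def by simp
  {
    assume "Ck_on E F l U f"
    then obtain D where D0: "\<forall>x\<in>U. D 0 x [] = f x" "\<forall>j\<le>l. \<forall>x\<in>U. bounded_multilinear E F j (D j x)"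
      "\<forall>j<l. \<forall>x\<in>U. \<forall>\<epsilon>>0. \<forall>\<^sub>F y in nbhd E U x.
           opnorm_le E F j (\<lambda>vs. D j y vs - D j x vs - D (Suc j) x ((y - x) # vs)) (\<epsilon> * nsnorm E (y - x))"
      "\<forall>x\<in>U. \<forall>\<epsilon>>0. \<forall>\<^sub>F y in nbhd E U x. opnorm_le E F l (\<lambda>vs. D l y vs - D l x vs) \<epsilon>"
      unfolding Ck_on_def ev_nbhd
      apply (elim exE conjE)
      subgoal for D
        apply (rule that[of D], assumption, assumption)
        unfolding ev_nbhd by assumption+
      done
    note D = D0[rule_format]
    have Din: "D j x vs \<in> nscar F" if "j \<le> l" "x \<in> U" "vs \<in> args E j" for j x vs
      using D(2) that unfolding bounded_multilinear_def by blast
    have "mixed_Ck E H F U l 0 0 (\<lambda>x _. D 0 x)" unfolding mixed_Ck_seq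
    proof (rule exI[of _ "\<lambda>j x _. D j x"], intro conjI allI impI ballI)
      show "mixed_diff E H F U 0 (0 + j) (\<lambda>x _. D j x) (\<lambda>x _. D (Suc j) x)" if j: "j < l" for j
        unfolding mixed_diff_def
      proof (intro ballI allI impI)
        fix x e assume x: "x \<in> U" and e: "(e::real) > 0"
        show "\<forall>\<^sub>F y in nbhd E U x. mixed_le E H F 0 (0 + j) (\<lambda>ws vs. D j y vs - D j x vs - D (Suc j) x ((y - x) # vs)) (e * nsnorm E (y - x))"
          using D(3)[OF j x e] ev_nbhd_in
        proof eventually_elim
          case (elim y)
          then have "y - x \<in> nscar E" using x U by auto
          then show ?case using elim x j by (subst o) (auto intro!: F.diff_in Din)
        qed
      qed
      show "mixed_cont E H F U 0 (0 + l) (\<lambda>x _. D l x)"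
        unfolding mixed_cont_def
      proof (intro ballI allI impI)
        fix x e assume x: "x \<in> U" and e: "(e::real) > 0"
        show "\<forall>\<^sub>F y in nbhd E U x. mixed_le E H F 0 (0 + l) (\<lambda>ws vs. D l y vs - D l x vs) e"
          using D(4)[OF x e] ev_nbhd_in
        proof eventually_elim
          case (elim y)
          then show ?case using elim x by (subst o) (auto intro!: F.diff_in Din)
        qed
      qed
    qed (use b D in auto)
    then show "mixed_Ck E H F U l 0 0 (\<lambda>x _ _. f x)"
      by (rule mixed_Ck_cong[rotated 4]) (use D(1) U E H in auto)
  }
  {
    assume "mixed_Ck E H F U l 0 0 (\<lambda>x _ _. f x)"
    then obtain D where D: "D 0 = (\<lambda>x _ _. f x)" "\<And>j x. j \<le> l \<Longrightarrow> x \<in> U \<Longrightarrow> mixed_ml E H F 0 j (D j x)"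
     "\<And>j. j<l \<Longrightarrow> mixed_diff E H F U 0 j (D j) (D (Suc j))" "mixed_cont E H F U 0 l (D l)"
      unfolding mixed_Ck_seq by (metis add_0)
    show "Ck_on E F l U f" unfolding Ck_on_def ev_nbhd[symmetric]
    proof (rule exI[of _ "\<lambda>j x. D j x []"], intro conjI allI impI ballI)
      show "bounded_multilinear E F j (D j x [])" if "j \<le> l" "x \<in> U" for j x
      proof -
        have "mixed_ml E H F 0 j (D j x) \<longleftrightarrow> mixed_ml E H F 0 j (\<lambda>_. D j x [])"
          by (rule mixed_ml_cong[OF E H]) auto
        then show ?thesis using b D(2)[OF that] by simp
      qed
      show "\<forall>\<^sub>F y in nbhd E U x. opnorm_le E F j (\<lambda>vs. D j y [] vs - D j x [] vs - D (Suc j) x [] ((y - x) # vs)) (e * nsnorm E (y - x))"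
        if "j < l" "x \<in> U" "e > 0" for j x e
      proof -
        have "\<forall>\<^sub>F y in nbhd E U x. mixed_le E H F 0 j (\<lambda>ws vs. D j y ws vs - D j x ws vs - D (Suc j) x ws ((y - x) # vs)) (e * nsnorm E (y - x))"
          using D(3) that unfolding mixed_diff_def by blast
        then show ?thesis by eventually_elim (auto simp: mixed_le_def opnorm_le_def)
      qed
      show "\<forall>\<^sub>F y in nbhd E U x. opnorm_le E F l (\<lambda>vs. D l y [] vs - D l x [] vs) e"
        if "x \<in> U" "e > 0" for x e
      proof -
        have "\<forall>\<^sub>F y in nbhd E U x. mixed_le E H F 0 l (\<lambda>ws vs. D l y ws vs - D l x ws vs) e"
          using D(4) that unfolding mixed_cont_def by blast
        then show ?thesis by eventually_elim (auto simp: mixed_le_def opnorm_le_def)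
      qed
    qed (use D in auto)
  }
qed

lemma Ck_on_nul:
  assumes "normed E" "normed F" "U \<subseteq> nscar E"
  shows "Ck_on E F l U f \<longleftrightarrow> mixed_Ck E nul F U l 0 0 (\<lambda>x _ _. f x)"
  by (rule Ck_on_mixed_Ck[OF assms(1,2) std_normed assms(3)])

section \<open>Uniqueness of derivatives at interior points\<close>

text \<open>Openness enters uniqueness here: from an interior point one can go a short way in every
  direction h and still meet what holds near x.\<close>

lemma nopen_ray:
  assumes "normed E" "nopen E W" "x \<in> W" "h \<in> nscar E" "\<forall>\<^sub>F y in nbhd E W x. P y"
  shows "\<exists>t>0. x + t *\<^sub>R h \<in> W \<and> P (x + t *\<^sub>R h)"
proof -
  interpret normed E by fact
  have xE: "x \<in> nscar E" using assms nopen_sub by blast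
  obtain d where d: "d > 0" "\<forall>y\<in>nscar E. nsnorm E (y - x) < d \<longrightarrow> y \<in> W" using assms unfolding nopen_def by blast
  obtain e where e: "e > 0" "\<forall>y\<in>W. nsnorm E (y - x) < e \<longrightarrow> P y" using assms unfolding ev_nbhd by blast
  \<comment> \<open>Half of the admissible radius over |h| + 1, so that h = 0 is allowed.\<close>
  define t where "t = (min d e / 2) / (nsnorm E h + 1)"
  have n: "0 \<le> nsnorm E h" using assms by simp
  have t: "t > 0" using d e n by (simp add: t_def)
  have "nsnorm E (x + t *\<^sub>R h - x) = t * nsnorm E h" using hom assms t by simp
  also have "\<dots> \<le> t * (nsnorm E h + 1)" using t by simp
  also have "\<dots> = min d e / 2"
  proof -
    have "nsnorm E h + 1 \<noteq> 0" using n by linarith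
    then show ?thesis by (rule nonzero_eq_divide_eq[THEN iffD1, OF _ t_def])
  qed
  also have "\<dots> < min d e" using d(1) e(1) by linarith
  finally have "nsnorm E (x + t *\<^sub>R h - x) < min d e" .
  moreover have "x + t *\<^sub>R h \<in> nscar E" using xE assms by auto
  ultimately show ?thesis using d e t by (intro exI[of _ t]) auto
qed

text \<open>T and the bound scale alike, so the estimate at the short vector t h is one at h itself,
  with arbitrarily small constant. K carries the norms of further frozen arguments.\<close>

lemma small_lin:
  assumes E: "normed E" and F: "normed F" and T: "\<And>v. v \<in> nscar E \<Longrightarrow> T v \<in> nscar F"
    "\<And>v t. v \<in> nscar E \<Longrightarrow> T (t *\<^sub>R v) = t *\<^sub>R T v"
    and W: "nopen E W" "x \<in> W" and K: "K \<ge> 0"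
    and small: "\<And>\<epsilon>. \<epsilon> > 0 \<Longrightarrow> \<forall>\<^sub>F y in nbhd E W x. nsnorm F (T (y - x)) \<le> \<epsilon> * nsnorm E (y - x) * K"
    and h: "h \<in> nscar E"
  shows "T h = 0"
proof -
  interpret E: normed E by fact
  interpret F: normed F by fact
  have n: "nsnorm E h \<ge> 0" using h by simp
  have "nsnorm F (T h) \<le> e" if e: "e > 0" for e
  proof -
    define e' where "e' = e / (nsnorm E h * K + 1)"
    have e': "e' > 0" using e n K by (simp add: e'_def add_nonneg_pos)
    obtain t where t: "t > 0" "nsnorm F (T (x + t *\<^sub>R h - x)) \<le> e' * nsnorm E (x + t *\<^sub>R h - x) * K"
      using nopen_ray[OF E W h small[OF e']] by blast
    then have "t * nsnorm F (T h) \<le> t * (e' * nsnorm E h * K)"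
      using T h by (simp add: E.hom F.hom mult_ac)
    then have "nsnorm F (T h) \<le> e' * (nsnorm E h * K)" using t by (simp add: mult_ac)
    also have "\<dots> \<le> e' * (nsnorm E h * K + 1)" using e' by simp
    also have "\<dots> = e" using n K by (simp add: e'_def add_nonneg_eq_0_iff)
    finally show ?thesis .
  qed
  then have "nsnorm F (T h) \<le> 0" by (rule field_le_epsilon[of _ 0, simplified])
  then have "nsnorm F (T h) = 0" using F.nonneg[OF T(1)[OF h]] by linarith
  then show ?thesis using F.eq0[OF T(1)[OF h]] by simp
qed

lemma mixed_cont_mono: "W \<subseteq> U \<Longrightarrow> mixed_cont E F G U m n R \<Longrightarrow> mixed_cont E F G W m n R"
  unfolding mixed_cont_def using nbhd_mono by (meson filter_leD subsetD)

lemma mixed_diff_mono: "W \<subseteq> U \<Longrightarrow> mixed_diff E F G U m n R R' \<Longrightarrow> mixed_diff E F G W m n R R'"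
  unfolding mixed_diff_def using nbhd_mono by (meson filter_leD subsetD)

lemma mixed_Ck_mono: "W \<subseteq> U \<Longrightarrow> mixed_Ck E F G U p m n R \<Longrightarrow> mixed_Ck E F G W p m n R"
proof (induction p arbitrary: n R)
  case 0
  have "mixed_cont E F G W m n R" by (rule mixed_cont_mono[OF 0(1)]) (use 0(2) in simp)
  then show ?case using 0 by auto
next
  case (Suc p)
  obtain R' where R': "mixed_diff E F G U m n R R'" "mixed_Ck E F G U p m (Suc n) R'"
    using Suc.prems(2) by (rule mixed_Ck_SucE)
  show ?case
    by (rule mixed_Ck_SucI[OF mixed_Ck_ml[OF Suc.prems(2)] mixed_diff_mono[OF Suc.prems(1) R'(1)] Suc.IH[OF Suc.prems(1) R'(2)]])
      (use Suc.prems in auto)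
qed

context normed3
begin

lemma mixed_diff_unique:
  assumes W: "nopen E W" "x \<in> W" and d: "mixed_diff E F G W m n R R'" "mixed_diff E F G W m n R R''"
    and b: "mixed_ml E F G m (Suc n) (R' x)" "mixed_ml E F G m (Suc n) (R'' x)"
    and w: "ws \<in> args F m" and v: "vs \<in> args E (Suc n)"
  shows "R' x ws vs = R'' x ws vs"
proof -
  obtain h us where vs: "vs = h # us" "h \<in> nscar E" "us \<in> args E n" using args_SucE[OF v] by blast
  let ?T = "\<lambda>h. R' x ws (h # us) - R'' x ws (h # us)"
  have T: "?T v \<in> nscar G" if "v \<in> nscar E" for v
    using mixed_ml_in[OF b(1) w] mixed_ml_in[OF b(2) w] that vs by auto
  have "?T h = 0"
  proof (rule small_lin[OF E.normed_axioms G.normed_axioms T _ W pn2_nonneg[OF w vs(3)] _ vs(2)])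
    show "?T (t *\<^sub>R v) = t *\<^sub>R ?T v" if "v \<in> nscar E" for v t
      using mixed_ml_lin0v[OF b(1) that that w vs(3), of t 0] mixed_ml_lin0v[OF b(2) that that w vs(3), of t 0] by (simp add: algebra_simps)
    fix e :: real assume "e > 0"
    then have "\<forall>\<^sub>F y in nbhd E W x. mixed_le E F G m n (\<lambda>ws vs. R y ws vs - R x ws vs - R' x ws ((y - x) # vs)) (e/2 * nsnorm E (y - x))"
      "\<forall>\<^sub>F y in nbhd E W x. mixed_le E F G m n (\<lambda>ws vs. R y ws vs - R x ws vs - R'' x ws ((y - x) # vs)) (e/2 * nsnorm E (y - x))"
      using d W unfolding mixed_diff_def by (meson half_gt_zero)+
    then show "\<forall>\<^sub>F y in nbhd E W x. nsnorm G (?T (y - x)) \<le> e * nsnorm E (y - x) * (pnorm F ws * pnorm E us)"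
    proof eventually_elim
      case (elim y)
      let ?a = "R y ws us - R x ws us - R' x ws ((y - x) # us)" and ?b = "R y ws us - R x ws us - R'' x ws ((y - x) # us)"
      have ab: "?a \<in> nscar G" "?b \<in> nscar G" "nsnorm G ?a \<le> e/2 * nsnorm E (y - x) * (pnorm F ws * pnorm E us)"
        "nsnorm G ?b \<le> e/2 * nsnorm E (y - x) * (pnorm F ws * pnorm E us)" using elim w vs unfolding mixed_le_def by auto
      have "?T (y - x) = ?b - ?a" by simp
      moreover have "nsnorm G (?b - ?a) \<le> nsnorm G ?b + nsnorm G ?a" using ab by (intro G.tri_diff)
      ultimately show ?case using ab(3,4) by (simp add: field_simps)
    qed
  qed
  then show ?thesis by (simp add: vs)
qed

text \<open>Each neighbourhood supplies a derivative of its own. By uniqueness they agree on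
  overlaps and glue to one derivative, to which the induction hypothesis applies.\<close>

lemma mixed_Ck_local:
  "(\<And>x. x \<in> U \<Longrightarrow> \<exists>W\<subseteq>U. x \<in> W \<and> nopen E W \<and> mixed_Ck E F G W p m n R) \<Longrightarrow> mixed_Ck E F G U p m n R"
proof (induction p arbitrary: n R)
  case 0
  then have U: "nopen E U" by (meson nopen_local)
  have "mixed_ml E F G m n (R x)" if "x \<in> U" for x using 0[OF that] mixed_Ck_ml by blast
  moreover have "mixed_cont E F G U m n R" unfolding mixed_cont_def
  proof (intro ballI allI impI)
    fix x e assume x: "x \<in> U" and e: "(e::real) > 0"
    obtain W where W: "W \<subseteq> U" "x \<in> W" "nopen E W" "mixed_cont E F G W m n R" using 0[OF x] by auto
    show "\<forall>\<^sub>F y in nbhd E U x. mixed_le E F G m n (\<lambda>ws vs. R y ws vs - R x ws vs) e"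
      using W e unfolding nbhd_local[OF W(3,2) nopen_sub[OF U] W(1), symmetric] mixed_cont_def by blast
  qed
  ultimately show ?case by simp
next
  case (Suc p)
  then have U: "nopen E U" by (meson nopen_local)
  have ml: "mixed_ml E F G m n (R x)" if "x \<in> U" for x using Suc.prems[OF that] mixed_Ck_ml by blast
  have "\<exists>W R'. W \<subseteq> U \<and> x \<in> W \<and> nopen E W \<and> mixed_diff E F G W m n R R' \<and> mixed_Ck E F G W p m (Suc n) R'" if "x \<in> U" for x
    using Suc.prems[OF that] mixed_Ck_SucE by metis
  then obtain W S where WS: "\<And>x. x \<in> U \<Longrightarrow> W x \<subseteq> U" "\<And>x. x \<in> U \<Longrightarrow> x \<in> W x" "\<And>x. x \<in> U \<Longrightarrow> nopen E (W x)"
    "\<And>x. x \<in> U \<Longrightarrow> mixed_diff E F G (W x) m n R (S x)" "\<And>x. x \<in> U \<Longrightarrow> mixed_Ck E F G (W x) p m (Suc n) (S x)"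
    by metis
  \<comment> \<open>At y the derivative belonging to the neighbourhood of y itself is taken; by
    \<open>eq\<close> every other one whose neighbourhood contains y gives the same.\<close>
  define R' where "R' y = S y y" for y
  have eq: "R' y ws vs = S x y ws vs" if "x \<in> U" "y \<in> W x" "ws \<in> args F m" "vs \<in> args E (Suc n)" for x y ws vs
  proof -
    have y: "y \<in> U" using WS(1) that by blast
    let ?V = "W x \<inter> W y"
    have "mixed_diff E F G ?V m n R (S y)" "mixed_diff E F G ?V m n R (S x)"
      using mixed_diff_mono[OF _ WS(4)[OF y], of ?V] mixed_diff_mono[OF _ WS(4)[OF that(1)], of ?V] by auto
    then show ?thesis unfolding R'_def
      by (rule mixed_diff_unique[rotated 2]) (use that y WS(2,3) mixed_Ck_ml[OF WS(5)] in \<open>auto intro!: nopen_Int\<close>)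
  qed
  have "mixed_Ck E F G U p m (Suc n) R'"
  proof (rule Suc.IH)
    fix x assume x: "x \<in> U"
    have "mixed_Ck E F G (W x) p m (Suc n) R'"
      by (rule mixed_Ck_cong[OF _ nopen_sub[OF WS(3)[OF x]] E.normed_axioms F.normed_axioms WS(5)[OF x]]) (use eq[OF x] in auto)
    then show "\<exists>W\<subseteq>U. x \<in> W \<and> nopen E W \<and> mixed_Ck E F G W p m (Suc n) R'" using WS x by blast
  qed
  moreover have "mixed_diff E F G U m n R R'" unfolding mixed_diff_def
  proof (intro ballI allI impI)
    fix x e assume x: "x \<in> U" and e: "(e::real) > 0"
    show "\<forall>\<^sub>F y in nbhd E U x. mixed_le E F G m n (\<lambda>ws vs. R y ws vs - R x ws vs - R' x ws ((y - x) # vs)) (e * nsnorm E (y - x))"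
      using WS(4)[OF x] WS(2)[OF x] e
      unfolding nbhd_local[OF WS(3)[OF x] WS(2)[OF x] nopen_sub[OF U] WS(1)[OF x], symmetric] mixed_diff_def R'_def by blast
  qed
  ultimately show ?case using ml by (intro mixed_Ck_SucI)
qed

lemma mixed_le_zero: "c \<ge> 0 \<Longrightarrow> mixed_le E F G m n (\<lambda>ws vs. 0) c"
  unfolding mixed_le_def by (simp add: pn2_nonneg)

lemma mixed_ml_zero: "mixed_ml E F G m n (\<lambda>ws vs. 0)"
  unfolding mixed_ml_def multilin_def using mixed_le_zero[of 0] by auto

lemma mixed_Ck_const: assumes U: "U \<subseteq> nscar E" shows "mixed_ml E F G m n T \<Longrightarrow> mixed_Ck E F G U p m n (\<lambda>_. T)"
proof (induction p arbitrary: n T)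
  case 0
  then show ?case by (auto simp: mixed_cont_def mixed_le_zero)
next
  case (Suc p)
  have "mixed_Ck E F G U p m (Suc n) (\<lambda>_ _ _. 0)" by (rule Suc.IH[OF mixed_ml_zero])
  moreover have "mixed_diff E F G U m n (\<lambda>_. T) (\<lambda>_ _ _. 0)"
    unfolding mixed_diff_def
  proof (intro ballI allI impI)
    fix x e assume x: "x \<in> U" and e: "(e::real) > 0"
    show "\<forall>\<^sub>F y in nbhd E U x. mixed_le E F G m n (\<lambda>ws vs. T ws vs - T ws vs - 0) (e * nsnorm E (y - x))"
      using ev_nbhd_in
    proof eventually_elim
      case (elim y)
      then have "nsnorm E (y - x) \<ge> 0" using x U by (intro E.nonneg E.diff_in) auto
      then show ?case using e by (simp add: mixed_le_zero)
    qed
  qed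
  ultimately show ?case using Suc.prems by (intro mixed_Ck_SucI)
qed

lemma mixed_Ck_linear:
  assumes U: "U \<subseteq> nscar E" and L: "\<And>v. v \<in> nscar E \<Longrightarrow> L v \<in> nscar G"
    "\<And>v w a b. v \<in> nscar E \<Longrightarrow> w \<in> nscar E \<Longrightarrow> L (a *\<^sub>R v + b *\<^sub>R w) = a *\<^sub>R L v + b *\<^sub>R L w"
    and c: "\<And>v. v \<in> nscar E \<Longrightarrow> nsnorm G (L v) \<le> c * nsnorm E v"
  shows "mixed_Ck E F G U p 0 0 (\<lambda>x _ _. L x)"
proof -
  have b: "mixed_ml E F G 0 1 (\<lambda>ws vs. L (hd vs))"
    unfolding mixed_ml_def
  proof (intro conjI ballI)
    show "multilin E G 1 (\<lambda>vs. L (hd vs))" unfolding multilin_def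
      using L by (auto simp: args_def length_Suc_conv)
    show "\<exists>c. mixed_le E F G 0 1 (\<lambda>ws vs. L (hd vs)) c"
      by (rule exI[of _ c]) (use L c in \<open>auto simp: mixed_le_def args_def length_Suc_conv\<close>)
    show "multilin F G 0 (\<lambda>ws. L (hd vs))" if "vs \<in> args E 1" for vs unfolding multilin_def
      using L that by (auto simp: args_def length_Suc_conv)
  qed
  have b0: "mixed_ml E F G 0 0 (\<lambda>_ _. L x)" if "x \<in> U" for x
    using L U that unfolding mixed_ml_def multilin_def mixed_le_def by auto
  have d: "mixed_diff E F G U 0 0 (\<lambda>x _ _. L x) (\<lambda>_ ws vs. L (hd vs))"
    unfolding mixed_diff_def
  proof (intro ballI allI impI)
    fix x e assume x: "x \<in> U" and e: "(e::real) > 0"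
    show "\<forall>\<^sub>F y in nbhd E U x. mixed_le E F G 0 0 (\<lambda>ws vs. L y - L x - L (hd ((y - x) # vs))) (e * nsnorm E (y - x))"
      using ev_nbhd_in
    proof eventually_elim
      case (elim y)
      then have "x \<in> nscar E" "y \<in> nscar E" using x U by auto
      then have "L y - L x - L (y - x) = 0" "nsnorm E (y - x) \<ge> 0" using L(2)[of y x 1 "-1"] by auto
      then show ?case using e by (simp add: mixed_le_zero)
    qed
  qed
  \<comment> \<open>The argument goes one order up, where \<open>mixed_Ck_const\<close> handles the
    constant derivative, and then drops one, so that p = 0 is no case of its own.\<close>
  have "mixed_Ck E F G U (Suc p) 0 0 (\<lambda>x _ _. L x)"
    by (rule mixed_Ck_SucI[OF b0 d]) (use mixed_Ck_const[OF U b] in auto)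
  then show ?thesis by (rule mixed_Ck_SucD[OF U])
qed

end

section \<open>Products of normed spaces\<close>

lemma prod_normed: assumes "normed E" "normed F" shows "normed (prod_ns E F)"
proof -
  interpret E: normed E by fact
  interpret F: normed F by fact
  show ?thesis unfolding prod_ns_def
  proof (unfold_locales, goal_cases)
    case 1
    then show ?case by (auto intro: subspace_Times E.sub F.sub)
  next
    case (3 x)
    obtain a b where x: "x = (a, b)" by (cases x)
    have "a \<in> nscar E" "b \<in> nscar F" using 3 x by auto
    then have "nsnorm E a \<le> 0 \<longleftrightarrow> a = 0" "nsnorm F b \<le> 0 \<longleftrightarrow> b = 0" "0 \<le> nsnorm E a" "0 \<le> nsnorm F b"
      by (metis E.eq0 E.nonneg order_antisym order_refl, metis F.eq0 F.nonneg order_antisym order_refl, simp_all)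
    then show ?case unfolding x by (auto simp: max_def zero_prod_def split: if_splits)
  next
    case (4 x c)
    then show ?case using E.hom[of "fst x" c] F.hom[of "snd x" c]
      by (auto simp: max_mult_distrib_left)
  next
    case (5 x y)
    then show ?case using E.tri[of "fst x" "fst y"] F.tri[of "snd x" "snd y"] by (auto simp: le_max_iff_disj)
  qed (auto simp: le_max_iff_disj)
qed

lemma prod_car [simp]: "nscar (prod_ns E F) = nscar E \<times> nscar F" by (simp add: prod_ns_def)
lemma prod_norm [simp]: "nsnorm (prod_ns E F) (a, b) = max (nsnorm E a) (nsnorm F b)" by (simp add: prod_ns_def)

lemma nopen_Times: assumes "nopen E U" "nopen F V" shows "nopen (prod_ns E F) (U \<times> V)"
  unfolding nopen_def
proof (intro conjI ballI)
  show "U \<times> V \<subseteq> nscar (prod_ns E F)" using nopen_sub[OF assms(1)] nopen_sub[OF assms(2)] by auto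
  fix p assume p: "p \<in> U \<times> V"
  obtain d where d: "d > 0" "\<forall>y\<in>nscar E. nsnorm E (y - fst p) < d \<longrightarrow> y \<in> U"
    using assms(1) p unfolding nopen_def by (metis mem_Times_iff)
  obtain e where e: "e > 0" "\<forall>y\<in>nscar F. nsnorm F (y - snd p) < e \<longrightarrow> y \<in> V"
    using assms(2) p unfolding nopen_def by (metis mem_Times_iff)
  show "\<exists>\<delta>>0. \<forall>y\<in>nscar (prod_ns E F). nsnorm (prod_ns E F) (y - p) < \<delta> \<longrightarrow> y \<in> U \<times> V"
    by (rule exI[of _ "min d e"], cases p) (use d e in auto)
qed

text \<open>Needed to hold one coordinate at a fixed point while the other varies.\<close>

lemma nopen_slice: assumes "normed E" "normed F" "nopen (prod_ns E F) W"
  shows "y \<in> nscar F \<Longrightarrow> nopen E {x \<in> nscar E. (x, y) \<in> W}" "x \<in> nscar E \<Longrightarrow> nopen F {y \<in> nscar F. (x, y) \<in> W}"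
proof -
  interpret E: normed E by fact
  interpret F: normed F by fact
  have d: "\<exists>d>0. \<forall>x'\<in>nscar E. \<forall>y'\<in>nscar F. nsnorm E (x' - x) < d \<and> nsnorm F (y' - y) < d \<longrightarrow> (x', y') \<in> W"
    if "(x, y) \<in> W" for x y
    using assms(3) that unfolding nopen_def by (fastforce)
  show "nopen E {x \<in> nscar E. (x, y) \<in> W}" if y: "y \<in> nscar F" unfolding nopen_def
  proof (intro conjI ballI)
    fix x assume "x \<in> {x \<in> nscar E. (x, y) \<in> W}"
    then obtain r where r: "r > 0" "\<forall>x'\<in>nscar E. \<forall>y'\<in>nscar F. nsnorm E (x' - x) < r \<and> nsnorm F (y' - y) < r \<longrightarrow> (x', y') \<in> W"
      using d by blast
    then have "(x', y) \<in> W" if "x' \<in> nscar E" "nsnorm E (x' - x) < r" for x' using that y by simp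
    then show "\<exists>\<delta>>0. \<forall>ya\<in>nscar E. nsnorm E (ya - x) < \<delta> \<longrightarrow> ya \<in> {x \<in> nscar E. (x, y) \<in> W}" using r(1) by blast
  qed auto
  show "nopen F {y \<in> nscar F. (x, y) \<in> W}" if x: "x \<in> nscar E" unfolding nopen_def
  proof (intro conjI ballI)
    fix y assume "y \<in> {y \<in> nscar F. (x, y) \<in> W}"
    then obtain r where r: "r > 0" "\<forall>x'\<in>nscar E. \<forall>y'\<in>nscar F. nsnorm E (x' - x) < r \<and> nsnorm F (y' - y) < r \<longrightarrow> (x', y') \<in> W"
      using d by blast
    then have "(x, y') \<in> W" if "y' \<in> nscar F" "nsnorm F (y' - y) < r" for y' using that x by simp
    then show "\<exists>\<delta>>0. \<forall>ya\<in>nscar F. nsnorm F (ya - y) < \<delta> \<longrightarrow> ya \<in> {y \<in> nscar F. (x, y) \<in> W}" using r(1) by blast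
  qed auto
qed

lemma mixed_le_pair: "mixed_le E F G m n T c \<Longrightarrow> mixed_le E F H m n T' c \<Longrightarrow> mixed_le E F (prod_ns G H) m n (\<lambda>ws vs. (T ws vs, T' ws vs)) c"
  unfolding mixed_le_def by simp

lemma multilin_pair: "multilin E G n T \<Longrightarrow> multilin E H n T' \<Longrightarrow> multilin E (prod_ns G H) n (\<lambda>vs. (T vs, T' vs))"
  unfolding multilin_def by simp

lemma mixed_ml_pair:
  assumes "normed3 E F G" "normed3 E F H" "mixed_ml E F G m n T" "mixed_ml E F H m n T'"
  shows "mixed_ml E F (prod_ns G H) m n (\<lambda>ws vs. (T ws vs, T' ws vs))"
proof -
  interpret A: normed3 E F G by fact
  interpret B: normed3 E F H by fact
  obtain c d where "mixed_le E F G m n T c" "mixed_le E F H m n T' d" using assms(3,4) unfolding mixed_ml_def by blast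
  then have "mixed_le E F (prod_ns G H) m n (\<lambda>ws vs. (T ws vs, T' ws vs)) (max c d)"
    by (intro mixed_le_pair) (erule A.mixed_le_mono[OF _ max.cobounded1], erule B.mixed_le_mono[OF _ max.cobounded2])
  then show ?thesis using assms(3,4) unfolding mixed_ml_def
    apply (elim conjE)
    apply (intro conjI ballI)
      apply (rule multilin_pair; blast)
     apply (rule multilin_pair; blast)
    apply blast
    done
qed

lemma mixed_Ck_pair:
  assumes N: "normed3 E F G" "normed3 E F H" and U: "U \<subseteq> nscar E"
  shows "mixed_Ck E F G U p m n R \<Longrightarrow> mixed_Ck E F H U p m n S \<Longrightarrow> mixed_Ck E F (prod_ns G H) U p m n (\<lambda>x ws vs. (R x ws vs, S x ws vs))"
proof (induction p arbitrary: n R S)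
  case 0
  have "mixed_cont E F (prod_ns G H) U m n (\<lambda>x ws vs. (R x ws vs, S x ws vs))"
    unfolding mixed_cont_def
  proof (intro ballI allI impI)
    fix x e assume x: "x \<in> U" and e: "(e::real) > 0"
    have "\<forall>\<^sub>F y in nbhd E U x. mixed_le E F G m n (\<lambda>ws vs. R y ws vs - R x ws vs) e"
      "\<forall>\<^sub>F y in nbhd E U x. mixed_le E F H m n (\<lambda>ws vs. S y ws vs - S x ws vs) e"
      using 0 x e unfolding mixed_Ck.simps mixed_cont_def by blast+
    then show "\<forall>\<^sub>F y in nbhd E U x. mixed_le E F (prod_ns G H) m n (\<lambda>ws vs. (R y ws vs, S y ws vs) - (R x ws vs, S x ws vs)) e"
      by eventually_elim (simp add: mixed_le_pair)
  qed
  then show ?case unfolding mixed_Ck.simps using mixed_ml_pair[OF N mixed_Ck_ml[OF 0(1)] mixed_Ck_ml[OF 0(2)]] by blast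
next
  case (Suc p)
  obtain R' where R': "mixed_diff E F G U m n R R'" "mixed_Ck E F G U p m (Suc n) R'"
    using Suc.prems(1) by (rule mixed_Ck_SucE)
  obtain S' where S': "mixed_diff E F H U m n S S'" "mixed_Ck E F H U p m (Suc n) S'"
    using Suc.prems(2) by (rule mixed_Ck_SucE)
  have "mixed_diff E F (prod_ns G H) U m n (\<lambda>x ws vs. (R x ws vs, S x ws vs)) (\<lambda>x ws vs. (R' x ws vs, S' x ws vs))"
    unfolding mixed_diff_def
  proof (intro ballI allI impI)
    fix x e assume x: "x \<in> U" and e: "(e::real) > 0"
    have "\<forall>\<^sub>F y in nbhd E U x. mixed_le E F G m n (\<lambda>ws vs. R y ws vs - R x ws vs - R' x ws ((y - x) # vs)) (e * nsnorm E (y - x))"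
      "\<forall>\<^sub>F y in nbhd E U x. mixed_le E F H m n (\<lambda>ws vs. S y ws vs - S x ws vs - S' x ws ((y - x) # vs)) (e * nsnorm E (y - x))"
      using R'(1) S'(1) x e unfolding mixed_diff_def by blast+
    then show "\<forall>\<^sub>F y in nbhd E U x. mixed_le E F (prod_ns G H) m n (\<lambda>ws vs. (R y ws vs, S y ws vs) - (R x ws vs, S x ws vs) - (R' x ws ((y - x) # vs), S' x ws ((y - x) # vs))) (e * nsnorm E (y - x))"
      by eventually_elim (simp add: mixed_le_pair)
  qed
  note d = this
  show ?case
    by (rule mixed_Ck_SucI[OF mixed_ml_pair[OF N mixed_Ck_ml[OF Suc.prems(1)] mixed_Ck_ml[OF Suc.prems(2)]] d Suc.IH[OF R'(2) S'(2)]])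
qed

section \<open>Rules for \<open>Ck_on\<close>\<close>

lemma normed3I: "normed E \<Longrightarrow> normed F \<Longrightarrow> normed G \<Longrightarrow> normed3 E F G" by (rule normed3.intro)

lemma Ck_on_le:
  assumes "normed E" "normed F" "U \<subseteq> nscar E" "Ck_on E F l U f" "l' \<le> l" shows "Ck_on E F l' U f"
proof -
  interpret normed3 E nul F by (intro normed3I std_normed assms)
  show ?thesis using assms(4) mixed_Ck_le[OF assms(3) _ assms(5)] unfolding Ck_on_nul[OF assms(1-3)] by blast
qed

lemma Ck_on_subset:
  assumes "normed E" "normed F" "U \<subseteq> nscar E" "Ck_on E F l U f" "W \<subseteq> U" shows "Ck_on E F l W f"
proof -
  have W: "W \<subseteq> nscar E" using assms by auto
  show ?thesis using assms(4) mixed_Ck_mono[OF assms(5)] unfolding Ck_on_nul[OF assms(1-3)] Ck_on_nul[OF assms(1,2) W] by blast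
qed

lemma Ck_on_cong:
  assumes "Ck_on E F l U f" "\<And>x. x \<in> U \<Longrightarrow> f x = g x" shows "Ck_on E F l U g"
  using assms unfolding Ck_on_def by simp

lemma Ck_on_compose:
  assumes "normed E" "normed F" "normed G" "U \<subseteq> nscar E" "V \<subseteq> nscar F" "f ` U \<subseteq> V" "Ck_on E F l U f" "Ck_on F G l V g"
  shows "Ck_on E G l U (\<lambda>x. g (f x))"
proof -
  interpret normed3 E F G by (intro normed3I assms)
  \<comment> \<open>The chain rule without open slots, with F itself as the immaterial
    space.\<close>
  have "mixed_Ck E F G U l 0 0 (\<lambda>x ws _. g (f x))"
    by (rule mixed_Ck_comp[OF assms(4,5,6) std_normed std_normed])
      (use assms Ck_on_nul in blast)+
  then show ?thesis using Ck_on_mixed_Ck[OF assms(1,3,2,4)] by blast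
qed

lemma Ck_on_pair:
  assumes "normed E" "normed F" "normed G" "U \<subseteq> nscar E" "Ck_on E F l U f" "Ck_on E G l U g"
  shows "Ck_on E (prod_ns F G) l U (\<lambda>x. (f x, g x))"
  using mixed_Ck_pair[OF normed3I[OF assms(1) std_normed assms(2)] normed3I[OF assms(1) std_normed assms(3)] assms(4)] assms(5,6)
  unfolding Ck_on_nul[OF assms(1,2,4)] Ck_on_nul[OF assms(1,3,4)] Ck_on_nul[OF assms(1) prod_normed[OF assms(2,3)] assms(4)]
  by blast

lemma Ck_on_linear:
  assumes "normed E" "normed F" "U \<subseteq> nscar E" and L: "\<And>v. v \<in> nscar E \<Longrightarrow> L v \<in> nscar F"
    "\<And>v w a b. v \<in> nscar E \<Longrightarrow> w \<in> nscar E \<Longrightarrow> L (a *\<^sub>R v + b *\<^sub>R w) = a *\<^sub>R L v + b *\<^sub>R L w"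
    and c: "\<And>v. v \<in> nscar E \<Longrightarrow> nsnorm F (L v) \<le> c * nsnorm E v"
  shows "Ck_on E F l U L"
proof -
  interpret normed3 E nul F by (intro normed3I std_normed assms)
  show ?thesis using mixed_Ck_linear[OF assms(3) L c] unfolding Ck_on_nul[OF assms(1-3)] by blast
qed

lemma Ck_on_const:
  assumes "normed E" "normed F" "U \<subseteq> nscar E" and c: "c \<in> nscar F"
  shows "Ck_on E F l U (\<lambda>_. c)"
proof -
  interpret normed3 E nul F by (intro normed3I std_normed assms)
  have "mixed_ml E nul F 0 0 (\<lambda>_ _. c)" unfolding mixed_ml_def multilin_def mixed_le_def using c by auto
  then show ?thesis using mixed_Ck_const[OF assms(3)] unfolding Ck_on_nul[OF assms(1-3)] by blast
qed

lemma Ck_on_id: assumes "normed E" "U \<subseteq> nscar E" shows "Ck_on E E l U (\<lambda>x. x)"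
  by (rule Ck_on_linear[OF assms(1,1,2), where c = 1]) auto

lemma Ck_on_fst: assumes "normed E" "normed F" "U \<subseteq> nscar (prod_ns E F)" shows "Ck_on (prod_ns E F) E l U fst"
  by (rule Ck_on_linear[OF prod_normed[OF assms(1,2)] assms(1,3), where c = 1]) auto

lemma Ck_on_snd: assumes "normed E" "normed F" "U \<subseteq> nscar (prod_ns E F)" shows "Ck_on (prod_ns E F) F l U snd"
  by (rule Ck_on_linear[OF prod_normed[OF assms(1,2)] assms(2,3), where c = 1]) auto

lemma Ck_on_local:
  assumes "normed E" "normed F" "U \<subseteq> nscar E" "\<And>x. x \<in> U \<Longrightarrow> \<exists>W\<subseteq>U. x \<in> W \<and> nopen E W \<and> Ck_on E F l W f"
  shows "Ck_on E F l U f"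
proof -
  interpret normed3 E nul F by (intro normed3I std_normed assms)
  have "\<exists>W\<subseteq>U. x \<in> W \<and> nopen E W \<and> mixed_Ck E nul F W l 0 0 (\<lambda>x _ _. f x)" if x: "x \<in> U" for x
    using assms(4)[OF x] Ck_on_nul[OF assms(1,2) nopen_sub] by blast
  then show ?thesis unfolding Ck_on_nul[OF assms(1-3)] by (rule mixed_Ck_local)
qed

lemma Ck_on_in: assumes "Ck_on E F l U f" "x \<in> U" shows "f x \<in> nscar F"
proof -
  obtain D where D: "\<forall>x\<in>U. D 0 x [] = f x" "\<forall>j\<le>l. \<forall>x\<in>U. bounded_multilinear E F j (D j x)"
    using assms unfolding Ck_on_def by (elim exE conjE)
  then have "bounded_multilinear E F 0 (D 0 x)" using assms(2) by blast
  then show ?thesis using D(1) assms(2) unfolding bounded_multilinear_def by auto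
qed

lemma Ck_on_0:
  assumes "normed E" "normed F" "U \<subseteq> nscar E"
  shows "Ck_on E F 0 U f \<longleftrightarrow> (\<forall>x\<in>U. f x \<in> nscar F) \<and> (\<forall>x\<in>U. \<forall>\<epsilon>>0. \<forall>\<^sub>F y in nbhd E U x. nsnorm F (f y - f x) \<le> \<epsilon>)"
proof -
  interpret F: normed F by fact
  have 1: "mixed_ml E nul F 0 0 (\<lambda>_ _. c) \<longleftrightarrow> c \<in> nscar F" for c
    unfolding mixed_ml_def multilin_def mixed_le_def by auto
  have 2: "(\<forall>\<^sub>F y in nbhd E U x. mixed_le E nul F 0 0 (\<lambda>ws vs. f y - f x) e) \<longleftrightarrow> (\<forall>\<^sub>F y in nbhd E U x. nsnorm F (f y - f x) \<le> e)"
    if "\<forall>x\<in>U. f x \<in> nscar F" "x \<in> U" for x e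
  proof
    assume "\<forall>\<^sub>F y in nbhd E U x. nsnorm F (f y - f x) \<le> e"
    then show "\<forall>\<^sub>F y in nbhd E U x. mixed_le E nul F 0 0 (\<lambda>ws vs. f y - f x) e"
      using ev_nbhd_in by eventually_elim (use that in \<open>auto simp: mixed_le_def\<close>)
  qed (auto simp: mixed_le_def elim: eventually_mono)
  show ?thesis unfolding Ck_on_nul[OF assms] mixed_Ck.simps mixed_cont_def 1 using 2 by blast
qed

text \<open>The sets on which representations in different charts can be composed have this form, so
  their openness comes from here.\<close>

lemma Ck_on_vimage_open:
  assumes E: "normed E" and F: "normed F" and U: "nopen E U" and f: "Ck_on E F l U f" and V: "nopen F V"
  shows "nopen E {x \<in> U. f x \<in> V}"
proof -
  interpret E: normed E by fact
  interpret F: normed F by fact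
  have "Ck_on E F 0 U f" by (rule Ck_on_le[OF E F nopen_sub[OF U] f]) simp
  then have f: "\<forall>x\<in>U. f x \<in> nscar F" "\<And>x e. x \<in> U \<Longrightarrow> e > 0 \<Longrightarrow> \<forall>\<^sub>F y in nbhd E U x. nsnorm F (f y - f x) \<le> e"
    unfolding Ck_on_0[OF E F nopen_sub[OF U]] by auto
  show ?thesis unfolding nopen_def
  proof (intro conjI ballI)
    show "{x \<in> U. f x \<in> V} \<subseteq> nscar E" using nopen_sub[OF U] by auto
    fix x assume x: "x \<in> {x \<in> U. f x \<in> V}"
    then obtain e where e: "e > 0" "\<forall>y\<in>nscar F. nsnorm F (y - f x) < e \<longrightarrow> y \<in> V" using V unfolding nopen_def by blast
    obtain d where d: "d > 0" "\<forall>y\<in>U. nsnorm E (y - x) < d \<longrightarrow> nsnorm F (f y - f x) \<le> e/2"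
      using f(2)[of x "e/2"] x e unfolding ev_nbhd by auto
    obtain d' where d': "d' > 0" "\<forall>y\<in>nscar E. nsnorm E (y - x) < d' \<longrightarrow> y \<in> U" using U x unfolding nopen_def by blast
    have "y \<in> U \<and> f y \<in> V" if "y \<in> nscar E" "nsnorm E (y - x) < min d d'" for y
    proof -
      have y: "y \<in> U" using d' that by auto
      then have "nsnorm F (f y - f x) < e" using d that e by fastforce
      then show ?thesis using e y f by auto
    qed
    then show "\<exists>\<delta>>0. \<forall>y\<in>nscar E. nsnorm E (y - x) < \<delta> \<longrightarrow> y \<in> {x \<in> U. f x \<in> V}"
      using d d' by (intro exI[of _ "min d d'"]) auto
  qed
qed

section \<open>First derivatives\<close>

lemma has_nderiv_ev:
  "has_nderiv E F U f x L \<longleftrightarrow>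
     (\<forall>v\<in>nscar E. L v \<in> nscar F) \<and>
     (\<forall>v\<in>nscar E. \<forall>w\<in>nscar E. \<forall>a b. L (a *\<^sub>R v + b *\<^sub>R w) = a *\<^sub>R L v + b *\<^sub>R L w) \<and>
     (\<exists>c. \<forall>v\<in>nscar E. nsnorm F (L v) \<le> c * nsnorm E v) \<and>
     (\<forall>\<epsilon>>0. \<forall>\<^sub>F y in nbhd E U x. nsnorm F (f y - f x - L (y - x)) \<le> \<epsilon> * nsnorm E (y - x))"
  unfolding has_nderiv_def ev_nbhd ..

lemma has_nderiv_local: "nopen E W \<Longrightarrow> x \<in> W \<Longrightarrow> U \<subseteq> nscar E \<Longrightarrow> W \<subseteq> U \<Longrightarrow>
   has_nderiv E F W f x L \<longleftrightarrow> has_nderiv E F U f x L"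
  unfolding has_nderiv_ev by (simp add: nbhd_local)

lemma has_nderiv_cong: assumes "\<And>y. y \<in> U \<Longrightarrow> f y = g y" "x \<in> U" shows "has_nderiv E F U f x L \<longleftrightarrow> has_nderiv E F U g x L"
  using assms unfolding has_nderiv_def by simp

lemma nderiv_cong: assumes "\<And>y. y \<in> U \<Longrightarrow> f y = g y" "x \<in> U" shows "nderiv E F U f x = nderiv E F U g x"
  unfolding nderiv_def using has_nderiv_cong[OF assms] by presburger

text \<open>As for mixed maps, but with a single argument and no frozen ones, hence K = 1.\<close>

lemma has_nderiv_unique:
  assumes E: "normed E" and F: "normed F" and U: "nopen E U" "x \<in> U" and L: "has_nderiv E F U f x L" "has_nderiv E F U f x M"
    and f: "\<And>y. y \<in> U \<Longrightarrow> f y \<in> nscar F" and v: "v \<in> nscar E"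
  shows "L v = M v"
proof -
  interpret E: normed E by fact
  interpret F: normed F by fact
  have L1: "L v \<in> nscar F" "M v \<in> nscar F" if "v \<in> nscar E" for v using L that unfolding has_nderiv_def by auto
  have "L v - M v = 0"
  proof (rule small_lin[OF E F _ _ U _ _ v, where K = 1])
    show "L v - M v \<in> nscar F" if "v \<in> nscar E" for v using L1 that by auto
    show "L (t *\<^sub>R v) - M (t *\<^sub>R v) = t *\<^sub>R (L v - M v)" if "v \<in> nscar E" for v t
    proof -
      have "L (t *\<^sub>R v + 0 *\<^sub>R v) = t *\<^sub>R L v + 0 *\<^sub>R L v" "M (t *\<^sub>R v + 0 *\<^sub>R v) = t *\<^sub>R M v + 0 *\<^sub>R M v"
        using L that unfolding has_nderiv_def by blast+
      then show ?thesis by (simp add: algebra_simps)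
    qed
    fix e :: real assume "e > 0"
    then have "\<forall>\<^sub>F y in nbhd E U x. nsnorm F (f y - f x - L (y - x)) \<le> e/2 * nsnorm E (y - x)"
      "\<forall>\<^sub>F y in nbhd E U x. nsnorm F (f y - f x - M (y - x)) \<le> e/2 * nsnorm E (y - x)"
      using L unfolding has_nderiv_ev by (meson half_gt_zero)+
    then show "\<forall>\<^sub>F y in nbhd E U x. nsnorm F (L (y - x) - M (y - x)) \<le> e * nsnorm E (y - x) * 1"
      using ev_nbhd_in
    proof eventually_elim
      case (elim y)
      have yx: "y - x \<in> nscar E" using elim U nopen_sub by blast
      have "L (y - x) - M (y - x) = (f y - f x - M (y - x)) - (f y - f x - L (y - x))" by simp
      moreover have "nsnorm F ((f y - f x - M (y - x)) - (f y - f x - L (y - x))) \<le>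
           nsnorm F (f y - f x - M (y - x)) + nsnorm F (f y - f x - L (y - x))"
        by (intro F.tri_diff F.diff_in f L1 yx elim U)
      ultimately show ?case using elim by simp
    qed
  qed auto
  then show ?thesis by simp
qed

lemma has_nderiv_nderiv: "has_nderiv E F U f x L \<Longrightarrow> has_nderiv E F U f x (nderiv E F U f x)"
  using someI[of "has_nderiv E F U f x" L] by (simp add: nderiv_def)

lemma nderiv_eq:
  assumes "normed E" "normed F" "nopen E U" "x \<in> U" "has_nderiv E F U f x L" "\<And>y. y \<in> U \<Longrightarrow> f y \<in> nscar F" "v \<in> nscar E"
  shows "nderiv E F U f x v = L v"
  by (rule has_nderiv_unique[OF assms(1-4) has_nderiv_nderiv[OF assms(5)] assms(5,6,7)])

text \<open>\<open>Ck_on_compose\<close> gives only the existence of derivatives. Tangent maps are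
  compared by their values, which need this pointwise formula.\<close>

lemma has_nderiv_compose:
  assumes E: "normed E" and F: "normed F" and G: "normed G" and U: "U \<subseteq> nscar E" and V: "V \<subseteq> nscar F" and fUV: "f ` U \<subseteq> V"
    and gV: "\<And>y. y \<in> V \<Longrightarrow> g y \<in> nscar G" and x: "x \<in> U"
    and f: "has_nderiv E F U f x L" and g: "has_nderiv F G V g (f x) M"
  shows "has_nderiv E G U (\<lambda>x. g (f x)) x (\<lambda>v. M (L v))"
proof -
  interpret E: normed E by fact
  interpret F: normed F by fact
  interpret G: normed G by fact
  have L: "\<And>v. v\<in>nscar E \<Longrightarrow> L v \<in> nscar F"
     "\<And>v w a b. v\<in>nscar E \<Longrightarrow> w\<in>nscar E \<Longrightarrow> L (a *\<^sub>R v + b *\<^sub>R w) = a *\<^sub>R L v + b *\<^sub>R L w" using f unfolding has_nderiv_def by blast+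
  have M: "\<And>v. v\<in>nscar F \<Longrightarrow> M v \<in> nscar G"
     "\<And>v w a b. v\<in>nscar F \<Longrightarrow> w\<in>nscar F \<Longrightarrow> M (a *\<^sub>R v + b *\<^sub>R w) = a *\<^sub>R M v + b *\<^sub>R M w" using g unfolding has_nderiv_def by blast+
  obtain c where c: "c \<ge> 0" "\<And>v. v\<in>nscar E \<Longrightarrow> nsnorm F (L v) \<le> c * nsnorm E v"
  proof -
    obtain c where c: "\<And>v. v\<in>nscar E \<Longrightarrow> nsnorm F (L v) \<le> c * nsnorm E v" using f unfolding has_nderiv_def by blast
    have "nsnorm F (L v) \<le> max c 0 * nsnorm E v" if "v \<in> nscar E" for v
      by (rule order_trans[OF c[OF that]]) (use that in \<open>auto intro: mult_right_mono\<close>)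
    then show ?thesis by (intro that[of "max c 0"]) auto
  qed
  obtain d where d: "d \<ge> 0" "\<And>v. v\<in>nscar F \<Longrightarrow> nsnorm G (M v) \<le> d * nsnorm F v"
  proof -
    obtain c where c: "\<And>v. v\<in>nscar F \<Longrightarrow> nsnorm G (M v) \<le> c * nsnorm F v" using g unfolding has_nderiv_def by blast
    have "nsnorm G (M v) \<le> max c 0 * nsnorm F v" if "v \<in> nscar F" for v
      by (rule order_trans[OF c[OF that]]) (use that in \<open>auto intro: mult_right_mono\<close>)
    then show ?thesis by (intro that[of "max c 0"]) auto
  qed
  have main: "\<forall>\<^sub>F y in nbhd E U x. nsnorm G (g (f y) - g (f x) - M (L (y - x))) \<le> e * nsnorm E (y - x)" if e: "e > 0" for e
  proof -
    define e1 where "e1 = e / (2 * (c + 1))"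
    define e2 where "e2 = min 1 (e / (2 * (d + 1)))"
    have pos: "e1 > 0" "e2 > 0" using e c d by (auto simp: e1_def e2_def)
    obtain r where r: "r > 0" "\<And>z. z \<in> V \<Longrightarrow> nsnorm F (z - f x) < r \<Longrightarrow> nsnorm G (g z - g (f x) - M (z - f x)) \<le> e1 * nsnorm F (z - f x)"
      using g pos unfolding has_nderiv_def by blast
    have "\<forall>\<^sub>F y in nbhd E U x. nsnorm F (f y - f x - L (y - x)) \<le> e2 * nsnorm E (y - x)"
      using f pos unfolding has_nderiv_ev by blast
    moreover have "\<forall>\<^sub>F y in nbhd E U x. nsnorm E (y - x) < r / (c + 1)" by (rule ev_nbhd_lt) (use r c in auto)
    ultimately show ?thesis using ev_nbhd_in
    proof eventually_elim
      case (elim y)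
      have yx: "y - x \<in> nscar E" using elim x U by auto
      have fy: "f y \<in> V" "f x \<in> V" using elim fUV x by auto
      then have fyc: "f y \<in> nscar F" "f x \<in> nscar F" "f y - f x \<in> nscar F" using V by auto
      let ?h = "nsnorm E (y - x)" and ?l = "L (y - x)"
      have h: "?h \<ge> 0" using yx by simp
      have l: "?l \<in> nscar F" "nsnorm F ?l \<le> c * ?h" using L c yx by auto
      have rem: "nsnorm F (f y - f x - ?l) \<le> e2 * ?h" using elim by auto
      have "nsnorm F (f y - f x) \<le> nsnorm F (f y - f x - ?l) + nsnorm F ?l"
        using F.tri[of "f y - f x - ?l" ?l] fyc l by simp
      also have "\<dots> \<le> e2 * ?h + c * ?h" using rem l by linarith
      also have "\<dots> \<le> 1 * ?h + c * ?h" by (intro add_mono mult_right_mono h) (auto simp: e2_def)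
      finally have lip: "nsnorm F (f y - f x) \<le> (c + 1) * ?h" by (simp add: algebra_simps)
      also have "\<dots> < r" using elim(2) c by (simp add: field_simps)
      finally have 1: "nsnorm G (g (f y) - g (f x) - M (f y - f x)) \<le> e1 * nsnorm F (f y - f x)"
        by (rule r(2)[OF fy(1)])
      have "e1 * nsnorm F (f y - f x) \<le> e1 * ((c + 1) * ?h)" by (intro mult_left_mono lip) (use pos in auto)
      also have "\<dots> = e / 2 * ?h" using c by (simp add: e1_def field_simps)
      finally have 2: "nsnorm G (g (f y) - g (f x) - M (f y - f x)) \<le> e / 2 * ?h" using 1 by linarith
      have "nsnorm G (M (f y - f x - ?l)) \<le> d * nsnorm F (f y - f x - ?l)" using d fyc l by auto
      also have "\<dots> \<le> d * (e2 * ?h)" by (intro mult_left_mono rem d)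
      also have "d * e2 \<le> e / 2"
      proof -
        have "d * e2 \<le> d * (e / (2 * (d + 1)))" using d by (intro mult_left_mono) (auto simp: e2_def)
        also have "\<dots> \<le> e / 2" using d e by (simp add: field_simps)
        finally show ?thesis .
      qed
      then have "d * (e2 * ?h) \<le> e / 2 * ?h" using h by (metis mult.assoc mult_right_mono)
      finally have 3: "nsnorm G (M (f y - f x - ?l)) \<le> e / 2 * ?h" by simp
      have "M (f y - f x - ?l) = M (f y - f x) - M ?l" using M(2)[OF fyc(3) l(1), of 1 "-1"] by simp
      then have "g (f y) - g (f x) - M ?l = (g (f y) - g (f x) - M (f y - f x)) + M (f y - f x - ?l)" by simp
      also have "nsnorm G \<dots> \<le> nsnorm G (g (f y) - g (f x) - M (f y - f x)) + nsnorm G (M (f y - f x - ?l))"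
        by (intro G.tri G.diff_in gV fy M fyc F.diff_in l)
      also have "\<dots> \<le> e * ?h" using 2 3 by (simp add: field_simps)
      finally show ?case .
    qed
  qed
  have "nsnorm G (M (L v)) \<le> d * c * nsnorm E v" if "v \<in> nscar E" for v
  proof -
    have "nsnorm G (M (L v)) \<le> d * nsnorm F (L v)" using d L that by auto
    also have "\<dots> \<le> d * (c * nsnorm E v)" using c that d by (intro mult_left_mono) auto
    finally show ?thesis by simp
  qed
  then show ?thesis unfolding has_nderiv_ev using L M main by auto
qed

lemma has_nderiv_linear:
  assumes "normed E" "normed F" "x \<in> U" "U \<subseteq> nscar E" and L: "\<And>v. v \<in> nscar E \<Longrightarrow> L v \<in> nscar F"
    "\<And>v w a b. v \<in> nscar E \<Longrightarrow> w \<in> nscar E \<Longrightarrow> L (a *\<^sub>R v + b *\<^sub>R w) = a *\<^sub>R L v + b *\<^sub>R L w"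
    and c: "\<And>v. v \<in> nscar E \<Longrightarrow> nsnorm F (L v) \<le> c * nsnorm E v"
  shows "has_nderiv E F U L x L"
proof -
  interpret E: normed E by fact
  interpret F: normed F by fact
  have "L y - L x - L (y - x) = 0" "nsnorm E (y - x) \<ge> 0" if "y \<in> U" for y
  proof -
    have "x \<in> nscar E" "y \<in> nscar E" using that assms(3,4) by auto
    then show "L y - L x - L (y - x) = 0" "nsnorm E (y - x) \<ge> 0" using L(2)[of y x 1 "-1"] by auto
  qed
  then have "\<forall>\<epsilon>>0. \<exists>\<delta>>0. \<forall>y\<in>U. nsnorm E (y - x) < \<delta> \<longrightarrow> nsnorm F (L y - L x - L (y - x)) \<le> \<epsilon> * nsnorm E (y - x)"
    by (auto intro!: exI[of _ 1])
  moreover have "\<exists>c. \<forall>v\<in>nscar E. nsnorm F (L v) \<le> c * nsnorm E v" using c by blast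
  ultimately show ?thesis unfolding has_nderiv_def using L by auto
qed

lemma has_nderiv_pair:
  assumes "normed E" "normed F" "normed G" "has_nderiv E F U f x L" "has_nderiv E G U g x M"
  shows "has_nderiv E (prod_ns F G) U (\<lambda>x. (f x, g x)) x (\<lambda>v. (L v, M v))"
proof -
  obtain c where c: "\<And>v. v\<in>nscar E \<Longrightarrow> nsnorm F (L v) \<le> c * nsnorm E v" using assms(4) unfolding has_nderiv_def by blast
  obtain d where d: "\<And>v. v\<in>nscar E \<Longrightarrow> nsnorm G (M v) \<le> d * nsnorm E v" using assms(5) unfolding has_nderiv_def by blast
  interpret E: normed E by fact
  have "nsnorm F (L v) \<le> max c d * nsnorm E v \<and> nsnorm G (M v) \<le> max c d * nsnorm E v" if "v\<in>nscar E" for v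
    using c[OF that] d[OF that] E.nonneg[OF that] by (smt (verit, ccfv_SIG) max.cobounded1 max.cobounded2 mult_right_mono)
  moreover have "\<forall>\<^sub>F y in nbhd E U x. nsnorm (prod_ns F G) ((f y, g y) - (f x, g x) - (L (y - x), M (y - x))) \<le> e * nsnorm E (y - x)"
    if "e > 0" for e
  proof -
    have "\<forall>\<^sub>F y in nbhd E U x. nsnorm F (f y - f x - L (y - x)) \<le> e * nsnorm E (y - x)"
       "\<forall>\<^sub>F y in nbhd E U x. nsnorm G (g y - g x - M (y - x)) \<le> e * nsnorm E (y - x)"
      using assms(4,5) that unfolding has_nderiv_ev by blast+
    then show ?thesis by eventually_elim simp
  qed
  ultimately show ?thesis using assms(4,5) unfolding has_nderiv_ev by auto
qed

lemma Ck_on_deriv_mixed_Ck: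
  assumes E: "normed E" and F: "normed F" and U: "U \<subseteq> nscar E" and f: "Ck_on E F (Suc l) U f"
  obtains f' where "mixed_Ck E nul F U l 0 1 f'" "\<And>x. x \<in> U \<Longrightarrow> has_nderiv E F U f x (\<lambda>v. f' x [] [v])"
proof -
  interpret normed3 E nul F by (intro normed3I std_normed assms)
  obtain f' where f': "mixed_diff E nul F U 0 0 (\<lambda>x _ _. f x) f'" "mixed_Ck E nul F U l 0 (Suc 0) f'"
    using f unfolding Ck_on_nul[OF E F U] by (rule mixed_Ck_SucE)
  have "has_nderiv E F U f x (\<lambda>v. f' x [] [v])" if x: "x \<in> U" for x
  proof -
    have b: "mixed_ml E nul F 0 (Suc 0) (f' x)" by (rule mixed_Ck_ml[OF f'(2) x])
    then obtain c where c: "mixed_le E nul F 0 (Suc 0) (f' x) c" unfolding mixed_ml_def by blast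
    have "\<forall>\<^sub>F y in nbhd E U x. nsnorm F (f y - f x - f' x [] [y - x]) \<le> e * nsnorm E (y - x)" if "e > 0" for e
    proof -
      have "\<forall>\<^sub>F y in nbhd E U x. mixed_le E nul F 0 0 (\<lambda>ws vs. f y - f x - f' x ws ((y - x) # vs)) (e * nsnorm E (y - x))"
        using f'(1) x that unfolding mixed_diff_def by blast
      then show ?thesis by eventually_elim (simp add: mixed_le_def)
    qed
    moreover have "nsnorm F (f' x [] [v]) \<le> c * nsnorm E v" if "v \<in> nscar E" for v
      using c[unfolded mixed_le_def, rule_format, of "[]" "[v]"] that by auto
    ultimately show ?thesis unfolding has_nderiv_ev
      using mixed_ml_in[OF b, of "[]" "[_]"] mixed_ml_lin0v[OF b, of _ _ "[]" "[]"] by auto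
  qed
  then show ?thesis using that f'(2) by auto
qed

lemma Ck_on_has_nderiv:
  assumes "normed E" "normed F" "U \<subseteq> nscar E" "Ck_on E F (Suc l) U f" "x \<in> U"
  shows "has_nderiv E F U f x (nderiv E F U f x)"
  using Ck_on_deriv_mixed_Ck[OF assms(1-4)] has_nderiv_nderiv assms(5) by metis

text \<open>The derivative is a mixed map with one open slot, composed with the projection to the
  point; inserting the projection to the direction into that slot gives (x, v) |-> Df(x) v. One
  order is lost because f' is of class C^l.\<close>

lemma Ck_on_nderiv:
  assumes E: "normed E" and F: "normed F" and U: "nopen E U" and f: "Ck_on E F (Suc l) U f"
  shows "Ck_on (prod_ns E E) F l (U \<times> nscar E) (\<lambda>(x, v). nderiv E F U f x v)"
proof -
  have Us: "U \<subseteq> nscar E" by (rule nopen_sub[OF U])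
  have fin: "\<And>x. x \<in> U \<Longrightarrow> f x \<in> nscar F" using Ck_on_in[OF f] .
  obtain f' where f': "mixed_Ck E nul F U l 0 1 f'" "\<And>x. x \<in> U \<Longrightarrow> has_nderiv E F U f x (\<lambda>v. f' x [] [v])"
    using Ck_on_deriv_mixed_Ck[OF E F Us f] by blast
  let ?P = "prod_ns E E" and ?W = "U \<times> nscar E"
  have P: "normed ?P" by (rule prod_normed[OF E E])
  have W: "?W \<subseteq> nscar ?P" using Us by auto
  interpret normed3 ?P E F by (intro normed3I P E F)
  \<comment> \<open>The chain rule leaves the slot for the direction open (m = 1).\<close>
  have "mixed_Ck ?P E F ?W l 1 0 (\<lambda>x ws _. f' (fst x) [] ws)"
    by (rule mixed_Ck_comp[OF W Us _ std_normed std_normed f'(1)])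
      (use Ck_on_fst[OF E E W] Ck_on_nul[OF P E W] in auto)
  then have 1: "mixed_Ck ?P E F ?W l (Suc 0) (cnt (nbs [])) (\<lambda>x ws _. f' (fst x) [] ws)" by simp
  have "mixed_Ck ?P nul E ?W l 0 0 (\<lambda>x _ _. snd x)"
    using Ck_on_snd[OF E E W] Ck_on_nul[OF P E W] by auto
  then have 2: "mixed_Ck ?P nul E ?W l 0 (cnt []) (\<lambda>x _ _. snd x)" by simp
  \<comment> \<open>No argument is marked: the inserted map \<open>snd\<close> takes none, and
    insertion is evaluation at the direction.\<close>
  have "mixed_Ck ?P E F ?W l 0 (length ([]::bool list)) (\<lambda>x. insert_arg [] (\<lambda>ws _. f' (fst x) [] ws) (\<lambda>(_::real list) _. snd x))"
    by (rule mixed_Ck_insert_arg[OF W std_normed 1 2])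
  then have "mixed_Ck ?P E F ?W l 0 0 (\<lambda>x. insert_arg [] (\<lambda>ws _. f' (fst x) [] ws) (\<lambda>(_::real list) _. snd x))" by simp
  then have 3: "mixed_Ck ?P E F ?W l 0 0 (\<lambda>x. insert_arg [] (\<lambda>ws _. f' (fst x) [] ws) (\<lambda>(_::real list) _. snd x))" .
  have "mixed_Ck ?P E F ?W l 0 0 (\<lambda>x _ _. f' (fst x) [] [snd x])"
    by (rule mixed_Ck_cong[OF _ W P E 3]) (auto simp: insert_arg_def)
  then have "Ck_on ?P F l ?W (\<lambda>x. f' (fst x) [] [snd x])"
    unfolding Ck_on_mixed_Ck[OF P F E W] .
  then show ?thesis
    by (rule Ck_on_cong) (use nderiv_eq[OF E F U _ f'(2) fin] in auto)
qed

section \<open>Manifolds without completeness and separation\<close>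

text \<open>What the calculus in charts works with: a normed model, open images of charts and
  overlaps, and smooth chart changes. These conditions pass to products, tangent bundles and single
  tangent spaces, and are verified for the groups of diffeomorphisms.\<close>

locale premfd =
  fixes M :: "('m, 'i, 'e::real_vector) mfd"
  assumes mod: "normed (model M)"
    and cov: "pts M = (\<Union>i\<in>idx M. cdom M i)"
    and inj: "i \<in> idx M \<Longrightarrow> inj_on (cmap M i) (cdom M i)"
    and ovl: "i \<in> idx M \<Longrightarrow> j \<in> idx M \<Longrightarrow> nopen (model M) (cmap M i ` (cdom M i \<inter> cdom M j))"
    and trans: "i \<in> idx M \<Longrightarrow> j \<in> idx M \<Longrightarrow>
       Ck_on (model M) (model M) l (cmap M i ` (cdom M i \<inter> cdom M j)) (cmap M j \<circ> cinv M i)"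
begin

sublocale E: normed "model M" by (rule mod)

lemma cinv_cmap [simp]: "i \<in> idx M \<Longrightarrow> x \<in> cdom M i \<Longrightarrow> cinv M i (cmap M i x) = x"
  unfolding cinv_def by (rule inv_into_f_f[OF inj])

lemma img: "i \<in> idx M \<Longrightarrow> nopen (model M) (cmap M i ` cdom M i)"
  using ovl[of i i] by simp

lemma cmap_in [simp, intro]: "i \<in> idx M \<Longrightarrow> x \<in> cdom M i \<Longrightarrow> cmap M i x \<in> nscar (model M)"
  using nopen_sub[OF img] by blast

lemma cdom_pts: "i \<in> idx M \<Longrightarrow> x \<in> cdom M i \<Longrightarrow> x \<in> pts M" using cov by blast

lemma cmap_mem_image: "i \<in> idx M \<Longrightarrow> x \<in> cdom M i \<Longrightarrow> A \<subseteq> cdom M i \<Longrightarrow> cmap M i x \<in> cmap M i ` A \<longleftrightarrow> x \<in> A"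
  using inj[of i] by (auto dest: inj_onD)

lemma ptsE: assumes "x \<in> pts M" obtains i where "i \<in> idx M" "x \<in> cdom M i" using assms cov by blast

end

lemma banach_manifold_premfd: assumes "banach_manifold M" shows "premfd M"
proof -
  have E: "normed (model M)" using assms banach_normed unfolding banach_manifold_def by blast
  show ?thesis
    using assms unfolding banach_manifold_def openin_ntop[OF E] by (intro premfd.intro E) blast+
qed

text \<open>\<open>mtop\<close> is defined through \<open>topology\<close>, which returns the
  intended open sets only for a predicate of this kind.\<close>

lemma istopology_mtop:
  "istopology (\<lambda>W. W \<subseteq> pts M \<and> (\<forall>i\<in>idx M. \<exists>V. openin (ntop (model M)) V \<and>
        W \<inter> cdom M i = {x \<in> cdom M i. cmap M i x \<in> V}))"
  unfolding istopology_def
proof (rule conjI; intro allI impI conjI ballI)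
  fix S T i assume S: "S \<subseteq> pts M \<and> (\<forall>i\<in>idx M. \<exists>V. openin (ntop (model M)) V \<and> S \<inter> cdom M i = {x \<in> cdom M i. cmap M i x \<in> V})"
    and T: "T \<subseteq> pts M \<and> (\<forall>i\<in>idx M. \<exists>V. openin (ntop (model M)) V \<and> T \<inter> cdom M i = {x \<in> cdom M i. cmap M i x \<in> V})"
  show "S \<inter> T \<subseteq> pts M" using S by blast
  assume i: "i \<in> idx M"
  then obtain V W where "openin (ntop (model M)) V" "S \<inter> cdom M i = {x \<in> cdom M i. cmap M i x \<in> V}"
     "openin (ntop (model M)) W" "T \<inter> cdom M i = {x \<in> cdom M i. cmap M i x \<in> W}" using S T by blast
  then show "\<exists>V. openin (ntop (model M)) V \<and> S \<inter> T \<inter> cdom M i = {x \<in> cdom M i. cmap M i x \<in> V}"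
    by (intro exI[of _ "V \<inter> W"]) (auto simp: openin_Int)
next
  fix K assume K: "\<forall>S\<in>K. S \<subseteq> pts M \<and> (\<forall>i\<in>idx M. \<exists>V. openin (ntop (model M)) V \<and> S \<inter> cdom M i = {x \<in> cdom M i. cmap M i x \<in> V})"
  then show "\<Union>K \<subseteq> pts M" by blast
  fix i assume i: "i \<in> idx M"
  then have "\<forall>S\<in>K. \<exists>V. openin (ntop (model M)) V \<and> S \<inter> cdom M i = {x \<in> cdom M i. cmap M i x \<in> V}" using K by blast
  then obtain V where V: "\<forall>S\<in>K. openin (ntop (model M)) (V S) \<and> S \<inter> cdom M i = {x \<in> cdom M i. cmap M i x \<in> V S}" by metis
  show "\<exists>V. openin (ntop (model M)) V \<and> \<Union>K \<inter> cdom M i = {x \<in> cdom M i. cmap M i x \<in> V}"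
    by (intro exI[of _ "\<Union>(V ` K)"]) (use V in \<open>auto intro!: openin_Union\<close>)
qed

context premfd
begin

lemma openin_mtop: "openin (mtop M) W \<longleftrightarrow> W \<subseteq> pts M \<and> (\<forall>i\<in>idx M. nopen (model M) (cmap M i ` (W \<inter> cdom M i)))"
proof -
  have "(\<exists>V. nopen (model M) V \<and> W \<inter> cdom M i = {x \<in> cdom M i. cmap M i x \<in> V}) \<longleftrightarrow> nopen (model M) (cmap M i ` (W \<inter> cdom M i))"
    if i: "i \<in> idx M" for i
  proof
    assume "\<exists>V. nopen (model M) V \<and> W \<inter> cdom M i = {x \<in> cdom M i. cmap M i x \<in> V}"
    then obtain V where V: "nopen (model M) V" "W \<inter> cdom M i = {x \<in> cdom M i. cmap M i x \<in> V}" by blast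
    have "cmap M i ` (W \<inter> cdom M i) = V \<inter> cmap M i ` cdom M i" unfolding V(2) by auto
    then show "nopen (model M) (cmap M i ` (W \<inter> cdom M i))" using nopen_Int[OF V(1) img[OF i]] by simp
  next
    assume *: "nopen (model M) (cmap M i ` (W \<inter> cdom M i))"
    have "W \<inter> cdom M i = {x \<in> cdom M i. cmap M i x \<in> cmap M i ` (W \<inter> cdom M i)}"
      using cmap_mem_image[OF i, of _ "W \<inter> cdom M i"] by blast
    then show "\<exists>V. nopen (model M) V \<and> W \<inter> cdom M i = {x \<in> cdom M i. cmap M i x \<in> V}" using * by blast
  qed
  moreover have "openin (mtop M) W \<longleftrightarrow> W \<subseteq> pts M \<and>
     (\<forall>i\<in>idx M. \<exists>V. openin (ntop (model M)) V \<and> W \<inter> cdom M i = {x \<in> cdom M i. cmap M i x \<in> V})"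
    unfolding mtop_def topology_inverse'[OF istopology_mtop] ..
  ultimately show ?thesis unfolding openin_ntop[OF mod] by auto
qed

lemma topspace_mtop [simp]: "topspace (mtop M) = pts M"
proof -
  have "openin (mtop M) (pts M)" unfolding openin_mtop using img cov by (auto simp: Int_absorb1 UN_upper)
  then show ?thesis using openin_mtop by (metis openin_subset openin_topspace subset_antisym)
qed

text \<open>Seen from another chart, the set is a preimage under a chart change, so continuity of
  the chart changes makes it open.\<close>

lemma openin_chart: assumes i: "i \<in> idx M" and V: "nopen (model M) V" shows "openin (mtop M) {x \<in> cdom M i. cmap M i x \<in> V}"
  unfolding openin_mtop
proof (intro conjI ballI)
  show "{x \<in> cdom M i. cmap M i x \<in> V} \<subseteq> pts M" using cov i by blast
  fix j assume j: "j \<in> idx M"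
  have "cmap M j ` ({x \<in> cdom M i. cmap M i x \<in> V} \<inter> cdom M j) = {u \<in> cmap M j ` (cdom M j \<inter> cdom M i). (cmap M i \<circ> cinv M j) u \<in> V}"
    using j by auto
  then show "nopen (model M) (cmap M j ` ({x \<in> cdom M i. cmap M i x \<in> V} \<inter> cdom M j))"
    using Ck_on_vimage_open[OF mod mod ovl[OF j i] trans[OF j i, of 0] V] by simp
qed

lemma openin_cdom: "i \<in> idx M \<Longrightarrow> openin (mtop M) (cdom M i)"
  using openin_chart[of i "cmap M i ` cdom M i"] img by (simp add: Collect_mem_eq cong: conj_cong)

end

section \<open>The local criterion\<close>

text \<open>One pair of charts for each point, with the image of U inside a single chart of N.
  \<open>Ck_map\<close> speaks about all pairs of charts and about continuity besides; both follow
  in \<open>Ck_map_localI\<close>.\<close>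

definition local_Ck where
  "local_Ck l M N f x \<longleftrightarrow> (\<exists>i\<in>idx M. \<exists>j\<in>idx N. \<exists>U. nopen (model M) U \<and> x \<in> cdom M i \<and> cmap M i x \<in> U \<and> U \<subseteq> cmap M i ` cdom M i \<and>
     (\<forall>u\<in>U. f (cinv M i u) \<in> cdom N j) \<and> Ck_on (model M) (model N) l U (\<lambda>u. cmap N j (f (cinv M i u))))"

lemma local_CkI:
  assumes "i \<in> idx M" "j \<in> idx N" "nopen (model M) U" "x \<in> cdom M i" "cmap M i x \<in> U" "U \<subseteq> cmap M i ` cdom M i"
    "\<And>u. u \<in> U \<Longrightarrow> f (cinv M i u) \<in> cdom N j" "Ck_on (model M) (model N) l U g" "\<And>u. u \<in> U \<Longrightarrow> cmap N j (f (cinv M i u)) = g u"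
  shows "local_Ck l M N f x"
proof -
  have "Ck_on (model M) (model N) l U (\<lambda>u. cmap N j (f (cinv M i u)))"
    by (rule Ck_on_cong[OF assms(8)]) (simp add: assms(9))
  then show ?thesis using assms(1-7) unfolding local_Ck_def by blast
qed

text \<open>Continuity comes from the representations in the chosen charts. For any other pair of
  charts the representation is, near each point, the chosen one between two chart changes.\<close>

lemma Ck_map_localI:
  assumes "premfd M" "premfd N" and L: "\<And>x. x \<in> pts M \<Longrightarrow> local_Ck l M N f x"
  shows "Ck_map l M N f"
proof -
  interpret M: premfd M by fact
  interpret N: premfd N by fact
  have LE: "\<exists>i j U. i \<in> idx M \<and> j \<in> idx N \<and> nopen (model M) U \<and> x \<in> cdom M i \<and> cmap M i x \<in> U \<and> U \<subseteq> cmap M i ` cdom M i \<and>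
     (\<forall>u\<in>U. f (cinv M i u) \<in> cdom N j) \<and> Ck_on (model M) (model N) l U (\<lambda>u. cmap N j (f (cinv M i u)))" if "x \<in> pts M" for x
    using L[OF that] unfolding local_Ck_def by blast
  have fin: "f x \<in> pts N" if x: "x \<in> pts M" for x
  proof -
    obtain i j U where "i \<in> idx M" "j \<in> idx N" "x \<in> cdom M i" "cmap M i x \<in> U" "\<forall>u\<in>U. f (cinv M i u) \<in> cdom N j"
      using LE[OF x] by blast
    then show ?thesis using N.cdom_pts by (metis M.cinv_cmap)
  qed
  have "continuous_map (mtop M) (mtop N) f"
    unfolding continuous_map_def
  proof (intro conjI allI impI)
    show "f \<in> topspace (mtop M) \<rightarrow> topspace (mtop N)" using fin by simp
    fix W assume W: "openin (mtop N) W"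
    show "openin (mtop M) {x \<in> topspace (mtop M). f x \<in> W}"
    proof (subst openin_subopen, intro ballI)
      fix x assume "x \<in> {x \<in> topspace (mtop M). f x \<in> W}"
      then have x: "x \<in> pts M" "f x \<in> W" by auto
      obtain i j U where U: "i \<in> idx M" "j \<in> idx N" "nopen (model M) U" "x \<in> cdom M i" "cmap M i x \<in> U" "U \<subseteq> cmap M i ` cdom M i"
       "\<forall>u\<in>U. f (cinv M i u) \<in> cdom N j" "Ck_on (model M) (model N) l U (\<lambda>u. cmap N j (f (cinv M i u)))" using LE[OF x(1)] by blast
      define V where "V = cmap N j ` (W \<inter> cdom N j)"
      have V: "nopen (model N) V" unfolding V_def using W U(2) N.openin_mtop by blast
      define U' where "U' = {u \<in> U. cmap N j (f (cinv M i u)) \<in> V}"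
      have U': "nopen (model M) U'" unfolding U'_def by (rule Ck_on_vimage_open[OF M.mod N.mod U(3,8) V])
      have inj: "f y \<in> cdom N j" if "y \<in> cdom M i" "cmap M i y \<in> U" for y
        using U(7)[rule_format, OF that(2)] M.cinv_cmap[OF U(1) that(1)] by simp
      have eq: "f y \<in> W" if y: "y \<in> cdom M i" "cmap M i y \<in> U'" for y
      proof -
        have "cmap N j (f y) \<in> cmap N j ` (W \<inter> cdom N j)" "f y \<in> cdom N j"
          using y inj[OF y(1)] M.cinv_cmap[OF U(1) y(1)] unfolding U'_def V_def by auto
        then show ?thesis using N.cmap_mem_image[OF U(2), of "f y" "W \<inter> cdom N j"] by blast
      qed
      have "cmap M i x \<in> U'" unfolding U'_def V_def using U(5) x(2) inj[OF U(4,5)] M.cinv_cmap[OF U(1,4)] by auto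
      then show "\<exists>T. openin (mtop M) T \<and> x \<in> T \<and> T \<subseteq> {x \<in> topspace (mtop M). f x \<in> W}"
        using M.openin_chart[OF U(1) U'] eq U(4) M.cdom_pts[OF U(1)]
        by (intro exI[of _ "{y \<in> cdom M i. cmap M i y \<in> U'}"]) auto
    qed
  qed
  moreover have "Ck_on (model M) (model N) l (rep_dom M N f i' j') (rep_map M N f i' j')" if i': "i' \<in> idx M" and j': "j' \<in> idx N" for i' j'
  proof (rule Ck_on_local[OF M.mod N.mod])
    show "rep_dom M N f i' j' \<subseteq> nscar (model M)" unfolding rep_dom_def using i' by auto
    fix v assume "v \<in> rep_dom M N f i' j'"
    then obtain x where x: "x \<in> cdom M i'" "f x \<in> cdom N j'" "v = cmap M i' x" unfolding rep_dom_def by blast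
    obtain i j U where U: "i \<in> idx M" "j \<in> idx N" "nopen (model M) U" "x \<in> cdom M i" "cmap M i x \<in> U" "U \<subseteq> cmap M i ` cdom M i"
       "\<forall>u\<in>U. f (cinv M i u) \<in> cdom N j" "Ck_on (model M) (model N) l U (\<lambda>u. cmap N j (f (cinv M i u)))" using LE[OF M.cdom_pts[OF i' x(1)]] by blast
    \<comment> \<open>A is where the image also lies in the chart j', and W is the part of A seen in
      the chart i': there all three maps of the composition are defined.\<close>
    define A where "A = {w \<in> U. cmap N j (f (cinv M i w)) \<in> cmap N j ` (cdom N j \<inter> cdom N j')}"
    have A: "nopen (model M) A" unfolding A_def by (rule Ck_on_vimage_open[OF M.mod N.mod U(3,8) N.ovl[OF U(2) j']])
    define W where "W = {w \<in> cmap M i' ` (cdom M i' \<inter> cdom M i). (cmap M i \<circ> cinv M i') w \<in> A}"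
    have W: "nopen (model M) W" unfolding W_def by (rule Ck_on_vimage_open[OF M.mod M.mod M.ovl[OF i' U(1)] M.trans[OF i' U(1)] A])
    have Wy: "\<exists>y. y \<in> cdom M i' \<and> y \<in> cdom M i \<and> w = cmap M i' y \<and> cmap M i y \<in> U \<and> f y \<in> cdom N j \<and> f y \<in> cdom N j'" if "w \<in> W" for w
    proof -
      obtain y where y: "y \<in> cdom M i'" "y \<in> cdom M i" "w = cmap M i' y" "cmap M i y \<in> A" using \<open>w \<in> W\<close> i' unfolding W_def by auto
      have yU: "cmap M i y \<in> U" using y(4) unfolding A_def by blast
      then have fy: "f y \<in> cdom N j" using U(7)[rule_format, OF yU] M.cinv_cmap[OF U(1) y(2)] by simp
      have "cmap N j (f y) \<in> cmap N j ` (cdom N j \<inter> cdom N j')" using y(4) M.cinv_cmap[OF U(1) y(2)] unfolding A_def by auto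
      then have "f y \<in> cdom N j'" using fy N.cmap_mem_image[OF U(2) fy, of "cdom N j \<inter> cdom N j'"] by blast
      then show ?thesis using y yU fy by blast
    qed
    have fxj: "f x \<in> cdom N j" using U(7)[rule_format, OF U(5)] M.cinv_cmap[OF U(1,4)] by simp
    have "v \<in> W" unfolding W_def A_def using x U i' fxj by auto
    moreover have "W \<subseteq> rep_dom M N f i' j'" using Wy unfolding rep_dom_def by blast
    moreover have "Ck_on (model M) (model N) l W (rep_map M N f i' j')"
    proof -
      have 1: "Ck_on (model M) (model M) l W (cmap M i \<circ> cinv M i')"
        by (rule Ck_on_subset[OF M.mod M.mod nopen_sub[OF M.ovl[OF i' U(1)]] M.trans[OF i' U(1)]]) (auto simp: W_def)
      have 2: "Ck_on (model M) (model N) l A (\<lambda>u. cmap N j (f (cinv M i u)))"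
        by (rule Ck_on_subset[OF M.mod N.mod nopen_sub[OF U(3)] U(8)]) (auto simp: A_def)
      have 3: "Ck_on (model M) (model N) l W (\<lambda>w. cmap N j (f (cinv M i ((cmap M i \<circ> cinv M i') w))))"
        by (rule Ck_on_compose[OF M.mod M.mod N.mod nopen_sub[OF W] nopen_sub[OF A] _ 1 2]) (auto simp: W_def)
      have "Ck_on (model M) (model N) l W (\<lambda>w. (cmap N j' \<circ> cinv N j) (cmap N j (f (cinv M i ((cmap M i \<circ> cinv M i') w)))))"
        by (rule Ck_on_compose[OF M.mod N.mod N.mod nopen_sub[OF W] nopen_sub[OF N.ovl[OF U(2) j']] _ 3 N.trans[OF U(2) j']])
          (auto simp: W_def A_def)
      then show ?thesis
      proof (rule Ck_on_cong)
        fix w assume "w \<in> W"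
        then obtain y where "y \<in> cdom M i'" "y \<in> cdom M i" "w = cmap M i' y" "f y \<in> cdom N j" using Wy by blast
        then show "(cmap N j' \<circ> cinv N j) (cmap N j (f (cinv M i ((cmap M i \<circ> cinv M i') w)))) = rep_map M N f i' j' w"
          using i' U(1,2) by (simp add: rep_map_def)
      qed
    qed
    ultimately show "\<exists>W\<subseteq>rep_dom M N f i' j'. v \<in> W \<and> nopen (model M) W \<and> Ck_on (model M) (model N) l W (rep_map M N f i' j')"
      using W by blast
  qed
  ultimately show ?thesis unfolding Ck_map_def by blast
qed

lemma Ck_map_in: assumes "premfd M" "premfd N" "Ck_map l M N f" "x \<in> pts M" shows "f x \<in> pts N"
proof -
  interpret M: premfd M by fact
  interpret N: premfd N by fact
  show ?thesis using assms(3,4) unfolding Ck_map_def continuous_map_def by auto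
qed

lemma rep_dom_open: assumes "premfd M" "premfd N" "continuous_map (mtop M) (mtop N) f" "i \<in> idx M" "j \<in> idx N"
  shows "nopen (model M) (rep_dom M N f i j)"
proof -
  interpret M: premfd M by fact
  interpret N: premfd N by fact
  have "openin (mtop M) {x \<in> topspace (mtop M). f x \<in> cdom N j}"
    using assms(3) N.openin_cdom[OF assms(5)] unfolding continuous_map_def by blast
  then have "nopen (model M) (cmap M i ` ({x \<in> pts M. f x \<in> cdom N j} \<inter> cdom M i))" using assms(4) M.openin_mtop by auto
  moreover have "{x \<in> pts M. f x \<in> cdom N j} \<inter> cdom M i = {x \<in> cdom M i. f x \<in> cdom N j}" using M.cdom_pts[OF assms(4)] by auto
  ultimately show ?thesis unfolding rep_dom_def by simp
qed

lemma rep_domE: assumes "premfd M" "i \<in> idx M" "u \<in> rep_dom M N f i j"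
  obtains x where "x \<in> cdom M i" "f x \<in> cdom N j" "u = cmap M i x" "cinv M i u = x"
proof -
  obtain x where "x \<in> cdom M i" "f x \<in> cdom N j" "u = cmap M i x" using assms(3) unfolding rep_dom_def by auto
  then show ?thesis using that premfd.cinv_cmap[OF assms(1,2)] by simp
qed

lemma rep_domI: "x \<in> cdom M i \<Longrightarrow> f x \<in> cdom N j \<Longrightarrow> cmap M i x \<in> rep_dom M N f i j"
  unfolding rep_dom_def by blast

lemma rep_map_cmap: "premfd M \<Longrightarrow> i \<in> idx M \<Longrightarrow> x \<in> cdom M i \<Longrightarrow> rep_map M N f i j (cmap M i x) = cmap N j (f x)"
  unfolding rep_map_def using premfd.cinv_cmap by fastforce

lemma Ck_map_rep: assumes "Ck_map l M N f" "i \<in> idx M" "j \<in> idx N"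
  shows "Ck_on (model M) (model N) l (rep_dom M N f i j) (rep_map M N f i j)"
  using assms unfolding Ck_map_def by blast

lemma Ck_map_cont: "Ck_map l M N f \<Longrightarrow> continuous_map (mtop M) (mtop N) f"
  unfolding Ck_map_def by blast

lemma Ck_map_le: assumes "premfd M" "premfd N" "Ck_map l M N f" "l' \<le> l" shows "Ck_map l' M N f"
  unfolding Ck_map_def
proof (intro conjI ballI)
  fix i j assume *: "i \<in> idx M" "j \<in> idx N"
  show "Ck_on (model M) (model N) l' (rep_dom M N f i j) (rep_map M N f i j)"
    by (rule Ck_on_le[OF premfd.mod[OF assms(1)] premfd.mod[OF assms(2)] _ Ck_map_rep[OF assms(3) *] assms(4)])
      (rule nopen_sub[OF rep_dom_open[OF assms(1,2) Ck_map_cont[OF assms(3)] *]])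
qed (rule Ck_map_cont[OF assms(3)])

lemma Ck_map_compose:
  assumes M: "premfd M" and N: "premfd N" and P: "premfd P" and f: "Ck_map l M N f" and g: "Ck_map l N P g"
  shows "Ck_map l M P (\<lambda>x. g (f x))"
proof (rule Ck_map_localI[OF M P])
  interpret M: premfd M by fact
  interpret N: premfd N by fact
  interpret P: premfd P by fact
  fix x assume x: "x \<in> pts M"
  have fx: "f x \<in> pts N" by (rule Ck_map_in[OF M N f x])
  have gfx: "g (f x) \<in> pts P" by (rule Ck_map_in[OF N P g fx])
  obtain i where i: "i \<in> idx M" "x \<in> cdom M i" using x by (rule M.ptsE)
  obtain j where j: "j \<in> idx N" "f x \<in> cdom N j" using fx by (rule N.ptsE)
  obtain k where k: "k \<in> idx P" "g (f x) \<in> cdom P k" using gfx by (rule P.ptsE)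
  let ?f = "rep_map M N f i j" and ?g = "rep_map N P g j k"
  have Rf: "nopen (model M) (rep_dom M N f i j)" by (rule rep_dom_open[OF M N Ck_map_cont[OF f] i(1) j(1)])
  have Rg: "nopen (model N) (rep_dom N P g j k)" by (rule rep_dom_open[OF N P Ck_map_cont[OF g] j(1) k(1)])
  \<comment> \<open>The two representations compose to that of the composite only while f stays in
    the chart j.\<close>
  define U where "U = {u \<in> rep_dom M N f i j. ?f u \<in> rep_dom N P g j k}"
  have U: "nopen (model M) U" unfolding U_def by (rule Ck_on_vimage_open[OF M.mod N.mod Rf Ck_map_rep[OF f i(1) j(1)] Rg])
  have c: "Ck_on (model M) (model P) l U (\<lambda>u. ?g (?f u))"
    by (rule Ck_on_compose[OF M.mod N.mod P.mod nopen_sub[OF U] nopen_sub[OF Rg] _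
       Ck_on_subset[OF M.mod N.mod nopen_sub[OF Rf] Ck_map_rep[OF f i(1) j(1)]] Ck_map_rep[OF g j(1) k(1)]])
      (auto simp: U_def)
  have Uy: "\<exists>y. y \<in> cdom M i \<and> u = cmap M i y \<and> f y \<in> cdom N j \<and> g (f y) \<in> cdom P k" if "u \<in> U" for u
  proof -
    have "u \<in> rep_dom M N f i j" using that by (simp add: U_def)
    then obtain y where y: "y \<in> cdom M i" "f y \<in> cdom N j" "u = cmap M i y" by (rule rep_domE[OF M i(1)])
    then have "cmap N j (f y) \<in> rep_dom N P g j k" using that by (simp add: U_def rep_map_cmap[OF M i(1)])
    then show ?thesis using y N.cmap_mem_image[OF j(1) y(2), of "{x \<in> cdom N j. g x \<in> cdom P k}"] unfolding rep_dom_def by blast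
  qed
  show "local_Ck l M P (\<lambda>x. g (f x)) x"
  proof (rule local_CkI[OF i(1) k(1) U i(2) _ _ _ c])
    show "cmap M i x \<in> U" unfolding U_def using i j k by (auto simp: rep_map_cmap[OF M] intro!: rep_domI)
    show "U \<subseteq> cmap M i ` cdom M i" using Uy by blast
    fix u assume "u \<in> U"
    then obtain y where y: "y \<in> cdom M i" "u = cmap M i y" "f y \<in> cdom N j" "g (f y) \<in> cdom P k" using Uy by blast
    then show "g (f (cinv M i u)) \<in> cdom P k" "cmap P k (g (f (cinv M i u))) = ?g (?f u)"
      using i j by (simp_all add: rep_map_cmap[OF M] rep_map_cmap[OF N])
  qed
qed

text \<open>This is how the continuity of the action becomes a case of its \<open>C^l\<close> property.\<close>

lemma continuous_Ck_map_0:
  assumes M: "premfd M" and N: "premfd N" and f: "continuous_map (mtop M) (mtop N) f" shows "Ck_map 0 M N f"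
  unfolding Ck_map_def
proof (intro conjI ballI)
  interpret M: premfd M by fact
  interpret N: premfd N by fact
  fix i j assume i: "i \<in> idx M" and j: "j \<in> idx N"
  let ?R = "rep_dom M N f i j" and ?f = "rep_map M N f i j"
  have R: "nopen (model M) ?R" by (rule rep_dom_open[OF M N f i j])
  have fR: "?f u \<in> nscar (model N)" if u: "u \<in> ?R" for u
  proof -
    obtain x where "x \<in> cdom M i" "f x \<in> cdom N j" "u = cmap M i x" using rep_domE[OF M i u] .
    then show ?thesis using j by (simp add: rep_map_cmap[OF M i])
  qed
  have "\<forall>\<^sub>F y in nbhd (model M) ?R u. nsnorm (model N) (?f y - ?f u) \<le> e" if u: "u \<in> ?R" and e: "e > 0" for u e
  proof -
    obtain x where x: "x \<in> cdom M i" "f x \<in> cdom N j" "u = cmap M i x" using rep_domE[OF M i u] .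
    \<comment> \<open>A ball around the image in the coordinates of N, to be pulled back by the
      continuity of f.\<close>
    define V where "V = {v \<in> nscar (model N). nsnorm (model N) (v - ?f u) < e}"
    have V: "nopen (model N) V" unfolding nopen_def
    proof (intro conjI ballI)
      fix v assume v: "v \<in> V"
      show "\<exists>\<delta>>0. \<forall>y\<in>nscar (model N). nsnorm (model N) (y - v) < \<delta> \<longrightarrow> y \<in> V"
      proof (intro exI[of _ "e - nsnorm (model N) (v - ?f u)"] conjI ballI impI)
        fix y assume y: "y \<in> nscar (model N)" "nsnorm (model N) (y - v) < e - nsnorm (model N) (v - ?f u)"
        then show "y \<in> V" using N.E.tri3[OF y(1) _ fR[OF u], of v] v unfolding V_def by auto
      qed (use v in \<open>auto simp: V_def\<close>)
    qed (auto simp: V_def)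
    have "openin (mtop M) {x \<in> topspace (mtop M). f x \<in> {y \<in> cdom N j. cmap N j y \<in> V}}"
      using f N.openin_chart[OF j V] unfolding continuous_map_def by blast
    then have o: "nopen (model M) (cmap M i ` ({x \<in> pts M. f x \<in> cdom N j \<and> cmap N j (f x) \<in> V} \<inter> cdom M i))"
      using i M.openin_mtop by auto
    have "?f u \<in> V" using fR[OF u] e by (auto simp: V_def N.E.norm0)
    then have "u \<in> cmap M i ` ({x \<in> pts M. f x \<in> cdom N j \<and> cmap N j (f x) \<in> V} \<inter> cdom M i)"
      using x M.cdom_pts[OF i] by (auto simp: rep_map_cmap[OF M i])
    then obtain d where d: "d > 0" "\<And>y. y \<in> nscar (model M) \<Longrightarrow> nsnorm (model M) (y - u) < d \<Longrightarrow>
        y \<in> cmap M i ` ({x \<in> pts M. f x \<in> cdom N j \<and> cmap N j (f x) \<in> V} \<inter> cdom M i)"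
      using o unfolding nopen_def by blast
    have "nsnorm (model N) (?f y - ?f u) \<le> e" if "y \<in> ?R" "nsnorm (model M) (y - u) < d" for y
    proof -
      have "y \<in> nscar (model M)" using that nopen_sub[OF R] by blast
      then have "y \<in> cmap M i ` ({x \<in> pts M. f x \<in> cdom N j \<and> cmap N j (f x) \<in> V} \<inter> cdom M i)" by (rule d(2)[OF _ that(2)])
      then obtain z where "z \<in> cdom M i" "cmap N j (f z) \<in> V" "y = cmap M i z" by auto
      then have "?f y \<in> V" by (simp add: rep_map_cmap[OF M i])
      then show ?thesis by (simp add: V_def)
    qed
    then show ?thesis unfolding ev_nbhd using d(1) by blast
  qed
  then show "Ck_on (model M) (model N) 0 ?R ?f" unfolding Ck_on_0[OF M.mod N.mod nopen_sub[OF R]] using fR by blast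
qed (rule f)

section \<open>Products\<close>

lemma prodM_sel [simp]: "pts (prodM M N) = pts M \<times> pts N" "model (prodM M N) = prod_ns (model M) (model N)"
  "idx (prodM M N) = idx M \<times> idx N" "cdom (prodM M N) (i, j) = cdom M i \<times> cdom N j"
  "cmap (prodM M N) (i, j) (x, y) = (cmap M i x, cmap N j y)"
  by (simp_all add: prodM_def)

lemma cmap_prodM_image: "cmap (prodM M N) (i, j) ` (A \<times> B) = cmap M i ` A \<times> cmap N j ` B"
  by (auto simp: image_iff)

lemma prodM_inj: assumes "premfd M" "premfd N" "i \<in> idx M" "j \<in> idx N" shows "inj_on (cmap (prodM M N) (i, j)) (cdom (prodM M N) (i, j))"
  using premfd.inj[OF assms(1,3)] premfd.inj[OF assms(2,4)] by (auto simp: inj_on_def)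

lemma cinv_prodM: assumes "premfd M" "premfd N" "i \<in> idx M" "j \<in> idx N" "u \<in> cmap M i ` cdom M i" "v \<in> cmap N j ` cdom N j"
  shows "cinv (prodM M N) (i, j) (u, v) = (cinv M i u, cinv N j v)"
proof -
  obtain x y where xy: "x \<in> cdom M i" "u = cmap M i x" "y \<in> cdom N j" "v = cmap N j y" using assms by auto
  have "cinv (prodM M N) (i, j) (cmap (prodM M N) (i, j) (x, y)) = (x, y)"
    unfolding cinv_def by (rule inv_into_f_f[OF prodM_inj[OF assms(1-4)]]) (use xy in auto)
  then show ?thesis using xy premfd.cinv_cmap[OF assms(1,3)] premfd.cinv_cmap[OF assms(2,4)] by simp
qed

text \<open>A chart change of the product is the pair of the two chart changes, each composed with a
  projection.\<close>

lemma prodM_premfd: assumes M: "premfd M" and N: "premfd N" shows "premfd (prodM M N)"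
proof -
  interpret M: premfd M by fact
  interpret N: premfd N by fact
  have im: "cmap (prodM M N) (i, j) ` (cdom (prodM M N) (i, j) \<inter> cdom (prodM M N) (i', j')) =
      cmap M i ` (cdom M i \<inter> cdom M i') \<times> cmap N j ` (cdom N j \<inter> cdom N j')" for i j i' j'
    by (simp add: Times_Int_Times cmap_prodM_image)
  show ?thesis
  proof (rule premfd.intro, goal_cases)
    case 1
    show ?case by (simp add: prod_normed M.mod N.mod)
  next
    case 2
    show ?case by (auto simp: M.cov N.cov)
  next
    case (3 p)
    then show ?case using prodM_inj[OF M N] by (cases p) auto
  next
    case (4 p q)
    then show ?case using nopen_Times[OF M.ovl N.ovl] by (cases p; cases q) (auto simp: im simp del: prodM_sel(4))
  next
    case (5 p q l)
    obtain i j i' j' where p: "p = (i, j)" and q: "q = (i', j')" by (cases p; cases q) auto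
    have ij: "i \<in> idx M" "j \<in> idx N" "i' \<in> idx M" "j' \<in> idx N" using 5 p q by auto
    let ?A = "cmap M i ` (cdom M i \<inter> cdom M i')" and ?B = "cmap N j ` (cdom N j \<inter> cdom N j')"
    have A: "?A \<subseteq> nscar (model M)" "?B \<subseteq> nscar (model N)" using nopen_sub M.ovl[OF ij(1,3)] N.ovl[OF ij(2,4)] by blast+
    then have AB: "?A \<times> ?B \<subseteq> nscar (prod_ns (model M) (model N))" by auto
    have P: "normed (prod_ns (model M) (model N))" by (rule prod_normed[OF M.mod N.mod])
    have "Ck_on (prod_ns (model M) (model N)) (prod_ns (model M) (model N)) l (?A \<times> ?B)
       (\<lambda>u. ((cmap M i' \<circ> cinv M i) (fst u), (cmap N j' \<circ> cinv N j) (snd u)))"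
      by (intro Ck_on_pair[OF P M.mod N.mod AB] Ck_on_compose[OF P M.mod M.mod AB A(1) _ Ck_on_fst[OF M.mod N.mod AB] M.trans[OF ij(1,3)]]
         Ck_on_compose[OF P N.mod N.mod AB A(2) _ Ck_on_snd[OF M.mod N.mod AB] N.trans[OF ij(2,4)]]) auto
    then show ?case unfolding p q im prodM_sel(2)
      by (rule Ck_on_cong) (use ij in \<open>auto simp: cinv_prodM[OF M N]\<close>)
  qed
qed

lemma Ck_map_pair:
  assumes M: "premfd M" and N: "premfd N" and P: "premfd P" and f: "Ck_map l M N f" and g: "Ck_map l M P g"
  shows "Ck_map l M (prodM N P) (\<lambda>x. (f x, g x))"
proof (rule Ck_map_localI[OF M prodM_premfd[OF N P]])
  interpret M: premfd M by fact
  interpret N: premfd N by fact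
  interpret P: premfd P by fact
  fix x assume x: "x \<in> pts M"
  obtain i where i: "i \<in> idx M" "x \<in> cdom M i" using x by (rule M.ptsE)
  obtain j where j: "j \<in> idx N" "f x \<in> cdom N j" using Ck_map_in[OF M N f x] by (rule N.ptsE)
  obtain k where k: "k \<in> idx P" "g x \<in> cdom P k" using Ck_map_in[OF M P g x] by (rule P.ptsE)
  let ?U = "rep_dom M N f i j \<inter> rep_dom M P g i k"
  have Rf: "nopen (model M) (rep_dom M N f i j)" by (rule rep_dom_open[OF M N Ck_map_cont[OF f] i(1) j(1)])
  have Rg: "nopen (model M) (rep_dom M P g i k)" by (rule rep_dom_open[OF M P Ck_map_cont[OF g] i(1) k(1)])
  have U: "nopen (model M) ?U" by (rule nopen_Int[OF Rf Rg])
  have c: "Ck_on (model M) (model (prodM N P)) l ?U (\<lambda>u. (rep_map M N f i j u, rep_map M P g i k u))"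
    unfolding prodM_sel
    by (rule Ck_on_pair[OF M.mod N.mod P.mod nopen_sub[OF U]
       Ck_on_subset[OF M.mod N.mod nopen_sub[OF Rf] Ck_map_rep[OF f i(1) j(1)]]
       Ck_on_subset[OF M.mod P.mod nopen_sub[OF Rg] Ck_map_rep[OF g i(1) k(1)]]]) auto
  show "local_Ck l M (prodM N P) (\<lambda>x. (f x, g x)) x"
  proof (rule local_CkI[OF i(1) _ U i(2) _ _ _ c, of "(j, k)"])
    show "(j, k) \<in> idx (prodM N P)" using j k by simp
    show "cmap M i x \<in> ?U" using i j k by (auto intro!: rep_domI)
    show "?U \<subseteq> cmap M i ` cdom M i" by (auto simp: rep_dom_def)
    fix u assume u: "u \<in> ?U"
    have "u \<in> rep_dom M N f i j" "u \<in> rep_dom M P g i k" using u by auto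
    obtain y where y: "f y \<in> cdom N j" "cinv M i u = y" by (rule rep_domE[OF M i(1) \<open>u \<in> rep_dom M N f i j\<close>])
    obtain z where z: "g z \<in> cdom P k" "cinv M i u = z" by (rule rep_domE[OF M i(1) \<open>u \<in> rep_dom M P g i k\<close>])
    show "(f (cinv M i u), g (cinv M i u)) \<in> cdom (prodM N P) (j, k)" using y z by simp
    show "cmap (prodM N P) (j, k) (f (cinv M i u), g (cinv M i u)) = (rep_map M N f i j u, rep_map M P g i k u)"
      by (simp add: rep_map_def)
  qed
qed

lemma Ck_map_id: assumes M: "premfd M" shows "Ck_map l M M (\<lambda>x. x)"
proof (rule Ck_map_localI[OF M M])
  interpret M: premfd M by fact
  fix x assume x: "x \<in> pts M"
  obtain i where i: "i \<in> idx M" "x \<in> cdom M i" using x by (rule M.ptsE)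
  show "local_Ck l M M (\<lambda>x. x) x"
    by (rule local_CkI[OF i(1) i(1) M.img[OF i(1)] i(2) _ _ _ Ck_on_id[OF M.mod nopen_sub[OF M.img[OF i(1)]]]])
      (use i in auto)
qed

lemma Ck_map_const: assumes M: "premfd M" and N: "premfd N" and c: "c \<in> pts N" shows "Ck_map l M N (\<lambda>_. c)"
proof (rule Ck_map_localI[OF M N])
  interpret M: premfd M by fact
  interpret N: premfd N by fact
  fix x assume x: "x \<in> pts M"
  obtain i where i: "i \<in> idx M" "x \<in> cdom M i" using x by (rule M.ptsE)
  obtain j where j: "j \<in> idx N" "c \<in> cdom N j" using c by (rule N.ptsE)
  show "local_Ck l M N (\<lambda>_. c) x"
    by (rule local_CkI[OF i(1) j(1) M.img[OF i(1)] i(2) _ _ _ Ck_on_const[OF M.mod N.mod nopen_sub[OF M.img[OF i(1)]] N.cmap_in[OF j]]])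
      (use i j in auto)
qed

lemma Ck_map_fst: assumes M: "premfd M" and N: "premfd N" shows "Ck_map l (prodM M N) M fst"
proof (rule Ck_map_localI[OF prodM_premfd[OF M N] M])
  interpret M: premfd M by fact
  interpret N: premfd N by fact
  interpret P: premfd "prodM M N" by (rule prodM_premfd[OF M N])
  fix p assume p: "p \<in> pts (prodM M N)"
  obtain x y where xy: "p = (x, y)" "x \<in> pts M" "y \<in> pts N" using p by auto
  obtain i where i: "i \<in> idx M" "x \<in> cdom M i" using xy(2) by (rule M.ptsE)
  obtain j where j: "j \<in> idx N" "y \<in> cdom N j" using xy(3) by (rule N.ptsE)
  have ij: "(i, j) \<in> idx (prodM M N)" using i j by simp
  show "local_Ck l (prodM M N) M fst p" unfolding xy(1)
    by (rule local_CkI[OF ij i(1) P.img[OF ij] _ _ _ _ Ck_on_fst[OF M.mod N.mod nopen_sub[OF P.img[OF ij], unfolded prodM_sel(2)], folded prodM_sel(2)]])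
      (use i j in \<open>auto simp: cinv_prodM[OF M N] cmap_prodM_image\<close>)
qed

lemma Ck_map_snd: assumes M: "premfd M" and N: "premfd N" shows "Ck_map l (prodM M N) N snd"
proof (rule Ck_map_localI[OF prodM_premfd[OF M N] N])
  interpret M: premfd M by fact
  interpret N: premfd N by fact
  interpret P: premfd "prodM M N" by (rule prodM_premfd[OF M N])
  fix p assume p: "p \<in> pts (prodM M N)"
  obtain x y where xy: "p = (x, y)" "x \<in> pts M" "y \<in> pts N" using p by auto
  obtain i where i: "i \<in> idx M" "x \<in> cdom M i" using xy(2) by (rule M.ptsE)
  obtain j where j: "j \<in> idx N" "y \<in> cdom N j" using xy(3) by (rule N.ptsE)
  have ij: "(i, j) \<in> idx (prodM M N)" using i j by simp
  show "local_Ck l (prodM M N) N snd p" unfolding xy(1)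
    by (rule local_CkI[OF ij j(1) P.img[OF ij] _ _ _ _ Ck_on_snd[OF M.mod N.mod nopen_sub[OF P.img[OF ij], unfolded prodM_sel(2)], folded prodM_sel(2)]])
      (use i j in \<open>auto simp: cinv_prodM[OF M N] cmap_prodM_image\<close>)
qed

lemma linM_sel [simp]: "pts (linM E) = nscar E" "model (linM E) = E" "idx (linM E) = UNIV" "cdom (linM E) i = nscar E"
  "cmap (linM E) i = (\<lambda>x. x)"
  by (simp_all add: linM_def)

lemma linM_premfd: assumes "normed E" shows "premfd (linM E)"
proof (rule premfd.intro, goal_cases)
  case (5 i j l)
  have "cinv (linM E) i x = x" if "x \<in> nscar E" for x
    unfolding cinv_def using inv_into_f_f[of "\<lambda>x. x" "nscar E" x] that by simp
  then show ?case using Ck_on_cong[OF Ck_on_id[OF assms, of "nscar E"], where g = "cmap (linM E) j \<circ> cinv (linM E) i"] by simp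
qed (use assms nopen_car in auto)

section \<open>Derivatives in charts\<close>

text \<open>The coordinate form of the tangent map in a chosen pair of charts; \<open>tmap\<close>
  is assembled from these (\<open>tmap_chart_D\<close>).\<close>

definition chart_D where
  "chart_D M N f i j x = nderiv (model M) (model N) (rep_dom M N f i j) (rep_map M N f i j) (cmap M i x)"

lemma idx_at_iff: "i \<in> idx_at M x \<longleftrightarrow> i \<in> idx M \<and> x \<in> cdom M i" by (simp add: idx_at_def)

lemma (in premfd) idx_at_pts: "i \<in> idx_at M x \<Longrightarrow> x \<in> pts M" unfolding idx_at_iff using cdom_pts by blast

lemma (in premfd) some_idx: "x \<in> pts M \<Longrightarrow> (SOME i. i \<in> idx_at M x) \<in> idx_at M x"
  by (metis idx_at_iff ptsE someI_ex)

lemma rep_map_in: assumes M: "premfd M" and N: "premfd N" and "i \<in> idx M" "j \<in> idx N" "u \<in> rep_dom M N f i j"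
  shows "rep_map M N f i j u \<in> nscar (model N)"
proof -
  obtain x where "x \<in> cdom M i" "f x \<in> cdom N j" "u = cmap M i x" using rep_domE[OF M assms(3,5)] .
  then show ?thesis using premfd.cmap_in[OF N assms(4)] by (simp add: rep_map_cmap[OF M assms(3)])
qed

lemma chart_D_has:
  assumes M: "premfd M" and N: "premfd N" and f: "Ck_map (Suc 0) M N f" and i: "i \<in> idx_at M x" and j: "j \<in> idx_at N (f x)"
  shows "has_nderiv (model M) (model N) (rep_dom M N f i j) (rep_map M N f i j) (cmap M i x) (chart_D M N f i j x)"
proof -
  have ij: "i \<in> idx M" "j \<in> idx N" using i j by (auto simp: idx_at_iff)
  show ?thesis unfolding chart_D_def
    by (rule Ck_on_has_nderiv[OF premfd.mod[OF M] premfd.mod[OF N] nopen_sub[OF rep_dom_open[OF M N Ck_map_cont[OF f] ij]] Ck_map_rep[OF f ij]])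
      (use i j in \<open>auto simp: idx_at_iff intro!: rep_domI\<close>)
qed

text \<open>Derivatives at interior points do not change when the domain shrinks, so L may be
  checked on any open W around the point.\<close>

lemma chart_D_eqI:
  assumes M: "premfd M" and N: "premfd N" and f: "continuous_map (mtop M) (mtop N) f" and i: "i \<in> idx_at M x" and j: "j \<in> idx_at N (f x)"
    and L: "has_nderiv (model M) (model N) W (rep_map M N f i j) (cmap M i x) L" and W: "nopen (model M) W" "cmap M i x \<in> W" "W \<subseteq> rep_dom M N f i j"
    and v: "v \<in> nscar (model M)"
  shows "chart_D M N f i j x v = L v"
proof -
  have ij: "i \<in> idx M" "j \<in> idx N" using i j by (auto simp: idx_at_iff)
  have R: "nopen (model M) (rep_dom M N f i j)" by (rule rep_dom_open[OF M N f ij])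
  have "has_nderiv (model M) (model N) (rep_dom M N f i j) (rep_map M N f i j) (cmap M i x) L"
    using L unfolding has_nderiv_local[OF W(1,2) nopen_sub[OF R] W(3)] .
  note h = this
  have x: "cmap M i x \<in> rep_dom M N f i j" using W by auto
  show ?thesis unfolding chart_D_def
    by (rule nderiv_eq[OF premfd.mod[OF M] premfd.mod[OF N] R x h rep_map_in[OF M N ij] v])
qed

lemma chart_D_in: assumes "premfd M" "premfd N" "Ck_map (Suc 0) M N f" "i \<in> idx_at M x" "j \<in> idx_at N (f x)" "v \<in> nscar (model M)"
  shows "chart_D M N f i j x v \<in> nscar (model N)"
  using chart_D_has[OF assms(1-5)] assms(6) unfolding has_nderiv_def by blast

lemma chart_D_add: assumes "premfd M" "premfd N" "Ck_map (Suc 0) M N f" "i \<in> idx_at M x" "j \<in> idx_at N (f x)"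
    "v \<in> nscar (model M)" "w \<in> nscar (model M)"
  shows "chart_D M N f i j x (v + w) = chart_D M N f i j x v + chart_D M N f i j x w"
proof -
  have "chart_D M N f i j x (1 *\<^sub>R v + 1 *\<^sub>R w) = 1 *\<^sub>R chart_D M N f i j x v + 1 *\<^sub>R chart_D M N f i j x w"
    using chart_D_has[OF assms(1-5)] assms(6,7) unfolding has_nderiv_def by blast
  then show ?thesis by simp
qed

lemma rep_map_cong:
  assumes M: "premfd M" and i: "i \<in> idx M" and eq: "\<And>y. y \<in> pts M \<Longrightarrow> f y = g y"
  shows "rep_dom M N f i j = rep_dom M N g i j" "u \<in> rep_dom M N g i j \<Longrightarrow> rep_map M N f i j u = rep_map M N g i j u"
proof -
  show "rep_dom M N f i j = rep_dom M N g i j"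
    unfolding rep_dom_def by (rule arg_cong[of _ _ "image _"]) (use eq premfd.cdom_pts[OF M i] in auto)
  assume "u \<in> rep_dom M N g i j"
  then obtain x where "x \<in> cdom M i" "cinv M i u = x" by (rule rep_domE[OF M i])
  then show "rep_map M N f i j u = rep_map M N g i j u" using eq[OF premfd.cdom_pts[OF M i]] by (simp add: rep_map_def)
qed

lemma chart_D_cong:
  assumes M: "premfd M" and eq: "\<And>y. y \<in> pts M \<Longrightarrow> f y = g y" and i: "i \<in> idx_at M x" and j: "j \<in> idx_at N (g x)"
  shows "chart_D M N f i j x = chart_D M N g i j x"
proof -
  have i': "i \<in> idx M" using i by (simp add: idx_at_iff)
  have d: "rep_dom M N f i j = rep_dom M N g i j" by (rule rep_map_cong(1)[OF M i' eq])
  show ?thesis unfolding chart_D_def d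
    by (rule nderiv_cong) (use rep_map_cong(2)[OF M i' eq] i j in \<open>auto simp: idx_at_iff intro!: rep_domI\<close>)
qed

text \<open>The middle chart j is arbitrary. Taken with the identity for one of the two maps, the
  rule yields every independence of charts used below.\<close>

lemma chart_D_chain:
  assumes M: "premfd M" and N: "premfd N" and P: "premfd P" and f: "Ck_map (Suc 0) M N f" and g: "Ck_map (Suc 0) N P g"
    and i: "i \<in> idx_at M x" and j: "j \<in> idx_at N (f x)" and k: "k \<in> idx_at P (g (f x))" and v: "v \<in> nscar (model M)"
  shows "chart_D M P (\<lambda>x. g (f x)) i k x v = chart_D N P g j k (f x) (chart_D M N f i j x v)"
proof -
  interpret M: premfd M by fact
  interpret N: premfd N by fact
  interpret P: premfd P by fact
  have i': "i \<in> idx M" "x \<in> cdom M i" and j': "j \<in> idx N" "f x \<in> cdom N j" and k': "k \<in> idx P" "g (f x) \<in> cdom P k"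
    using i j k by (auto simp: idx_at_iff)
  let ?f = "rep_map M N f i j" and ?g = "rep_map N P g j k" and ?R = "rep_dom M N f i j" and ?S = "rep_dom N P g j k"
  have R: "nopen (model M) ?R" by (rule rep_dom_open[OF M N Ck_map_cont[OF f] i'(1) j'(1)])
  have S: "nopen (model N) ?S" by (rule rep_dom_open[OF N P Ck_map_cont[OF g] j'(1) k'(1)])
  define U where "U = {u \<in> ?R. ?f u \<in> ?S}"
  have U: "nopen (model M) U" unfolding U_def by (rule Ck_on_vimage_open[OF M.mod N.mod R Ck_map_rep[OF f i'(1) j'(1)] S])
  have xU: "cmap M i x \<in> U" unfolding U_def using i' j' k' by (auto simp: rep_map_cmap[OF M] intro!: rep_domI)
  have Uy: "u \<in> rep_dom M P (\<lambda>x. g (f x)) i k" "?g (?f u) = rep_map M P (\<lambda>x. g (f x)) i k u" if uU: "u \<in> U" for u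
  proof -
    have "u \<in> ?R" using uU by (simp add: U_def)
    then obtain y where y: "y \<in> cdom M i" "f y \<in> cdom N j" "u = cmap M i y" by (rule rep_domE[OF M i'(1)])
    then have "cmap N j (f y) \<in> ?S" using uU by (simp add: U_def rep_map_cmap[OF M i'(1)])
    then have "g (f y) \<in> cdom P k" using y N.cmap_mem_image[OF j'(1) y(2), of "{x \<in> cdom N j. g x \<in> cdom P k}"] unfolding rep_dom_def by blast
    then show "u \<in> rep_dom M P (\<lambda>x. g (f x)) i k" "?g (?f u) = rep_map M P (\<lambda>x. g (f x)) i k u"
      using y by (auto intro!: rep_domI simp: rep_map_cmap[OF M i'(1)] rep_map_cmap[OF N j'(1)])
  qed
  have 1: "has_nderiv (model M) (model N) U ?f (cmap M i x) (chart_D M N f i j x)"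
    using chart_D_has[OF M N f i j] has_nderiv_local[OF U xU nopen_sub[OF R], of "model N" ?f "chart_D M N f i j x"] by (simp add: U_def)
  have 2: "has_nderiv (model N) (model P) ?S ?g (?f (cmap M i x)) (chart_D N P g j k (f x))"
    using chart_D_has[OF N P g j k] i' by (simp add: rep_map_cmap[OF M])
  have "has_nderiv (model M) (model P) U (\<lambda>u. ?g (?f u)) (cmap M i x) (\<lambda>v. chart_D N P g j k (f x) (chart_D M N f i j x v))"
    by (rule has_nderiv_compose[OF M.mod N.mod P.mod nopen_sub[OF U] nopen_sub[OF S] _ rep_map_in[OF N P j'(1) k'(1)] xU 1 2])
      (auto simp: U_def)
  then have 3: "has_nderiv (model M) (model P) U (rep_map M P (\<lambda>x. g (f x)) i k) (cmap M i x) (\<lambda>v. chart_D N P g j k (f x) (chart_D M N f i j x v))"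
    using has_nderiv_cong[of U "\<lambda>u. ?g (?f u)" "rep_map M P (\<lambda>x. g (f x)) i k", OF Uy(2) xU] by blast
  show ?thesis
    by (rule chart_D_eqI[OF M P Ck_map_cont[OF Ck_map_compose[OF M N P f g]] i k 3 U xU _ v]) (use Uy in auto)
qed

lemma chart_D_pair:
  assumes M: "premfd M" and N: "premfd N" and P: "premfd P" and f: "Ck_map (Suc 0) M N f" and g: "Ck_map (Suc 0) M P g"
    and i: "i \<in> idx_at M x" and j: "j \<in> idx_at N (f x)" and k: "k \<in> idx_at P (g x)" and v: "v \<in> nscar (model M)"
  shows "chart_D M (prodM N P) (\<lambda>x. (f x, g x)) i (j, k) x v = (chart_D M N f i j x v, chart_D M P g i k x v)"
proof -
  interpret M: premfd M by fact
  interpret N: premfd N by fact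
  interpret P: premfd P by fact
  have i': "i \<in> idx M" "x \<in> cdom M i" and j': "j \<in> idx N" "f x \<in> cdom N j" and k': "k \<in> idx P" "g x \<in> cdom P k"
    using i j k by (auto simp: idx_at_iff)
  have jk: "(j, k) \<in> idx_at (prodM N P) (f x, g x)" using j' k' by (auto simp: idx_at_iff)
  let ?R = "rep_dom M N f i j" and ?S = "rep_dom M P g i k" and ?T = "rep_dom M (prodM N P) (\<lambda>x. (f x, g x)) i (j, k)"
  have R: "nopen (model M) ?R" by (rule rep_dom_open[OF M N Ck_map_cont[OF f] i'(1) j'(1)])
  have S: "nopen (model M) ?S" by (rule rep_dom_open[OF M P Ck_map_cont[OF g] i'(1) k'(1)])
  have c: "continuous_map (mtop M) (mtop (prodM N P)) (\<lambda>x. (f x, g x))" by (rule Ck_map_cont[OF Ck_map_pair[OF M N P f g]])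
  have T: "nopen (model M) ?T" by (rule rep_dom_open[OF M prodM_premfd[OF N P] c i'(1)]) (use j' k' in auto)
  have sub: "?T \<subseteq> ?R" "?T \<subseteq> ?S" unfolding rep_dom_def by auto
  have x: "cmap M i x \<in> ?T" using i' j' k' by (auto intro!: rep_domI)
  have eq: "rep_map M (prodM N P) (\<lambda>x. (f x, g x)) i (j, k) = (\<lambda>u. (rep_map M N f i j u, rep_map M P g i k u))"
    by (rule ext) (simp add: rep_map_def)
  have "has_nderiv (model M) (model N) ?T (rep_map M N f i j) (cmap M i x) (chart_D M N f i j x)"
    "has_nderiv (model M) (model P) ?T (rep_map M P g i k) (cmap M i x) (chart_D M P g i k x)"
    by (rule has_nderiv_local[OF T x nopen_sub[OF R] sub(1), THEN iffD2, OF chart_D_has[OF M N f i j]])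
      (rule has_nderiv_local[OF T x nopen_sub[OF S] sub(2), THEN iffD2, OF chart_D_has[OF M P g i k]])
  from has_nderiv_pair[OF M.mod N.mod P.mod this]
  have "has_nderiv (model M) (model (prodM N P)) ?T (rep_map M (prodM N P) (\<lambda>x. (f x, g x)) i (j, k)) (cmap M i x) (\<lambda>v. (chart_D M N f i j x v, chart_D M P g i k x v))"
    unfolding eq by simp
  from chart_D_eqI[OF M prodM_premfd[OF N P] c i jk this T x order_refl v] show ?thesis .
qed

text \<open>Identity and projections are linear in suitable charts, so their chart derivatives are
  these linear maps themselves.\<close>

lemma chart_D_linear:
  assumes M: "premfd M" and N: "premfd N" and f: "continuous_map (mtop M) (mtop N) f" and i: "i \<in> idx_at M x" and j: "j \<in> idx_at N (f x)"
    and eq: "\<And>y. y \<in> cdom M i \<Longrightarrow> f y \<in> cdom N j \<Longrightarrow> cmap N j (f y) = L (cmap M i y)"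
    and L: "\<And>v. v \<in> nscar (model M) \<Longrightarrow> L v \<in> nscar (model N)"
    "\<And>v w a b. v \<in> nscar (model M) \<Longrightarrow> w \<in> nscar (model M) \<Longrightarrow> L (a *\<^sub>R v + b *\<^sub>R w) = a *\<^sub>R L v + b *\<^sub>R L w"
    and c: "\<And>v. v \<in> nscar (model M) \<Longrightarrow> nsnorm (model N) (L v) \<le> c * nsnorm (model M) v"
    and v: "v \<in> nscar (model M)"
  shows "chart_D M N f i j x v = L v"
proof -
  have ij: "i \<in> idx M" "j \<in> idx N" using i j by (auto simp: idx_at_iff)
  let ?U = "rep_dom M N f i j"
  have U: "nopen (model M) ?U" by (rule rep_dom_open[OF M N f ij])
  have x: "cmap M i x \<in> ?U" using i j by (auto simp: idx_at_iff intro!: rep_domI)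
  have "L u = rep_map M N f i j u" if u: "u \<in> ?U" for u
  proof -
    obtain y where "y \<in> cdom M i" "f y \<in> cdom N j" "u = cmap M i y" using rep_domE[OF M ij(1) u] .
    then show ?thesis using eq by (simp add: rep_map_cmap[OF M ij(1)])
  qed
  then have "has_nderiv (model M) (model N) ?U (rep_map M N f i j) (cmap M i x) L"
    using has_nderiv_linear[OF premfd.mod[OF M] premfd.mod[OF N] x nopen_sub[OF U] L c] has_nderiv_cong[of ?U L, OF _ x] by blast
  from chart_D_eqI[OF M N f i j this U x order_refl v] show ?thesis .
qed

lemma chart_D_id:
  assumes M: "premfd M" and i: "i \<in> idx_at M x" and v: "v \<in> nscar (model M)"
  shows "chart_D M M (\<lambda>x. x) i i x v = v"
  by (rule chart_D_linear[OF M M Ck_map_cont[OF Ck_map_id[OF M]] i i, where c = 1]) (use v in auto)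

lemma chart_D_const:
  assumes M: "premfd M" and N: "premfd N" and i: "i \<in> idx_at M x" and j: "j \<in> idx_at N c" and v: "v \<in> nscar (model M)"
  shows "chart_D M N (\<lambda>_. c) i j x v = 0"
proof -
  interpret M: premfd M by fact
  interpret N: premfd N by fact
  have i': "i \<in> idx M" "x \<in> cdom M i" and j': "j \<in> idx N" "c \<in> cdom N j" using i j by (auto simp: idx_at_iff)
  let ?U = "rep_dom M N (\<lambda>_. c) i j"
  have trans_D: "continuous_map (mtop M) (mtop N) (\<lambda>_. c)" by (rule Ck_map_cont[OF Ck_map_const[OF M N N.cdom_pts[OF j']]])
  have U: "nopen (model M) ?U" by (rule rep_dom_open[OF M N trans_D i'(1) j'(1)])
  have x: "cmap M i x \<in> ?U" using i' j' by (auto intro!: rep_domI)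
  have "0 \<le> nsnorm (model M) (y - cmap M i x)" if "y \<in> ?U" for y
    using that nopen_sub[OF U] x by (intro M.E.nonneg M.E.diff_in) auto
  then have "has_nderiv (model M) (model N) ?U (rep_map M N (\<lambda>_. c) i j) (cmap M i x) (\<lambda>v. 0)"
    unfolding has_nderiv_def rep_map_def by (auto intro!: exI[of _ 1])
  from chart_D_eqI[OF M N trans_D i j this U x order_refl v] show ?thesis .
qed

lemma chart_D_fst:
  assumes M: "premfd M" and N: "premfd N" and i: "i \<in> idx_at M x" and j: "j \<in> idx_at N y" and v: "v \<in> nscar (model M)" "w \<in> nscar (model N)"
  shows "chart_D (prodM M N) M fst (i, j) i (x, y) (v, w) = v"
proof -
  have "chart_D (prodM M N) M fst (i, j) i (x, y) (v, w) = fst (v, w)"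
    by (rule chart_D_linear[OF prodM_premfd[OF M N] M Ck_map_cont[OF Ck_map_fst[OF M N]], where c = 1])
      (use i j v in \<open>auto simp: idx_at_iff\<close>)
  then show ?thesis by simp
qed

lemma chart_D_snd:
  assumes M: "premfd M" and N: "premfd N" and i: "i \<in> idx_at M x" and j: "j \<in> idx_at N y" and v: "v \<in> nscar (model M)" "w \<in> nscar (model N)"
  shows "chart_D (prodM M N) N snd (i, j) j (x, y) (v, w) = w"
proof -
  have "chart_D (prodM M N) N snd (i, j) j (x, y) (v, w) = snd (v, w)"
    by (rule chart_D_linear[OF prodM_premfd[OF M N] N Ck_map_cont[OF Ck_map_snd[OF M N]], where c = 1])
      (use i j v in \<open>auto simp: idx_at_iff\<close>)
  then show ?thesis by simp
qed

section \<open>Tangent vectors\<close>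

text \<open>The derivative of the chart change, read as the derivative of the identity map in two
  charts. The cocycle rule is then an instance of the chain rule.\<close>

abbreviation trans_D where "trans_D M i j x \<equiv> chart_D M M (\<lambda>x. x) i j x"

lemma tspace_iff: "X \<in> tspace M x \<longleftrightarrow> fst X = x \<and> snd X \<in> extensional (idx_at M x) \<and> (\<forall>i\<in>idx_at M x. snd X i \<in> nscar (model M)) \<and>
     (\<forall>i\<in>idx_at M x. \<forall>j\<in>idx_at M x. snd X j = trans_D M i j x (snd X i))"
proof -
  have 1: "rep_dom M M (\<lambda>x. x) i j = cmap M i ` (cdom M i \<inter> cdom M j)" for i j
    by (auto simp: rep_dom_def)
  have 2: "rep_map M M (\<lambda>x. x) i j = cmap M j \<circ> cinv M i" for i j
    by (auto simp: rep_map_def)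
  show ?thesis unfolding tspace_def chart_D_def 1 2
    by (cases X) (simp only: mem_Collect_eq prod.inject fst_conv snd_conv, blast)
qed

lemma tspace_fst: "X \<in> tspace M x \<Longrightarrow> fst X = x" unfolding tspace_iff by blast

lemma tspace_coord: "X \<in> tspace M x \<Longrightarrow> i \<in> idx_at M x \<Longrightarrow> snd X i \<in> nscar (model M)" unfolding tspace_iff by blast

lemma tspace_trans_D: "X \<in> tspace M x \<Longrightarrow> i \<in> idx_at M x \<Longrightarrow> j \<in> idx_at M x \<Longrightarrow> trans_D M i j x (snd X i) = snd X j" unfolding tspace_iff by metis

lemma tspace_ext: "X \<in> tspace M x \<Longrightarrow> snd X \<in> extensional (idx_at M x)" unfolding tspace_iff by blast

text \<open>The coordinate in one chart determines those in all charts around x through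
  \<open>trans_D\<close>; for the other indices both families are \<open>undefined\<close> by
  extensionality.\<close>

lemma tspace_eqI: assumes "X \<in> tspace M x" "Y \<in> tspace M x" "i \<in> idx_at M x" "snd X i = snd Y i" shows "X = Y"
proof (rule prod_eqI)
  show "fst X = fst Y" using tspace_fst[OF assms(1)] tspace_fst[OF assms(2)] by simp
  show "snd X = snd Y"
  proof (rule extensionalityI[of _ "idx_at M x"])
    show "snd X j = snd Y j" if "j \<in> idx_at M x" for j
      using tspace_trans_D[OF assms(1,3) that] tspace_trans_D[OF assms(2,3) that] assms(4) by simp
  qed (rule tspace_ext[OF assms(1)], rule tspace_ext[OF assms(2)])
qed

lemma trans_D_chain:
  assumes M: "premfd M" and "i \<in> idx_at M x" "j \<in> idx_at M x" "k \<in> idx_at M x" "v \<in> nscar (model M)"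
  shows "trans_D M j k x (trans_D M i j x v) = trans_D M i k x v"
  using chart_D_chain[OF M M M Ck_map_id[OF M] Ck_map_id[OF M] assms(2-5)] by simp

lemma trans_D_in:
  assumes M: "premfd M" and "i \<in> idx_at M x" "j \<in> idx_at M x" "v \<in> nscar (model M)"
  shows "trans_D M i j x v \<in> nscar (model M)"
  by (rule chart_D_in[OF M M Ck_map_id[OF M] assms(2-4)])

text \<open>The inverse of the chart i of the tangent bundle, see \<open>TM_cinv\<close>: one
  coordinate vector spread to all charts around x.\<close>

definition tvec where "tvec M i x w = (x, restrict (\<lambda>k. trans_D M i k x w) (idx_at M x))"

lemma tvec_in: assumes M: "premfd M" and "i \<in> idx_at M x" "w \<in> nscar (model M)" shows "tvec M i x w \<in> tspace M x"
  unfolding tspace_iff tvec_def using trans_D_chain[OF M assms(2)] trans_D_in[OF M assms(2)] assms(3) by simp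

lemma tvec_coord: assumes M: "premfd M" and "i \<in> idx_at M x" "w \<in> nscar (model M)" shows "snd (tvec M i x w) i = w"
  unfolding tvec_def using chart_D_id[OF assms] assms by simp

lemma tmap_chart_D: "tmap M N f X = (f (fst X), restrict (\<lambda>j. chart_D M N f (SOME i. i \<in> idx_at M (fst X)) j (fst X) (snd X (SOME i. i \<in> idx_at M (fst X)))) (idx_at N (f (fst X))))"
  by (simp add: tmap_def chart_D_def Let_def)

lemma fst_tmap [simp]: "fst (tmap M N f X) = f (fst X)" by (simp add: tmap_chart_D)

text \<open>\<open>tmap\<close> is defined by an arbitrarily chosen chart around the base point.
  Passing to another chart i inserts a \<open>trans_D\<close>, which the chain rule absorbs.\<close>

lemma tmap_coord:
  assumes M: "premfd M" and N: "premfd N" and f: "Ck_map (Suc 0) M N f" and X: "X \<in> tspace M x" and i: "i \<in> idx_at M x" and j: "j \<in> idx_at N (f x)"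
  shows "snd (tmap M N f X) j = chart_D M N f i j x (snd X i)"
proof -
  let ?i = "SOME i. i \<in> idx_at M x"
  have i0: "?i \<in> idx_at M x" by (rule premfd.some_idx[OF M premfd.idx_at_pts[OF M i]])
  have "snd X i = trans_D M ?i i x (snd X ?i)" using tspace_trans_D[OF X i0 i] by simp
  then have "chart_D M N f i j x (snd X i) = chart_D M N f ?i j x (snd X ?i)"
    using chart_D_chain[OF M M N Ck_map_id[OF M] f i0 i j tspace_coord[OF X i0]] by simp
  then show ?thesis using tspace_fst[OF X] j by (simp add: tmap_chart_D)
qed

lemma tmap_in:
  assumes M: "premfd M" and N: "premfd N" and f: "Ck_map (Suc 0) M N f" and x: "x \<in> pts M" and X: "X \<in> tspace M x"
  shows "tmap M N f X \<in> tspace N (f x)"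
proof -
  have i: "(SOME i. i \<in> idx_at M x) \<in> idx_at M x" (is "?i \<in> _") by (rule premfd.some_idx[OF M x])
  have "chart_D N N (\<lambda>x. x) j k (f x) (chart_D M N f ?i j x (snd X ?i)) = chart_D M N f ?i k x (snd X ?i)"
    if "j \<in> idx_at N (f x)" "k \<in> idx_at N (f x)" for j k
    using chart_D_chain[OF M N N f Ck_map_id[OF N] i that tspace_coord[OF X i]] by simp
  then show ?thesis
    unfolding tspace_iff using tspace_fst[OF X] chart_D_in[OF M N f i _ tspace_coord[OF X i]] by (simp add: tmap_chart_D)
qed

section \<open>The tangent bundle\<close>

lemma TM_sel [simp]: "pts (TM M) = (\<Union>x\<in>pts M. tspace M x)" "model (TM M) = prod_ns (model M) (model M)" "idx (TM M) = idx M"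
  "cdom (TM M) i = (\<Union>x\<in>cdom M i. tspace M x)" "cmap (TM M) i X = (cmap M i (fst X), snd X i)"
  by (simp_all add: TM_def case_prod_beta)

lemma TM_cdom_iff: "X \<in> cdom (TM M) i \<longleftrightarrow> fst X \<in> cdom M i \<and> X \<in> tspace M (fst X)"
  by (auto simp: tspace_fst)

text \<open>\<open>tvec\<close> realizes every vector over every point of the overlap, so the image
  is a full cylinder.\<close>

lemma TM_image: assumes M: "premfd M" and ij: "i \<in> idx M" "j \<in> idx M"
  shows "cmap (TM M) i ` (cdom (TM M) i \<inter> cdom (TM M) j) = cmap M i ` (cdom M i \<inter> cdom M j) \<times> nscar (model M)"
proof (intro subset_antisym subsetI)
  fix p assume "p \<in> cmap (TM M) i ` (cdom (TM M) i \<inter> cdom (TM M) j)"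
  then obtain X where X0: "X \<in> cdom (TM M) i" "X \<in> cdom (TM M) j" "p = cmap (TM M) i X" by blast
  then have X: "X \<in> tspace M (fst X)" "fst X \<in> cdom M i" "fst X \<in> cdom M j" "p = cmap (TM M) i X"
    unfolding TM_cdom_iff by simp_all
  then show "p \<in> cmap M i ` (cdom M i \<inter> cdom M j) \<times> nscar (model M)"
    using tspace_coord[OF X(1), of i] ij by (auto simp: idx_at_iff)
next
  fix p assume "p \<in> cmap M i ` (cdom M i \<inter> cdom M j) \<times> nscar (model M)"
  then obtain x w where p: "p = (cmap M i x, w)" "x \<in> cdom M i" "x \<in> cdom M j" "w \<in> nscar (model M)" by auto
  then have i: "i \<in> idx_at M x" using ij by (simp add: idx_at_iff)
  have "tvec M i x w \<in> tspace M x" "fst (tvec M i x w) = x" using tvec_in[OF M i p(4)] tspace_fst[OF tvec_in[OF M i p(4)]] by auto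
  then have "tvec M i x w \<in> cdom (TM M) i \<inter> cdom (TM M) j" "p = cmap (TM M) i (tvec M i x w)"
    using p tvec_coord[OF M i p(4)] by auto
  then show "p \<in> cmap (TM M) i ` (cdom (TM M) i \<inter> cdom (TM M) j)" by blast
qed

lemma TM_inj: assumes M: "premfd M" and i: "i \<in> idx M" shows "inj_on (cmap (TM M) i) (cdom (TM M) i)"
proof (rule inj_onI)
  fix X Y assume X: "X \<in> cdom (TM M) i" and Y: "Y \<in> cdom (TM M) i" and eq: "cmap (TM M) i X = cmap (TM M) i Y"
  have XY: "X \<in> tspace M (fst X)" "Y \<in> tspace M (fst Y)" "fst X \<in> cdom M i" "fst Y \<in> cdom M i" using X Y unfolding TM_cdom_iff by auto
  have "fst X = fst Y" using inj_onD[OF premfd.inj[OF M i]] eq XY by auto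
  then show "X = Y" using tspace_eqI[of X M "fst X" Y i] XY i eq by (simp add: idx_at_iff)
qed

lemma TM_cinv: assumes M: "premfd M" and i: "i \<in> idx M" and x: "x \<in> cdom M i" and w: "w \<in> nscar (model M)"
  shows "cinv (TM M) i (cmap M i x, w) = tvec M i x w"
proof -
  have i': "i \<in> idx_at M x" using i x by (simp add: idx_at_iff)
  have t: "tvec M i x w \<in> tspace M x" "fst (tvec M i x w) = x" "snd (tvec M i x w) i = w"
    using tvec_in[OF M i' w] tvec_coord[OF M i' w] tspace_fst[OF tvec_in[OF M i' w]] by auto
  have "cinv (TM M) i (cmap (TM M) i (tvec M i x w)) = tvec M i x w"
    unfolding cinv_def by (rule inv_into_f_f[OF TM_inj[OF M i]]) (use t x in auto)
  then show ?thesis using t by simp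
qed

text \<open>A chart change of the tangent bundle is a chart change of M together with its
  derivative. The latter is of class C^l by \<open>Ck_on_nderiv\<close>, since chart changes are
  smooth and can give up one order.\<close>

lemma TM_premfd: assumes M: "premfd M" shows "premfd (TM M)"
proof -
  interpret M: premfd M by fact
  show ?thesis
  proof (rule premfd.intro, goal_cases)
    case 1
    show ?case by (simp add: prod_normed M.mod)
  next
    case 2
    show ?case by (auto simp: M.cov)
  next
    case (3 i)
    then show ?case using TM_inj[OF M] by simp
  next
    case (4 i j)
    then have ij: "i \<in> idx M" "j \<in> idx M" by auto
    show ?case unfolding TM_image[OF M ij] TM_sel(2) by (rule nopen_Times[OF M.ovl[OF ij] nopen_car])
  next
    case (5 i j l)
    then have ij: "i \<in> idx M" "j \<in> idx M" by auto
    let ?E = "model M" and ?A = "cmap M i ` (cdom M i \<inter> cdom M j)"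
    let ?W = "?A \<times> nscar ?E" and ?P = "prod_ns ?E ?E"
    have A: "nopen ?E ?A" by (rule M.ovl[OF ij])
    have W: "?W \<subseteq> nscar ?P" using nopen_sub[OF A] by auto
    have P: "normed ?P" by (rule prod_normed[OF M.mod M.mod])
    have "Ck_on ?P ?P l ?W (\<lambda>p. ((cmap M j \<circ> cinv M i) (fst p), (\<lambda>(x, v). nderiv ?E ?E ?A (cmap M j \<circ> cinv M i) x v) p))"
      by (intro Ck_on_pair[OF P M.mod M.mod W] Ck_on_nderiv[OF M.mod M.mod A M.trans[OF ij]]
        Ck_on_compose[OF P M.mod M.mod W nopen_sub[OF A] _ Ck_on_fst[OF M.mod M.mod W] M.trans[OF ij]]) auto
    then show ?case unfolding TM_image[OF M ij] TM_sel(2)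
    proof (rule Ck_on_cong)
      fix p assume "p \<in> ?W"
      then obtain x w where p: "p = (cmap M i x, w)" "x \<in> cdom M i" "x \<in> cdom M j" "w \<in> nscar (model M)" by auto
      then have i: "i \<in> idx_at M x" and j: "j \<in> idx_at M x" using ij by (simp_all add: idx_at_iff)
      have t: "snd (tvec M i x w) j = trans_D M i j x w" "fst (tvec M i x w) = x" using j by (simp_all add: tvec_def)
      have "rep_dom M M (\<lambda>x. x) i j = ?A" "rep_map M M (\<lambda>x. x) i j = cmap M j \<circ> cinv M i"
        by (auto simp: rep_dom_def rep_map_def)
      then show "((cmap M j \<circ> cinv M i) (fst p), (\<lambda>(x, v). nderiv ?E ?E ?A (cmap M j \<circ> cinv M i) x v) p) = (cmap (TM M) j \<circ> cinv (TM M) i) p"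
        using p ij t by (simp add: TM_cinv[OF M] chart_D_def)
    qed
  qed
qed

section \<open>Single tangent spaces\<close>

lemma tspaceM_sel [simp]: "pts (tspaceM M x) = tspace M x" "model (tspaceM M x) = model M" "idx (tspaceM M x) = idx_at M x"
  "cdom (tspaceM M x) i = tspace M x" "cmap (tspaceM M x) i X = snd X i"
  by (simp_all add: tspaceM_def case_prod_beta)

lemma tspaceM_image: assumes M: "premfd M" and i: "i \<in> idx_at M x" shows "cmap (tspaceM M x) i ` tspace M x = nscar (model M)"
proof (intro subset_antisym subsetI)
  fix w assume w: "w \<in> nscar (model M)"
  show "w \<in> cmap (tspaceM M x) i ` tspace M x"
    by (rule image_eqI[of _ _ "tvec M i x w"]) (simp_all add: tvec_in[OF M i w] tvec_coord[OF M i w])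
qed (use tspace_coord[OF _ i] in auto)

lemma tspaceM_inj: assumes M: "premfd M" and i: "i \<in> idx_at M x" shows "inj_on (cmap (tspaceM M x) i) (tspace M x)"
  by (rule inj_onI) (use tspace_eqI[OF _ _ i] in auto)

lemma tspaceM_cinv: assumes M: "premfd M" and i: "i \<in> idx_at M x" and w: "w \<in> nscar (model M)"
  shows "cinv (tspaceM M x) i w = tvec M i x w"
proof -
  have "cinv (tspaceM M x) i (cmap (tspaceM M x) i (tvec M i x w)) = tvec M i x w"
    unfolding cinv_def tspaceM_sel(4) by (rule inv_into_f_f[OF tspaceM_inj[OF M i] tvec_in[OF M i w]])
  then show ?thesis using tvec_coord[OF M i w] by simp
qed

text \<open>The chart changes are the bounded linear maps \<open>trans_D\<close>, hence
  smooth.\<close>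

lemma tspaceM_premfd: assumes M: "premfd M" and x: "x \<in> pts M" shows "premfd (tspaceM M x)"
proof -
  interpret M: premfd M by fact
  show ?thesis
  proof (rule premfd.intro, goal_cases)
    case 1
    show ?case by (simp add: M.mod)
  next
    case 2
    show ?case using M.some_idx[OF x] by auto
  next
    case (3 i)
    then show ?case using tspaceM_inj[OF M] by simp
  next
    case (4 i j)
    then show ?case using tspaceM_image[OF M] nopen_car by simp
  next
    case (5 i j l)
    then have i: "i \<in> idx_at M x" and j: "j \<in> idx_at M x" by auto
    have h: "has_nderiv (model M) (model M) (rep_dom M M (\<lambda>x. x) i j) (rep_map M M (\<lambda>x. x) i j) (cmap M i x) (trans_D M i j x)"
      by (rule chart_D_has[OF M M Ck_map_id[OF M] i j])
    then obtain c where c: "\<And>v. v \<in> nscar (model M) \<Longrightarrow> nsnorm (model M) (trans_D M i j x v) \<le> c * nsnorm (model M) v"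
      unfolding has_nderiv_def by blast
    have "Ck_on (model M) (model M) l (nscar (model M)) (trans_D M i j x)"
      by (rule Ck_on_linear[OF M.mod M.mod order_refl _ _ c]) (use h in \<open>auto simp: has_nderiv_def\<close>)
    then have "Ck_on (model M) (model M) l (nscar (model M)) (cmap (tspaceM M x) j \<circ> cinv (tspaceM M x) i)"
      by (rule Ck_on_cong) (use j in \<open>simp add: tspaceM_cinv[OF M i] tvec_def\<close>)
    then show ?case using tspaceM_image[OF M i] by simp
  qed
qed

text \<open>Let F represent a in charts and let x be the coordinate of e. The map becomes (v, w) |->
  (F(x, w), DF(x, w)(v, 0)), which is of class C^l because DF is so in point and direction
  jointly.\<close>

lemma Ck_map_partial_tangent:
  assumes M: "premfd M" and N: "premfd N" and P: "premfd P" and e: "e \<in> pts M" and a: "Ck_map (Suc l) (prodM M N) P (\<lambda>(g, y). a g y)"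
  shows "Ck_map l (prodM (tspaceM M e) N) (TM P) (\<lambda>(X, y). tmap M P (\<lambda>g. a g y) X)"
proof (rule Ck_map_localI[OF prodM_premfd[OF tspaceM_premfd[OF M e] N] TM_premfd[OF P]])
  interpret M: premfd M by fact
  interpret N: premfd N by fact
  interpret P: premfd P by fact
  have MN: "premfd (prodM M N)" by (rule prodM_premfd[OF M N])
  have TN: "premfd (prodM (tspaceM M e) N)" by (rule prodM_premfd[OF tspaceM_premfd[OF M e] N])
  have a1: "Ck_map (Suc 0) (prodM M N) P (\<lambda>(g, y). a g y)" by (rule Ck_map_le[OF MN P a]) simp
  have sl: "Ck_map l' M (prodM M N) (\<lambda>g. (g, y))" if "y \<in> pts N" for y l'
    by (rule Ck_map_pair[OF M M N Ck_map_id[OF M] Ck_map_const[OF M N that]])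
  have a_sl: "Ck_map (Suc 0) M P (\<lambda>g. a g y)" if "y \<in> pts N" for y
    using Ck_map_compose[OF M MN P sl[OF that] a1] by simp
  fix p assume "p \<in> pts (prodM (tspaceM M e) N)"
  then obtain X0 y0 where p: "p = (X0, y0)" "X0 \<in> tspace M e" "y0 \<in> pts N" by auto
  obtain i where i: "i \<in> idx_at M e" using M.some_idx[OF e] by blast
  then have i': "i \<in> idx M" "e \<in> cdom M i" by (auto simp: idx_at_iff)
  obtain j where j: "j \<in> idx N" "y0 \<in> cdom N j" using p(3) by (rule N.ptsE)
  have "a e y0 \<in> pts P" using Ck_map_in[OF MN P a, of "(e, y0)"] e p by simp
  then obtain k where k: "k \<in> idx P" "a e y0 \<in> cdom P k" by (rule P.ptsE)
  let ?F = "rep_map (prodM M N) P (\<lambda>(g, y). a g y) (i, j) k" and ?R = "rep_dom (prodM M N) P (\<lambda>(g, y). a g y) (i, j) k"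
  have ij: "(i, j) \<in> idx (prodM M N)" using i' j by simp
  let ?E = "model M" and ?H = "model N" and ?x = "cmap M i e"
  let ?EH = "prod_ns ?E ?H"
  have EH: "normed ?EH" by (rule prod_normed[OF M.mod N.mod])
  have R: "nopen ?EH ?R" using rep_dom_open[OF MN P Ck_map_cont[OF a] ij k(1)] by simp
  have F: "Ck_on ?EH (model P) (Suc l) ?R ?F" using Ck_map_rep[OF a ij k(1)] by simp
  have x: "?x \<in> nscar ?E" using i' by auto
  \<comment> \<open>The base point e is fixed, so only the slice of the domain of F over its
    coordinate matters; v ranges over the whole model space.\<close>
  define V where "V = {y \<in> nscar ?H. (?x, y) \<in> ?R}"
  have V: "nopen ?H V" unfolding V_def by (rule nopen_slice(2)[OF M.mod N.mod R x])
  let ?U = "nscar ?E \<times> V"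
  have U: "nopen ?EH ?U" by (rule nopen_Times[OF nopen_car V])
  have Vy: "\<exists>y. y \<in> cdom N j \<and> w = cmap N j y \<and> a e y \<in> cdom P k" if "w \<in> V" for w
  proof -
    have "(?x, w) \<in> ?R" using that by (simp add: V_def)
    then obtain z where z: "z \<in> cdom (prodM M N) (i, j)" "(\<lambda>(g, y). a g y) z \<in> cdom P k" "(?x, w) = cmap (prodM M N) (i, j) z"
      by (rule rep_domE[OF MN ij])
    obtain g y where gy: "z = (g, y)" by (cases z)
    have "g = e" using z inj_onD[OF M.inj[OF i'(1)], of g e] i' gy by simp
    then show ?thesis using z gy by auto
  qed
  have "Ck_on ?EH ?EH l ?U (\<lambda>p. (?x, snd p))" "Ck_on ?EH ?EH l ?U (\<lambda>p. (fst p, 0))"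
    by (intro Ck_on_pair[OF EH M.mod N.mod nopen_sub[OF U]] Ck_on_const[OF EH M.mod nopen_sub[OF U] x] Ck_on_const[OF EH N.mod nopen_sub[OF U] N.E.zero_in]
      Ck_on_fst[OF M.mod N.mod nopen_sub[OF U]] Ck_on_snd[OF M.mod N.mod nopen_sub[OF U]])+
  note in1 = this(1) and in2 = Ck_on_pair[OF EH EH EH nopen_sub[OF U] this]
  let ?D = "\<lambda>(x, v). nderiv ?EH (model P) ?R ?F x v"
  have D: "Ck_on (prod_ns ?EH ?EH) (model P) l (?R \<times> nscar ?EH) ?D"
    by (rule Ck_on_nderiv[OF EH P.mod R F])
  have c1: "Ck_on ?EH (model P) l ?U (\<lambda>p. ?F (?x, snd p))"
    by (rule Ck_on_compose[OF EH EH P.mod nopen_sub[OF U] nopen_sub[OF R] _ in1 Ck_on_le[OF EH P.mod nopen_sub[OF R] F]]) (auto simp: V_def)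
  have c2: "Ck_on ?EH (model P) l ?U (\<lambda>p. ?D ((?x, snd p), (fst p, 0)))"
    by (rule Ck_on_compose[OF EH prod_normed[OF EH EH] P.mod nopen_sub[OF U] _ _ in2 D]) (use nopen_sub[OF R] in \<open>auto simp: V_def\<close>)
  have c: "Ck_on (model (prodM (tspaceM M e) N)) (model (TM P)) l ?U (\<lambda>p. (?F (?x, snd p), ?D ((?x, snd p), (fst p, 0))))"
    using Ck_on_pair[OF EH P.mod P.mod nopen_sub[OF U] c1 c2] by simp
  have val: "(\<lambda>(X, y). tmap M P (\<lambda>g. a g y) X) (cinv (prodM (tspaceM M e) N) (i, j) u) \<in> cdom (TM P) k \<and>
     cmap (TM P) k ((\<lambda>(X, y). tmap M P (\<lambda>g. a g y) X) (cinv (prodM (tspaceM M e) N) (i, j) u)) = (?F (?x, snd u), ?D ((?x, snd u), (fst u, 0)))"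
    if u: "u \<in> ?U" for u
  proof -
    obtain v w where vw: "u = (v, w)" "v \<in> nscar ?E" "w \<in> V" using u by auto
    obtain y where y: "y \<in> cdom N j" "w = cmap N j y" "a e y \<in> cdom P k" using Vy[OF vw(3)] by blast
    have yp: "y \<in> pts N" by (rule N.cdom_pts[OF j(1) y(1)])
    have jy: "j \<in> idx_at N y" "k \<in> idx_at P (a e y)" using y j k by (auto simp: idx_at_iff)
    let ?X = "tvec M i e v"
    have X: "?X \<in> tspace M e" by (rule tvec_in[OF M i vw(2)])
    have ci: "cinv (prodM (tspaceM M e) N) (i, j) u = (?X, y)"
      using cinv_prodM[OF tspaceM_premfd[OF M e] N, of i j v w] i j y vw tspaceM_image[OF M i] by (simp add: tspaceM_cinv[OF M i])
    have t: "tmap M P (\<lambda>g. a g y) ?X \<in> tspace P (a e y)" by (rule tmap_in[OF M P a_sl[OF yp] e X])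
    have "snd (tmap M P (\<lambda>g. a g y) ?X) k = chart_D M P (\<lambda>g. a g y) i k e v"
      using tmap_coord[OF M P a_sl[OF yp] X i jy(2)] tvec_coord[OF M i vw(2)] by simp
    \<comment> \<open>The map g |-> a g y is a after g |-> (g, y), and the latter has the derivative
      v |-> (v, 0).\<close>
    also have "\<dots> = chart_D (prodM M N) P (\<lambda>(g, y). a g y) (i, j) k (e, y) (chart_D M (prodM M N) (\<lambda>g. (g, y)) i (i, j) e v)"
      using chart_D_chain[OF M MN P sl[OF yp] a1 i, of "(i, j)" k v] i jy vw(2) by (simp add: idx_at_iff)
    also have "chart_D M (prodM M N) (\<lambda>g. (g, y)) i (i, j) e v = (v, 0)"
      using chart_D_pair[OF M M N Ck_map_id[OF M] Ck_map_const[OF M N yp] i i jy(1) vw(2)] chart_D_id[OF M i vw(2)] chart_D_const[OF M N i jy(1) vw(2)] by simp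
    finally have 2: "snd (tmap M P (\<lambda>g. a g y) ?X) k = ?D ((?x, w), (v, 0))" using y(2) by (simp add: chart_D_def)
    have "?F (cmap (prodM M N) (i, j) (e, y)) = cmap P k (a e y)"
      by (subst rep_map_cmap[OF MN ij]) (use i' y in auto)
    then have 1: "?F (?x, w) = cmap P k (a e y)" using y by simp
    show ?thesis unfolding ci using t tspace_fst[OF t] 1 2 y vw by auto
  qed
  have ij': "(i, j) \<in> idx (prodM (tspaceM M e) N)" using i j by simp
  have kT: "k \<in> idx (TM P)" using k by simp
  show "local_Ck l (prodM (tspaceM M e) N) (TM P) (\<lambda>(X, y). tmap M P (\<lambda>g. a g y) X) p"
  proof (rule local_CkI[OF ij' kT _ _ _ _ _ c])
    show "nopen (model (prodM (tspaceM M e) N)) ?U" using U by simp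
    show "p \<in> cdom (prodM (tspaceM M e) N) (i, j)" using p j by simp
    have "cmap (prodM M N) (i, j) (e, y0) \<in> ?R" by (rule rep_domI) (use i' j k in auto)
    then show "cmap (prodM (tspaceM M e) N) (i, j) p \<in> ?U"
      using p j tspace_coord[OF p(2) i] by (auto simp: V_def)
    show "?U \<subseteq> cmap (prodM (tspaceM M e) N) (i, j) ` cdom (prodM (tspaceM M e) N) (i, j)"
    proof -
      have "cmap (prodM (tspaceM M e) N) (i, j) ` (tspace M e \<times> cdom N j) = nscar ?E \<times> cmap N j ` cdom N j"
        unfolding cmap_prodM_image tspaceM_image[OF M i] ..
      moreover have "V \<subseteq> cmap N j ` cdom N j" using Vy by blast
      ultimately show ?thesis by auto
    qed
  qed (use val in auto)
qed

section \<open>Pairs and sums of tangent vectors\<close>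

lemma idx_at_prodM [simp]: "idx_at (prodM M N) (x, y) = idx_at M x \<times> idx_at N y"
  by (auto simp: idx_at_iff)

text \<open>The identity of the product is the pair of the two projections, so pairing and chain
  rule compute its derivative.\<close>

lemma trans_D_prodM:
  assumes M: "premfd M" and N: "premfd N" and i: "i \<in> idx_at M x" "i' \<in> idx_at M x" and j: "j \<in> idx_at N y" "j' \<in> idx_at N y"
    and v: "v \<in> nscar (model M)" "w \<in> nscar (model N)"
  shows "trans_D (prodM M N) (i, j) (i', j') (x, y) (v, w) = (trans_D M i i' x v, trans_D N j j' y w)"
proof -
  have P: "premfd (prodM M N)" by (rule prodM_premfd[OF M N])
  have ij: "(i, j) \<in> idx_at (prodM M N) (x, y)" using i j by simp
  have vw: "(v, w) \<in> nscar (model (prodM M N))" using v by simp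
  have "chart_D (prodM M N) (prodM M N) (\<lambda>p. (fst p, snd p)) (i, j) (i', j') (x, y) (v, w) =
     (chart_D (prodM M N) M fst (i, j) i' (x, y) (v, w), chart_D (prodM M N) N snd (i, j) j' (x, y) (v, w))"
    using chart_D_pair[OF P M N Ck_map_fst[OF M N] Ck_map_snd[OF M N] ij _ _ vw, of i' j'] i j by simp
  moreover have "chart_D (prodM M N) M fst (i, j) i' (x, y) (v, w) = trans_D M i i' x v"
    using chart_D_chain[OF P M M Ck_map_fst[OF M N] Ck_map_id[OF M] ij, of i i' "(v, w)"] i v chart_D_fst[OF M N i(1) j(1) v] by simp
  moreover have "chart_D (prodM M N) N snd (i, j) j' (x, y) (v, w) = trans_D N j j' y w"
    using chart_D_chain[OF P N N Ck_map_snd[OF M N] Ck_map_id[OF N] ij, of j j' "(v, w)"] j v chart_D_snd[OF M N i(1) j(1) v] by simp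
  ultimately show ?thesis by simp
qed

lemma tpair_in:
  assumes M: "premfd M" and N: "premfd N" and X: "X \<in> tspace M x" and Y: "Y \<in> tspace N y"
  shows "tpair M N X Y \<in> tspace (prodM M N) (x, y)"
proof -
  have [simp]: "fst X = x" "fst Y = y" using tspace_fst[OF X] tspace_fst[OF Y] by auto
  show ?thesis unfolding tspace_iff tpair_def
    using trans_D_prodM[OF M N _ _ _ _ tspace_coord[OF X] tspace_coord[OF Y]] tspace_trans_D[OF X] tspace_trans_D[OF Y] tspace_coord[OF X] tspace_coord[OF Y]
    by auto
qed

lemma tpair_coord: "X \<in> tspace M x \<Longrightarrow> Y \<in> tspace N y \<Longrightarrow> i \<in> idx_at M x \<Longrightarrow> j \<in> idx_at N y \<Longrightarrow>
   snd (tpair M N X Y) (i, j) = (snd X i, snd Y j)"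
  by (simp add: tpair_def tspace_fst)

lemma tadd_in:
  assumes M: "premfd M" and X: "X \<in> tspace M x" and Y: "Y \<in> tspace M x"
  shows "tadd M X Y \<in> tspace M x"
proof -
  have [simp]: "fst X = x" by (rule tspace_fst[OF X])
  show ?thesis unfolding tspace_iff tadd_def
    using chart_D_add[OF M M Ck_map_id[OF M] _ _ tspace_coord[OF X] tspace_coord[OF Y]] tspace_trans_D[OF X] tspace_trans_D[OF Y]
      tspace_coord[OF X] tspace_coord[OF Y] normed.add_in[OF premfd.mod[OF M]]
    by auto
qed

lemma tadd_coord: "X \<in> tspace M x \<Longrightarrow> i \<in> idx_at M x \<Longrightarrow> snd (tadd M X Y) i = snd X i + snd Y i"
  by (simp add: tadd_def tspace_fst)

text \<open>Over a common base point the sum of tangent vectors is in a chart the sum of coordinate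
  vectors, so the map rearranges the components of the representations of S, T and T' and applies
  one bounded linear addition.\<close>

lemma Ck_map_tpair_tadd:
  assumes P: "premfd P" and M: "premfd M" and N: "premfd N" and S: "Ck_map l P (TM M) S" and T: "Ck_map l P (TM N) T" and T': "Ck_map l P (TM N) T'"
    and eq: "\<And>p. p \<in> pts P \<Longrightarrow> fst (T p) = fst (T' p)"
  shows "Ck_map l P (TM (prodM M N)) (\<lambda>p. tpair M N (S p) (tadd N (T p) (T' p)))"
proof (rule Ck_map_localI[OF P TM_premfd[OF prodM_premfd[OF M N]]])
  interpret P: premfd P by fact
  interpret M: premfd M by fact
  interpret N: premfd N by fact
  note TMM = TM_premfd[OF M] and TMN = TM_premfd[OF N]
  let ?S = "S" and ?E = "model P" and ?F = "model M" and ?H = "model N"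
  have tS: "S p \<in> tspace M (fst (S p))" "fst (S p) \<in> pts M" if "p \<in> pts P" for p
    using Ck_map_in[OF P TMM S that] by (auto simp: tspace_fst)
  have tT: "T p \<in> tspace N (fst (T p))" "fst (T p) \<in> pts N" if "p \<in> pts P" for p
    using Ck_map_in[OF P TMN T that] by (auto simp: tspace_fst)
  have tT': "T' p \<in> tspace N (fst (T p))" if p: "p \<in> pts P" for p
    using Ck_map_in[OF P TMN T' p] eq[OF p] by (auto simp: tspace_fst)
  fix p assume p: "p \<in> pts P"
  obtain i where i: "i \<in> idx P" "p \<in> cdom P i" using p by (rule P.ptsE)
  obtain j where j: "j \<in> idx M" "fst (S p) \<in> cdom M j" using tS(2)[OF p] by (rule M.ptsE)
  obtain k where k: "k \<in> idx N" "fst (T p) \<in> cdom N k" using tT(2)[OF p] by (rule N.ptsE)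
  have jT: "j \<in> idx (TM M)" "k \<in> idx (TM N)" using j k by auto
  let ?A = "rep_dom P (TM M) S i j" and ?B = "rep_dom P (TM N) T i k" and ?C = "rep_dom P (TM N) T' i k"
  let ?a = "rep_map P (TM M) S i j" and ?b = "rep_map P (TM N) T i k" and ?c = "rep_map P (TM N) T' i k"
  have A: "nopen ?E ?A" by (rule rep_dom_open[OF P TMM Ck_map_cont[OF S] i(1) jT(1)])
  have B: "nopen ?E ?B" by (rule rep_dom_open[OF P TMN Ck_map_cont[OF T] i(1) jT(2)])
  have C: "nopen ?E ?C" by (rule rep_dom_open[OF P TMN Ck_map_cont[OF T'] i(1) jT(2)])
  let ?U = "?A \<inter> (?B \<inter> ?C)"
  have U: "nopen ?E ?U" by (intro nopen_Int A B C)
  note Us = nopen_sub[OF U]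
  have FF: "normed (prod_ns ?F ?F)" and HH: "normed (prod_ns ?H ?H)" by (intro prod_normed M.mod N.mod)+
  have ca: "Ck_on ?E (prod_ns ?F ?F) l ?U ?a"
    by (rule Ck_on_subset[OF P.mod FF nopen_sub[OF A] Ck_map_rep[OF S i(1) jT(1), unfolded TM_sel(2)]]) auto
  have cb: "Ck_on ?E (prod_ns ?H ?H) l ?U ?b"
    by (rule Ck_on_subset[OF P.mod HH nopen_sub[OF B] Ck_map_rep[OF T i(1) jT(2), unfolded TM_sel(2)]]) auto
  have cc: "Ck_on ?E (prod_ns ?H ?H) l ?U ?c"
    by (rule Ck_on_subset[OF P.mod HH nopen_sub[OF C] Ck_map_rep[OF T' i(1) jT(2), unfolded TM_sel(2)]]) auto
  have fs: "Ck_on ?E F l ?U (\<lambda>u. fst (r u))" "Ck_on ?E F l ?U (\<lambda>u. snd (r u))" if "normed F" "Ck_on ?E (prod_ns F F) l ?U r" for F r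
    by (rule Ck_on_compose[OF P.mod prod_normed[OF that(1,1)] that(1) Us order_refl _ that(2) Ck_on_fst[OF that(1,1) order_refl]];
        use Ck_on_in[OF that(2)] in blast)
      (rule Ck_on_compose[OF P.mod prod_normed[OF that(1,1)] that(1) Us order_refl _ that(2) Ck_on_snd[OF that(1,1) order_refl]];
        use Ck_on_in[OF that(2)] in blast)
  have add: "Ck_on ?E ?H l ?U (\<lambda>u. snd (?b u) + snd (?c u))"
  proof -
    have "Ck_on (prod_ns ?H ?H) ?H l (nscar (prod_ns ?H ?H)) (\<lambda>p. fst p + snd p)"
    \<comment> \<open>The product carries the maximum norm, so addition has norm at most 2.\<close>
    proof (rule Ck_on_linear[OF HH N.mod order_refl, where c = 2])
      fix v assume "v \<in> nscar (prod_ns ?H ?H)"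
      then show "nsnorm ?H (fst v + snd v) \<le> 2 * nsnorm (prod_ns ?H ?H) v"
        using N.E.tri[of "fst v" "snd v"] by (cases v) auto
    qed (auto simp: algebra_simps)
    note this' = this
    have pr: "Ck_on ?E (prod_ns ?H ?H) l ?U (\<lambda>u. (snd (?b u), snd (?c u)))"
      by (intro Ck_on_pair[OF P.mod N.mod N.mod Us] fs(2)[OF N.mod cb] fs(2)[OF N.mod cc])
    show ?thesis using Ck_on_compose[OF P.mod HH N.mod Us order_refl _ pr this'] Ck_on_in[OF pr] by auto
  qed
  have FH: "normed (prod_ns ?F ?H)" by (intro prod_normed M.mod N.mod)
  have c: "Ck_on ?E (model (TM (prodM M N))) l ?U (\<lambda>u. ((fst (?a u), fst (?b u)), (snd (?a u), snd (?b u) + snd (?c u))))"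
    unfolding TM_sel prodM_sel
    by (intro Ck_on_pair[OF P.mod FH FH Us] Ck_on_pair[OF P.mod M.mod N.mod Us] fs(1)[OF M.mod ca] fs(2)[OF M.mod ca] fs(1)[OF N.mod cb] add)
  have val: "tpair M N (S x) (tadd N (T x) (T' x)) \<in> cdom (TM (prodM M N)) (j, k) \<and>
      cmap (TM (prodM M N)) (j, k) (tpair M N (S x) (tadd N (T x) (T' x))) =
       ((fst (?a u), fst (?b u)), (snd (?a u), snd (?b u) + snd (?c u)))"
    if u: "u \<in> ?U" and xu: "x = cinv P i u" for u x
  proof -
    have uABC: "u \<in> ?A" "u \<in> ?B" using u by auto
    obtain x1 where x1: "x1 \<in> cdom P i" "S x1 \<in> cdom (TM M) j" "u = cmap P i x1" "cinv P i u = x1" using rep_domE[OF P i(1) uABC(1)] .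
    obtain x2 where x2: "T x2 \<in> cdom (TM N) k" "cinv P i u = x2" using rep_domE[OF P i(1) uABC(2)] by blast
    have x: "x \<in> cdom P i" "S x \<in> cdom (TM M) j" "T x \<in> cdom (TM N) k" "u = cmap P i x" using x1 x2 xu by auto
    have xp: "x \<in> pts P" by (rule P.cdom_pts[OF i(1) x(1)])
    have f: "fst (S x) \<in> cdom M j" "fst (T x) \<in> cdom N k" using x unfolding TM_cdom_iff by auto
    then have jk: "j \<in> idx_at M (fst (S x))" "k \<in> idx_at N (fst (T x))" using j k by (auto simp: idx_at_iff)
    have ad: "tadd N (T x) (T' x) \<in> tspace N (fst (T x))" by (rule tadd_in[OF N tT(1)[OF xp] tT'[OF xp]])
    have tp: "tpair M N (S x) (tadd N (T x) (T' x)) \<in> tspace (prodM M N) (fst (S x), fst (T x))"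
      by (rule tpair_in[OF M N tS(1)[OF xp] ad])
    have "snd (tpair M N (S x) (tadd N (T x) (T' x))) (j, k) = (snd (S x) j, snd (T x) k + snd (T' x) k)"
      using tpair_coord[OF tS(1)[OF xp] ad jk] tadd_coord[OF tT(1)[OF xp] jk(2)] by simp
    moreover have "?a u = cmap (TM M) j (S x)" "?b u = cmap (TM N) k (T x)" "?c u = cmap (TM N) k (T' x)"
      using x(1,4) by (simp_all only: rep_map_cmap[OF P i(1)])
    ultimately show ?thesis using tp tspace_fst[OF tp] f eq[OF xp] by auto
  qed
  have jkT: "(j, k) \<in> idx (TM (prodM M N))" using j k by simp
  show "local_Ck l P (TM (prodM M N)) (\<lambda>p. tpair M N (S p) (tadd N (T p) (T' p))) p"
  proof (rule local_CkI[OF i(1) jkT U i(2) _ _ _ c])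
    have "S p \<in> cdom (TM M) j" "T p \<in> cdom (TM N) k" "T' p \<in> cdom (TM N) k"
      using tS[OF p] tT[OF p] tT'[OF p] j k eq[OF p] unfolding TM_cdom_iff by auto
    then show "cmap P i p \<in> ?U" using i(2) by (auto intro!: rep_domI simp del: TM_sel)
    show "?U \<subseteq> cmap P i ` cdom P i" by (auto simp: rep_dom_def simp del: TM_sel)
  qed (use val in blast)+
qed

section \<open>Directional derivatives and \<open>C_0^k\<close>\<close>

lemma std_sel [simp]: "nscar std_ns = UNIV" "nsnorm std_ns = norm" by (simp_all add: std_ns_def)

lemma has_derivative_stdI:
  fixes f :: "'v::real_normed_vector \<Rightarrow> 'w::real_normed_vector"
  assumes L: "bounded_linear L" and e: "\<And>e. e > 0 \<Longrightarrow> \<exists>d>0. \<forall>y. norm (y - x) < d \<longrightarrow> norm (f y - f x - L (y - x)) \<le> e * norm (y - x)"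
  shows "(f has_derivative L) (at x)"
  unfolding has_derivative_at_alt using assms by blast

text \<open>For a fixed list of directions, the value of the j-th derivative on that list has the
  (j+1)-st derivative as its Frechet derivative. Uniqueness then identifies the derivatives of
  \<open>Ck_on\<close> with the iterated directional ones, by induction on the list.\<close>

lemma Ck_std_pderivs:
  fixes f :: "'v::real_normed_vector \<Rightarrow> 'w::real_normed_vector"
  assumes "Ck_on std_ns std_ns k UNIV f"
  shows "\<And>vs x. length vs < k \<Longrightarrow> (pderivs f vs has_derivative (\<lambda>v. pderivs f (v # vs) x)) (at x)"
    "\<And>vs x. length vs \<le> k \<Longrightarrow> isCont (pderivs f vs) x"
proof -
  obtain D where D0: "\<forall>x\<in>UNIV. D 0 x [] = f x" "\<forall>j\<le>k. \<forall>x\<in>UNIV. bounded_multilinear std_ns std_ns j (D j x)"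
      "\<forall>j<k. \<forall>x\<in>UNIV. \<forall>\<epsilon>>0. \<exists>\<delta>>0. \<forall>y\<in>UNIV. nsnorm std_ns (y - x) < \<delta> \<longrightarrow>
           opnorm_le std_ns std_ns j (\<lambda>vs. D j y vs - D j x vs - D (Suc j) x ((y - x) # vs)) (\<epsilon> * nsnorm std_ns (y - x))"
      "\<forall>x\<in>UNIV. \<forall>\<epsilon>>0. \<exists>\<delta>>0. \<forall>y\<in>UNIV. nsnorm std_ns (y - x) < \<delta> \<longrightarrow> opnorm_le std_ns std_ns k (\<lambda>vs. D k y vs - D k x vs) \<epsilon>"
    using assms unfolding Ck_on_def
    apply (elim exE conjE)
    subgoal for D by (rule that[of D])
    done
  have ar: "vs \<in> args std_ns j \<longleftrightarrow> length vs = j" for vs :: "'v list" and j by (simp add: args_def)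
  have pnorm: "0 \<le> prod_list (map norm vs)" for vs :: "'v list" by (induction vs) auto
  have hd: "((\<lambda>x. D (length vs) x vs) has_derivative (\<lambda>v. D (Suc (length vs)) x (v # vs))) (at x)" if l: "length vs < k" for vs x
  proof (rule has_derivative_stdI)
    have b: "bounded_multilinear std_ns std_ns (Suc (length vs)) (D (Suc (length vs)) x)" using D0(2) l by auto
    then obtain c where c: "opnorm_le std_ns std_ns (Suc (length vs)) (D (Suc (length vs)) x) c" unfolding bounded_multilinear_def by blast
    have lin: "D (Suc (length vs)) x ((a *\<^sub>R v + b *\<^sub>R w) # vs) = a *\<^sub>R D (Suc (length vs)) x (v # vs) + b *\<^sub>R D (Suc (length vs)) x (w # vs)" for a b v w
    proof -
      have "\<forall>us\<in>args std_ns (Suc (length vs)). \<forall>i<Suc (length vs). \<forall>v\<in>nscar std_ns. \<forall>w\<in>nscar std_ns. \<forall>a b.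
        D (Suc (length vs)) x (us[i := a *\<^sub>R v + b *\<^sub>R w]) = a *\<^sub>R D (Suc (length vs)) x (us[i := v]) + b *\<^sub>R D (Suc (length vs)) x (us[i := w])"
        using b unfolding bounded_multilinear_def by blast
      from this[rule_format, of "v # vs" 0 v w a b] show ?thesis by (simp add: ar)
    qed
    show "bounded_linear (\<lambda>v. D (Suc (length vs)) x (v # vs))"
    proof (rule bounded_linear_intro[where K = "c * prod_list (map norm vs)"])
      show "D (Suc (length vs)) x ((v + w) # vs) = D (Suc (length vs)) x (v # vs) + D (Suc (length vs)) x (w # vs)" for v w
        using lin[of 1 v 1 w] by simp
      show "D (Suc (length vs)) x ((a *\<^sub>R v) # vs) = a *\<^sub>R D (Suc (length vs)) x (v # vs)" for a v
        using lin[of a v 0 v] by simp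
      show "norm (D (Suc (length vs)) x (v # vs)) \<le> norm v * (c * prod_list (map norm vs))" for v
        using c[unfolded opnorm_le_def, rule_format, of "v # vs"] by (simp add: ar mult_ac)
    qed
    fix e :: real assume e: "e > 0"
    define e' where "e' = e / (prod_list (map norm vs) + 1)"
    have e': "e' > 0" using e pnorm[of vs] by (simp add: e'_def add_nonneg_pos)
    have le: "e' * prod_list (map norm vs) \<le> e"
    proof -
      have "e' * prod_list (map norm vs) \<le> e' * (prod_list (map norm vs) + 1)" using e' by simp
      also have "\<dots> = e" using pnorm[of vs] by (simp add: e'_def add_nonneg_eq_0_iff)
      finally show ?thesis .
    qed
    obtain d where d: "d > 0" "\<And>y. norm (y - x) < d \<Longrightarrow> opnorm_le std_ns std_ns (length vs) (\<lambda>us. D (length vs) y us - D (length vs) x us - D (Suc (length vs)) x ((y - x) # us)) (e' * norm (y - x))"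
      using D0(3)[rule_format, OF l, of x e'] e' by auto
    have "norm (D (length vs) y vs - D (length vs) x vs - D (Suc (length vs)) x ((y - x) # vs)) \<le> e * norm (y - x)" if "norm (y - x) < d" for y
    proof -
      have "norm (D (length vs) y vs - D (length vs) x vs - D (Suc (length vs)) x ((y - x) # vs)) \<le> e' * norm (y - x) * prod_list (map norm vs)"
        using d(2)[OF that] unfolding opnorm_le_def by (simp add: ar)
      also have "\<dots> = (e' * prod_list (map norm vs)) * norm (y - x)" by simp
      also have "\<dots> \<le> e * norm (y - x)" by (intro mult_right_mono le) simp
      finally show ?thesis .
    qed
    then show "\<exists>d>0. \<forall>y. norm (y - x) < d \<longrightarrow> norm (D (length vs) y vs - D (length vs) x vs - D (Suc (length vs)) x ((y - x) # vs)) \<le> e * norm (y - x)"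
      using d(1) by blast
  qed
  have eq: "length vs \<le> k \<Longrightarrow> D (length vs) x vs = pderivs f vs x" for vs x
  proof (induction vs arbitrary: x)
    case Nil
    then show ?case using D0(1) by simp
  next
    case (Cons v vs)
    then have IH: "pderivs f vs = (\<lambda>x. D (length vs) x vs)" and l: "length vs < k" by auto
    show ?case using frechet_derivative_at[OF hd[OF l, of x]] by (simp add: IH fun_eq_iff)
  qed
  show *: "(pderivs f vs has_derivative (\<lambda>v. pderivs f (v # vs) x)) (at x)" if "length vs < k" for vs x
  proof -
    have "pderivs f vs = (\<lambda>x. D (length vs) x vs)" "(\<lambda>v. pderivs f (v # vs) x) = (\<lambda>v. D (Suc (length vs)) x (v # vs))"
      using eq[of vs] eq[of "_ # vs" x] that by (auto simp del: pderivs.simps)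
    then show ?thesis using hd[OF that] by simp
  qed
  show "isCont (pderivs f vs) x" if l: "length vs \<le> k" for vs x
  proof (cases "length vs = k")
    case False
    then show ?thesis using *[of vs x] l has_derivative_continuous by fastforce
  next
    case True
    \<comment> \<open>At the top order there is no further derivative to infer continuity from; it
      is the last clause of \<open>Ck_on\<close>.\<close>
    have "\<exists>d>0. \<forall>y. dist y x < d \<longrightarrow> dist (pderivs f vs y) (pderivs f vs x) < e" if e: "e > 0" for e
    proof -
      define e' where "e' = e / (prod_list (map norm vs) + 1)"
      have e': "e' > 0" using e pnorm[of vs] by (simp add: e'_def add_nonneg_pos)
      have le: "e' * prod_list (map norm vs) < e"
      proof -
        have "e' * prod_list (map norm vs) < e' * (prod_list (map norm vs) + 1)" using e' by simp
        also have "\<dots> = e" using pnorm[of vs] by (simp add: e'_def add_nonneg_eq_0_iff)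
        finally show ?thesis .
      qed
      obtain d where d: "d > 0" "\<And>y. norm (y - x) < d \<Longrightarrow> opnorm_le std_ns std_ns k (\<lambda>vs. D k y vs - D k x vs) e'"
        using D0(4)[rule_format, of x e'] e' by auto
      have "dist (pderivs f vs y) (pderivs f vs x) < e" if "dist y x < d" for y
      proof -
        have "norm (D k y vs - D k x vs) \<le> e' * prod_list (map norm vs)"
          using d(2)[of y] that True unfolding opnorm_le_def by (simp add: ar dist_norm)
        then show ?thesis using le eq[of vs y] eq[of vs x] True by (simp add: dist_norm)
      qed
      then show ?thesis using d(1) by blast
    qed
    then show ?thesis unfolding continuous_at_eps_delta by blast
  qed
qed

lemma pderivs_lin:
  fixes f g :: "'v::real_normed_vector \<Rightarrow> 'w::real_normed_vector"
  assumes f: "Ck_on std_ns std_ns k UNIV f" and g: "Ck_on std_ns std_ns k UNIV g"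
  shows "length vs \<le> k \<Longrightarrow> pderivs (\<lambda>x. a *\<^sub>R f x + b *\<^sub>R g x) vs = (\<lambda>x. a *\<^sub>R pderivs f vs x + b *\<^sub>R pderivs g vs x)"
proof (induction vs)
  case (Cons v vs)
  then have l: "length vs < k" and IH: "pderivs (\<lambda>x. a *\<^sub>R f x + b *\<^sub>R g x) vs = (\<lambda>x. a *\<^sub>R pderivs f vs x + b *\<^sub>R pderivs g vs x)" by simp_all
  have "((\<lambda>x. a *\<^sub>R pderivs f vs x + b *\<^sub>R pderivs g vs x) has_derivative (\<lambda>v. a *\<^sub>R pderivs f (v # vs) x + b *\<^sub>R pderivs g (v # vs) x)) (at x)" for x
    by (intro has_derivative_add has_derivative_scaleR_right Ck_std_pderivs(1)[OF f l] Ck_std_pderivs(1)[OF g l])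
  from fun_cong[OF frechet_derivative_at[OF this], of v] show ?case by (intro ext) (simp add: IH)
qed simp

text \<open>The pair of f and g followed by a bounded linear map.\<close>

lemma Ck_std_lin:
  fixes f g :: "'v::real_normed_vector \<Rightarrow> 'w::real_normed_vector"
  assumes f: "Ck_on std_ns std_ns k UNIV f" and g: "Ck_on std_ns std_ns k UNIV g"
  shows "Ck_on std_ns std_ns k UNIV (\<lambda>x. a *\<^sub>R f x + b *\<^sub>R g x)"
proof -
  have P: "normed (prod_ns std_ns std_ns :: ('w \<times> 'w) nspace)" by (intro prod_normed std_normed)
  have "Ck_on std_ns (prod_ns std_ns std_ns) k UNIV (\<lambda>x. (f x, g x))"
    by (rule Ck_on_pair[OF std_normed std_normed std_normed _ f g]) simp
  moreover have "Ck_on (prod_ns std_ns std_ns) std_ns k UNIV (\<lambda>p. a *\<^sub>R fst p + b *\<^sub>R snd p :: 'w)"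
  proof (rule Ck_on_linear[OF P std_normed, where c = "\<bar>a\<bar> + \<bar>b\<bar>"])
    fix v :: "'w \<times> 'w"
    have "norm (a *\<^sub>R fst v + b *\<^sub>R snd v) \<le> \<bar>a\<bar> * norm (fst v) + \<bar>b\<bar> * norm (snd v)"
      by (metis norm_scaleR norm_triangle_ineq)
    also have "\<dots> \<le> \<bar>a\<bar> * max (norm (fst v)) (norm (snd v)) + \<bar>b\<bar> * max (norm (fst v)) (norm (snd v))"
      by (intro add_mono mult_left_mono) auto
    finally show "nsnorm std_ns (a *\<^sub>R fst v + b *\<^sub>R snd v) \<le> (\<bar>a\<bar> + \<bar>b\<bar>) * nsnorm (prod_ns std_ns std_ns) v"
      by (cases v) (simp add: algebra_simps)
  qed (auto simp: algebra_simps)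
  ultimately show ?thesis
    using Ck_on_compose[OF std_normed P std_normed, of UNIV UNIV "\<lambda>x. (f x, g x)" k "\<lambda>p. a *\<^sub>R fst p + b *\<^sub>R snd p"] by simp
qed

text \<open>On a large ball by compactness, outside it by the limit.\<close>

lemma vanishing_bounded:
  fixes g :: "'v::euclidean_space \<Rightarrow> 'w::real_normed_vector"
  assumes "\<And>x. isCont g x" "(g \<longlongrightarrow> 0) at_infinity"
  shows "bounded (range g)"
proof -
  obtain R where R: "\<And>x. R \<le> norm x \<Longrightarrow> norm (g x) < 1"
    using tendstoD[OF assms(2), of 1] unfolding eventually_at_infinity by auto
  have "compact (g ` cball 0 R)"
    by (intro compact_continuous_image continuous_at_imp_continuous_on) (use assms in auto)
  then have "bounded (g ` cball 0 R)" by (rule compact_imp_bounded)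
  then obtain B where B: "\<And>x. x \<in> cball 0 R \<Longrightarrow> norm (g x) \<le> B"
    unfolding bounded_iff by (meson imageI)
  have "norm (g x) \<le> max B 1" for x using R[of x] B[of x] by (cases "R \<le> norm x") auto
  then show ?thesis unfolding bounded_iff by blast
qed

section \<open>The normed space C_0^k\<close>

lemma finite_multi_idx: "finite (multi_idx k :: (real^'n) list set)"
proof -
  have "multi_idx k = {vs :: (real^'n) list. set vs \<subseteq> Basis \<and> length vs \<le> k}" by (auto simp: multi_idx_def)
  then show ?thesis using finite_lists_length_le[OF finite_Basis, of k] by simp
qed

lemma C0_D:
  assumes "u \<in> nscar (C0 k)"
  shows "Ck_on std_ns std_ns k UNIV (apply_bcontfun u)" "\<And>vs. vs \<in> multi_idx k \<Longrightarrow> (pderivs (apply_bcontfun u) vs \<longlongrightarrow> 0) at_infinity"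
  using assms by (auto simp: C0_def)

text \<open>The supremum of reals that defines the norm is meaningful only for a bounded family.
  Each partial derivative is continuous and vanishes at infinity, and there are finitely many of
  them.\<close>

lemma C0_bdd:
  assumes u: "u \<in> nscar (C0 k)"
  shows "bdd_above ((\<lambda>(vs, x). norm (pderivs (apply_bcontfun u) vs x)) ` (multi_idx k \<times> UNIV))"
proof -
  have "\<exists>B. \<forall>x. norm (pderivs (apply_bcontfun u) vs x) \<le> B" if vs: "vs \<in> multi_idx k" for vs
  proof -
    have "length vs \<le> k" using vs by (simp add: multi_idx_def)
    then have "bounded (range (pderivs (apply_bcontfun u) vs))"
      by (intro vanishing_bounded C0_D(2)[OF u vs] Ck_std_pderivs(2)[OF C0_D(1)[OF u]])
    then show ?thesis unfolding bounded_iff by (meson rangeI)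
  qed
  then obtain B where B: "\<And>vs x. vs \<in> multi_idx k \<Longrightarrow> norm (pderivs (apply_bcontfun u) vs x) \<le> B vs" by metis
  have "norm (pderivs (apply_bcontfun u) vs x) \<le> Max (B ` multi_idx k)" if "vs \<in> multi_idx k" for vs x
    by (rule order_trans[OF B[OF that] Max_ge]) (use that finite_multi_idx in auto)
  then show ?thesis by (intro bdd_aboveI[of _ "Max (B ` multi_idx k)"]) auto
qed

lemma C0_norm_ge:
  assumes u: "u \<in> nscar (C0 k)" and "vs \<in> multi_idx k"
  shows "norm (pderivs (apply_bcontfun u) vs x) \<le> nsnorm (C0 k) u"
proof -
  have "(\<lambda>(vs, x). norm (pderivs (apply_bcontfun u) vs x)) (vs, x) \<le> nsnorm (C0 k) u"
    unfolding C0_def nspace.simps by (rule cSUP_upper[OF _ C0_bdd[OF u]]) (use assms in auto)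
  then show ?thesis by simp
qed

lemma C0_norm_le:
  assumes "\<And>vs x. vs \<in> multi_idx k \<Longrightarrow> norm (pderivs (apply_bcontfun u) vs x) \<le> c"
  shows "nsnorm (C0 k) u \<le> c"
proof -
  have "[] \<in> multi_idx k" by (simp add: multi_idx_def)
  then show ?thesis unfolding C0_def nspace.simps by (intro cSUP_least) (use assms in auto)
qed

lemma nil_multi_idx: "[] \<in> multi_idx k" by (simp add: multi_idx_def)

lemma apply_lin: "apply_bcontfun (a *\<^sub>R u + b *\<^sub>R v) = (\<lambda>x. a *\<^sub>R apply_bcontfun u x + b *\<^sub>R apply_bcontfun v x)"
  by (rule ext) (simp add: plus_bcontfun.rep_eq scaleR_bcontfun.rep_eq)

lemma C0_lin:
  assumes u: "u \<in> nscar (C0 k)" and v: "v \<in> nscar (C0 k)" shows "a *\<^sub>R u + b *\<^sub>R v \<in> nscar (C0 k)"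
proof -
  have "(pderivs (apply_bcontfun (a *\<^sub>R u + b *\<^sub>R v)) vs \<longlongrightarrow> 0) at_infinity" if vs: "vs \<in> multi_idx k" for vs
  proof -
    have "((\<lambda>x. a *\<^sub>R pderivs (apply_bcontfun u) vs x + b *\<^sub>R pderivs (apply_bcontfun v) vs x) \<longlongrightarrow> a *\<^sub>R 0 + b *\<^sub>R 0) at_infinity"
      by (intro tendsto_intros C0_D(2)[OF u vs] C0_D(2)[OF v vs])
    then show ?thesis unfolding apply_lin using pderivs_lin[OF C0_D(1)[OF u] C0_D(1)[OF v]] vs by (simp add: multi_idx_def)
  qed
  moreover have "Ck_on std_ns std_ns k UNIV (apply_bcontfun (a *\<^sub>R u + b *\<^sub>R v))"
    unfolding apply_lin by (rule Ck_std_lin[OF C0_D(1)[OF u] C0_D(1)[OF v]])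
  ultimately show ?thesis by (simp add: C0_def)
qed

lemma C0_pderivs_lin:
  assumes u: "u \<in> nscar (C0 k)" and v: "v \<in> nscar (C0 k)" and vs: "vs \<in> multi_idx k"
  shows "pderivs (apply_bcontfun (a *\<^sub>R u + b *\<^sub>R v)) vs x = a *\<^sub>R pderivs (apply_bcontfun u) vs x + b *\<^sub>R pderivs (apply_bcontfun v) vs x"
  unfolding apply_lin using pderivs_lin[OF C0_D(1)[OF u] C0_D(1)[OF v]] vs by (simp add: multi_idx_def)

lemma pderivs_zero: "pderivs (\<lambda>x. 0) vs = (\<lambda>x::'v::real_normed_vector. 0::'w::real_normed_vector)"
  by (induction vs) (simp_all add: frechet_derivative_const)

lemma C0_zero: "0 \<in> nscar (C0 k :: ((real^'n) \<Rightarrow>\<^sub>C (real^'n)) nspace)"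
proof -
  have z: "apply_bcontfun (0 :: (real^'n) \<Rightarrow>\<^sub>C (real^'n)) = (\<lambda>x. 0)" by (rule ext) (simp add: zero_bcontfun.rep_eq)
  have "Ck_on std_ns std_ns k UNIV (\<lambda>x::real^'n. 0::real^'n)" by (rule Ck_on_const[OF std_normed std_normed]) auto
  then show ?thesis by (simp add: C0_def z pderivs_zero)
qed

lemma C0_nonneg: "u \<in> nscar (C0 k) \<Longrightarrow> 0 \<le> nsnorm (C0 k) u"
  by (rule order_trans[OF norm_ge_zero C0_norm_ge[OF _ nil_multi_idx]])

lemma C0_scale: "u \<in> nscar (C0 k) \<Longrightarrow> c *\<^sub>R u \<in> nscar (C0 k)"
  using C0_lin[of u k u c 0] by simp

lemma C0_normed: "normed (C0 k :: ((real^'n) \<Rightarrow>\<^sub>C (real^'n)) nspace)"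
proof
  show "subspace (nscar (C0 k :: ((real^'n) \<Rightarrow>\<^sub>C (real^'n)) nspace))"
    unfolding subspace_def using C0_zero C0_lin[of _ k _ 1 1] C0_lin[of _ k _ _ 0] by (fastforce)
  fix u v :: "(real^'n) \<Rightarrow>\<^sub>C (real^'n)" and c :: real
  assume u: "u \<in> nscar (C0 k)"
  show n: "0 \<le> nsnorm (C0 k) u"
    by (rule C0_nonneg[OF u])
  show "nsnorm (C0 k) u = 0 \<longleftrightarrow> u = 0"
  proof
    assume "nsnorm (C0 k) u = 0"
    then have "apply_bcontfun u x = 0" for x using C0_norm_ge[OF u nil_multi_idx, of x] by simp
    then show "u = 0" by (simp add: bcontfun_eqI)
  next
    assume "u = 0"
    moreover have "apply_bcontfun (0 :: (real^'n) \<Rightarrow>\<^sub>C (real^'n)) = (\<lambda>x. 0)" by (rule ext) (simp add: zero_bcontfun.rep_eq)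
    ultimately have "nsnorm (C0 k) u \<le> 0" by (intro C0_norm_le) (simp add: pderivs_zero)
    then show "nsnorm (C0 k) u = 0" using n by simp
  qed
  have le: "nsnorm (C0 k) (c *\<^sub>R u) \<le> \<bar>c\<bar> * nsnorm (C0 k) u" if u: "u \<in> nscar (C0 k)" for c and u :: "(real^'n) \<Rightarrow>\<^sub>C (real^'n)"
  proof (rule C0_norm_le)
    fix vs :: "(real^'n) list" and x assume "vs \<in> multi_idx k"
    then show "norm (pderivs (apply_bcontfun (c *\<^sub>R u)) vs x) \<le> \<bar>c\<bar> * nsnorm (C0 k) u"
      using C0_pderivs_lin[OF u u, of vs c 0 x] C0_norm_ge[OF u, of vs x] by (simp add: mult_left_mono)
  qed
  show "nsnorm (C0 k) (c *\<^sub>R u) = \<bar>c\<bar> * nsnorm (C0 k) u"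
  proof (cases "c = 0")
    case True
    moreover have "0 \<le> nsnorm (C0 k) (c *\<^sub>R u)"
      by (rule C0_nonneg[OF C0_scale[OF u]])
    ultimately show ?thesis using le[OF u, of c] by simp
  next
    case False
    have cu: "c *\<^sub>R u \<in> nscar (C0 k)" by (rule C0_scale[OF u])
    \<comment> \<open>The reverse inequality is \<open>le\<close> for the scalar
      \<open>inverse c\<close> at the vector c u.\<close>
    have "\<bar>c\<bar> * nsnorm (C0 k) u = \<bar>c\<bar> * nsnorm (C0 k) (inverse c *\<^sub>R (c *\<^sub>R u))" using False by simp
    also have "\<dots> \<le> \<bar>c\<bar> * (\<bar>inverse c\<bar> * nsnorm (C0 k) (c *\<^sub>R u))" by (intro mult_left_mono le cu) auto
    also have "\<dots> = nsnorm (C0 k) (c *\<^sub>R u)" using False by (simp add: field_simps)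
    finally show ?thesis using le[OF u, of c] by simp
  qed
  assume v: "v \<in> nscar (C0 k)"
  show "nsnorm (C0 k) (u + v) \<le> nsnorm (C0 k) u + nsnorm (C0 k) v"
  proof (rule C0_norm_le)
    fix vs :: "(real^'n) list" and x assume vs: "vs \<in> multi_idx k"
    have "pderivs (apply_bcontfun (u + v)) vs x = pderivs (apply_bcontfun u) vs x + pderivs (apply_bcontfun v) vs x"
      using C0_pderivs_lin[OF u v vs, of 1 1 x] by simp
    then show "norm (pderivs (apply_bcontfun (u + v)) vs x) \<le> nsnorm (C0 k) u + nsnorm (C0 k) v"
      using C0_norm_ge[OF u vs, of x] C0_norm_ge[OF v vs, of x] norm_triangle_ineq by (smt (verit))
  qed
qed

section \<open>Openness of the diffeomorphisms\<close>

text \<open>Derivatives are unique only on open sets, hence charts can be changed only once the chart domain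
  of the diffeomorphism group is known to be open.\<close>

lemma C0_deriv:
  fixes u :: "(real^'n) \<Rightarrow>\<^sub>C (real^'n)"
  assumes u: "u \<in> nscar (C0 k)" and k: "k \<ge> 1"
  shows "(apply_bcontfun u has_derivative (\<lambda>v. pderivs (apply_bcontfun u) [v] x)) (at x)"
    "norm (pderivs (apply_bcontfun u) [v] x) \<le> (\<Sum>b\<in>Basis. norm (pderivs (apply_bcontfun u) [b] x)) * norm v"
proof -
  show d: "(apply_bcontfun u has_derivative (\<lambda>v. pderivs (apply_bcontfun u) [v] x)) (at x)"
    using Ck_std_pderivs(1)[OF C0_D(1)[OF u], of "[]" x] k by (simp del: pderivs.simps(2))
  let ?L = "\<lambda>v. pderivs (apply_bcontfun u) [v] x"
  interpret L: bounded_linear ?L using d by (rule has_derivative_bounded_linear)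
  \<comment> \<open>The norm of \<open>C0 k\<close> controls the partial derivatives only; expanding
    v in the basis bounds the full derivative by their sum.\<close>
  have "?L v = ?L (\<Sum>b\<in>Basis. (v \<bullet> b) *\<^sub>R b)" by (simp only: euclidean_representation)
  also have "\<dots> = (\<Sum>b\<in>Basis. (v \<bullet> b) *\<^sub>R ?L b)" by (simp only: L.sum L.scaleR)
  finally have "norm (?L v) \<le> (\<Sum>b\<in>Basis. \<bar>v \<bullet> b\<bar> * norm (?L b))" using norm_sum[of "\<lambda>b. (v \<bullet> b) *\<^sub>R ?L b" Basis] by simp
  also have "\<dots> \<le> (\<Sum>b\<in>Basis. norm v * norm (?L b))" by (intro sum_mono mult_right_mono Basis_le_norm) auto
  finally show "norm (?L v) \<le> (\<Sum>b\<in>Basis. norm (?L b)) * norm v" by (simp add: sum_distrib_left mult.commute)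
qed

text \<open>C^1 in terms of \<open>has_derivative\<close> and continuity of the derivative in the
  operator norm; together with the converse \<open>Ck1_std_D\<close> this connects
  \<open>Ck_on\<close> with the differentiation of inverse maps below.\<close>

lemma Ck1_std:
  fixes f :: "'v::real_normed_vector \<Rightarrow> 'w::real_normed_vector"
  assumes "\<And>x. (f has_derivative f' x) (at x)"
    and "\<And>x e. e > 0 \<Longrightarrow> \<exists>d>0. \<forall>y. norm (y - x) < d \<longrightarrow> (\<forall>v. norm (f' y v - f' x v) \<le> e * norm v)"
  shows "Ck_on std_ns std_ns 1 UNIV f"
proof -
  have bl: "bounded_linear (f' x)" for x using assms(1) by (rule has_derivative_bounded_linear)
  have ar: "vs \<in> args std_ns j \<longleftrightarrow> length vs = j" for vs :: "'v list" and j by (simp add: args_def)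
  show ?thesis unfolding Ck_on_def
  \<comment> \<open>Orders 0 and 1 are the only ones looked at, so every positive j may be answered
    with the first derivative.\<close>
  proof (rule exI[of _ "\<lambda>j x vs. if j = 0 then f x else f' x (hd vs)"], intro conjI ballI allI impI)
    fix j x assume "j \<le> (1::nat)"
    then consider "j = 0" | "j = 1" by linarith
    then show "bounded_multilinear std_ns std_ns j (\<lambda>vs. if j = 0 then f x else f' x (hd vs))"
    proof cases
      case 1
      then show ?thesis by (auto simp: bounded_multilinear_def opnorm_le_def)
    next
      case 2
      interpret bounded_linear "f' x" by (rule bl)
      obtain K where "\<And>v. norm (f' x v) \<le> norm v * K" using bounded by blast
      then show ?thesis using 2
        by (auto simp: bounded_multilinear_def opnorm_le_def ar length_Suc_conv add scaleR mult.commute intro!: exI[of _ K])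
    qed
  next
    fix j x e assume j: "j < (1::nat)" and e: "(e::real) > 0"
    obtain d where d: "d > 0" "\<And>y. norm (y - x) < d \<Longrightarrow> norm (f y - f x - f' x (y - x)) \<le> e * norm (y - x)"
      using assms(1)[of x] e unfolding has_derivative_at_alt by blast
    show "\<exists>\<delta>>0. \<forall>y\<in>UNIV. nsnorm std_ns (y - x) < \<delta> \<longrightarrow>
              opnorm_le std_ns std_ns j
               (\<lambda>vs. (if j = 0 then f y else f' y (hd vs)) - (if j = 0 then f x else f' x (hd vs)) - (if Suc j = 0 then f x else f' x (hd ((y - x) # vs))))
               (e * nsnorm std_ns (y - x))"
      by (rule exI[of _ d]) (use d j in \<open>auto simp: opnorm_le_def\<close>)
  next
    fix x e assume e: "(e::real) > 0"
    obtain d where d: "d > 0" "\<And>y v. norm (y - x) < d \<Longrightarrow> norm (f' y v - f' x v) \<le> e * norm v" using assms(2)[OF e, of x] by blast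
    show "\<exists>\<delta>>0. \<forall>y\<in>UNIV. nsnorm std_ns (y - x) < \<delta> \<longrightarrow>
              opnorm_le std_ns std_ns 1 (\<lambda>vs. (if 1 = (0::nat) then f y else f' y (hd vs)) - (if 1 = (0::nat) then f x else f' x (hd vs))) e"
      by (rule exI[of _ d]) (use d in \<open>auto simp: opnorm_le_def ar length_Suc_conv\<close>)
  qed auto
qed

lemma Ck1_std_D:
  fixes f :: "'v::real_normed_vector \<Rightarrow> 'w::real_normed_vector"
  assumes "Ck_on std_ns std_ns 1 UNIV f"
  obtains f' where "\<And>x. (f has_derivative f' x) (at x)"
    "\<And>x e. e > 0 \<Longrightarrow> \<exists>d>0. \<forall>y. norm (y - x) < d \<longrightarrow> (\<forall>v. norm (f' y v - f' x v) \<le> e * norm v)"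
proof -
  have N: "normed (std_ns :: 'v nspace)" "normed (std_ns :: 'w nspace)" by (rule std_normed)+
  have "Ck_on std_ns std_ns (Suc 0) UNIV f" using assms by simp
  then obtain f' where f': "mixed_Ck std_ns nul std_ns UNIV 0 0 1 f'" "\<And>x. x \<in> UNIV \<Longrightarrow> has_nderiv std_ns std_ns UNIV f x (\<lambda>v. f' x [] [v])"
    using Ck_on_deriv_mixed_Ck[OF N, of UNIV 0 f] by auto
  let ?g = "\<lambda>x v. f' x [] [v]"
  have d: "(f has_derivative ?g x) (at x)" for x
  proof (rule has_derivative_stdI)
    have h: "has_nderiv std_ns std_ns UNIV f x (?g x)" using f'(2) by simp
    show "\<exists>d>0. \<forall>y. norm (y - x) < d \<longrightarrow> norm (f y - f x - ?g x (y - x)) \<le> e * norm (y - x)" if "e > 0" for e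
      using h that unfolding has_nderiv_def by simp
    have lin: "?g x (a *\<^sub>R v + b *\<^sub>R w) = a *\<^sub>R ?g x v + b *\<^sub>R ?g x w" for a b v w using h unfolding has_nderiv_def by simp
    obtain c where c: "\<And>v. norm (?g x v) \<le> c * norm v" using h unfolding has_nderiv_def by auto
    show "bounded_linear (?g x)"
      by (rule bounded_linear_intro[where K = c]) (use lin[of 1 _ 1] lin[of _ _ 0] c in \<open>auto simp: mult.commute\<close>)
  qed
  have "\<exists>d>0. \<forall>y. norm (y - x) < d \<longrightarrow> (\<forall>v. norm (?g y v - ?g x v) \<le> e * norm v)" if "e > 0" for x e
  proof -
    have "\<forall>\<^sub>F y in nbhd std_ns UNIV x. mixed_le std_ns nul std_ns 0 1 (\<lambda>ws vs. f' y ws vs - f' x ws vs) e"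
      using f'(1) that unfolding mixed_Ck.simps mixed_cont_def by simp
    then obtain d where d: "d > 0" "\<And>y. norm (y - x) < d \<Longrightarrow> mixed_le std_ns nul std_ns 0 1 (\<lambda>ws vs. f' y ws vs - f' x ws vs) e"
      unfolding ev_nbhd by auto
    have "norm (?g y v - ?g x v) \<le> e * norm v" if "norm (y - x) < d" for y v
      using d(2)[OF that, unfolded mixed_le_def, rule_format, of "[]" "[v]"] by (simp add: args_def)
    then show ?thesis using d(1) by blast
  qed
  then show ?thesis by (rule that[of ?g, OF d])
qed

text \<open>The image is open by invariance of domain and closed by completeness.\<close>

lemma expanding_Diff1:
  fixes h :: "real^'n \<Rightarrow> real^'n"
  assumes h: "Ck_on std_ns std_ns 1 UNIV h" and c: "c > 0" and exp: "\<And>x y. c * norm (x - y) \<le> norm (h x - h y)"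
  shows "h \<in> Diff1"
proof -
  obtain h' where h': "\<And>x. (h has_derivative h' x) (at x)"
    "\<And>x e. e > 0 \<Longrightarrow> \<exists>d>0. \<forall>y. norm (y - x) < d \<longrightarrow> (\<forall>v. norm (h' y v - h' x v) \<le> e * norm v)"
    using Ck1_std_D[OF h] by blast
  have injh: "inj h"
  proof (rule injI)
    fix x y assume "h x = h y"
    then have "norm (x - y) \<le> 0" using exp[of x y] c by (simp add: mult_le_0_iff)
    then show "x = y" by simp
  qed
  have cont: "continuous_on UNIV h" by (rule has_derivative_continuous_on[OF has_derivative_at_withinI[OF h'(1)]])
  have "open (range h)" by (rule invariance_of_domain[OF cont open_UNIV injh])
  moreover have "closed (range h)"
  proof (rule complete_imp_closed, unfold complete_def, intro allI impI)
    fix s assume s: "(\<forall>n. s n \<in> range h) \<and> Cauchy s"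
    then have "\<forall>n. \<exists>y. s n = h y" by blast
    from choice[OF this] obtain t where t: "\<forall>n. s n = h (t n)" by blast
    \<comment> \<open>The expansion bound turns a Cauchy sequence of images into one of
      preimages.\<close>
    have "Cauchy t" unfolding Cauchy_def
    proof (intro allI impI)
      fix e :: real assume "e > 0"
      then have "c * e > 0" using c by simp
      then obtain M where M: "\<forall>m\<ge>M. \<forall>n\<ge>M. dist (s m) (s n) < c * e" using s unfolding Cauchy_def by blast
      have "dist (t m) (t n) < e" if "m \<ge> M" "n \<ge> M" for m n
      proof -
        have "c * dist (t m) (t n) \<le> dist (s m) (s n)" using exp[of "t m" "t n"] by (simp add: t dist_norm)
        also have "\<dots> < c * e" using M that by blast
        finally show ?thesis using c by simp
      qed
      then show "\<exists>M. \<forall>m\<ge>M. \<forall>n\<ge>M. dist (t m) (t n) < e" by blast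
    qed
    then obtain l where l: "t \<longlonglongrightarrow> l" using Cauchy_convergent[of t] unfolding convergent_def by blast
    have "isCont h l" by (rule has_derivative_continuous[OF h'(1)])
    then have "(\<lambda>n. h (t n)) \<longlonglongrightarrow> h l" using l by (rule isCont_tendsto_compose)
    moreover have "(\<lambda>n. h (t n)) = s" using t by auto
    ultimately show "\<exists>l\<in>range h. s \<longlonglongrightarrow> l" by auto
  qed
  \<comment> \<open>The range is open, closed and nonempty in a connected space.\<close>
  ultimately have surjh: "range h = UNIV" using clopen[of "range h"] by auto
  then have bij: "bij h" using injh by (simp add: bij_def)
  define g where "g = inv_into UNIV h"
  have hg: "h (g y) = y" and gh: "g (h x) = x" for x y
    using surj_f_inv_f[OF surjh, of y] inv_f_f[OF injh, of x] unfolding g_def by simp_all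
  \<comment> \<open>Difference quotients carry the expansion bound over to the derivative, up to e
    |v| for every e > 0. This makes every \<open>h' x\<close> invertible with inverse bounded by 1 /
    c.\<close>
  have exp': "c * norm v \<le> norm (h' x v)" for x v
  proof -
    have "c * norm v \<le> norm (h' x v) + e * norm v" if e: "e > 0" for e
    proof -
      obtain d where d: "d > 0" "\<And>y. norm (y - x) < d \<Longrightarrow> norm (h y - h x - h' x (y - x)) \<le> e * norm (y - x)"
        using h'(1)[of x] e unfolding has_derivative_at_alt by blast
      define t where "t = (d / 2) / (norm v + 1)"
      have n: "norm v + 1 > 0" using norm_ge_zero[of v] by linarith
      then have t: "t > 0" using d(1) by (simp add: t_def)
      have "t * (norm v + 1) = d / 2" by (rule nonzero_eq_divide_eq[THEN iffD1, OF _ t_def]) (use n in simp)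
      moreover have "t * norm v \<le> t * (norm v + 1)" using t by (intro mult_left_mono) auto
      ultimately have "t * norm v < d" using d(1) by linarith
      then have 1: "norm (h (x + t *\<^sub>R v) - h x - h' x (t *\<^sub>R v)) \<le> e * (t * norm v)"
        using d(2)[of "x + t *\<^sub>R v"] t by simp
      interpret bounded_linear "h' x" using h'(1) by (rule has_derivative_bounded_linear)
      have "c * (t * norm v) \<le> norm (h (x + t *\<^sub>R v) - h x)" using exp[of "x + t *\<^sub>R v" x] t by simp
      also have "\<dots> \<le> norm (h' x (t *\<^sub>R v)) + norm (h (x + t *\<^sub>R v) - h x - h' x (t *\<^sub>R v))"
        using norm_triangle_ineq[of "h' x (t *\<^sub>R v)" "h (x + t *\<^sub>R v) - h x - h' x (t *\<^sub>R v)"] by simp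
      also have "\<dots> \<le> norm (h' x (t *\<^sub>R v)) + e * (t * norm v)" using 1 by simp
      finally have "t * (c * norm v) \<le> t * (norm (h' x v) + e * norm v)" using t by (simp add: scaleR algebra_simps)
      then show ?thesis using t by simp
    qed
    note * = this
    show ?thesis
    proof (rule field_le_epsilon)
      fix e :: real assume e: "e > 0"
      define r where "r = e / (norm v + 1)"
      have n: "norm v + 1 > 0" using norm_ge_zero[of v] by linarith
      then have r: "r > 0" using e by (simp add: r_def)
      have "r * (norm v + 1) = e" by (rule nonzero_eq_divide_eq[THEN iffD1, OF _ r_def]) (use n in simp)
      moreover have "r * norm v \<le> r * (norm v + 1)" using r by (intro mult_left_mono) auto
      ultimately show "c * norm v \<le> norm (h' x v) + e" using *[OF r] by linarith
    qed
  qed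
  have lin: "linear (h' x)" for x using h'(1) has_derivative_linear by blast
  have injL: "inj (h' x)" for x
  proof (subst linear_injective_0[OF lin], intro allI impI)
    fix v assume "h' x v = 0"
    then have "c * norm v \<le> 0" using exp'[of v x] by simp
    then show "v = 0" using c by (simp add: mult_le_0_iff)
  qed
  \<comment> \<open>The candidate for the derivative of the inverse: \<open>h' x\<close> is
    injective, hence bijective in finite dimension.\<close>
  define k where "k x = inv_into UNIV (h' x)" for x
  have hk: "h' x (k x v) = v" and kh: "k x (h' x v) = v" for x v
    using surj_f_inv_f[OF linear_injective_imp_surjective[OF lin injL], of x v] inv_f_f[OF injL, of x v] unfolding k_def by simp_all
  have kn: "norm (k x v) \<le> norm v / c" for x v using exp'[of "k x v" x] c by (simp add: hk field_simps)
  have klin: "linear (k x)" for x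
  proof (rule linearI)
    show "k x (a + b) = k x a + k x b" for a b
      by (rule injD[OF injL[of x]]) (simp add: linear_add[OF lin] hk)
    show "k x (r *\<^sub>R b) = r *\<^sub>R k x b" for r b
      by (rule injD[OF injL[of x]]) (simp add: linear_scale[OF lin] hk)
  qed
  have kb: "bounded_linear (k x)" for x using klin linear_conv_bounded_linear by blast
  have gn: "norm (g y - g z) \<le> norm (y - z) / c" for y z using exp[of "g y" "g z"] c by (simp add: hg field_simps)
  have gcont: "continuous (at y) g" for y
    unfolding continuous_at_eps_delta
  proof (intro allI impI)
    fix e :: real assume e: "e > 0"
    have "dist (g z) (g y) < e" if "dist z y < c * e" for z
    proof -
      have "norm (z - y) / c < e" using that c by (simp add: dist_norm pos_divide_less_eq mult.commute)
      then show ?thesis using gn[of z y] by (simp add: dist_norm)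
    qed
    then show "\<exists>d>0. \<forall>x'. dist x' y < d \<longrightarrow> dist (g x') (g y) < e" using c e by (intro exI[of _ "c * e"]) auto
  qed
  \<comment> \<open>Continuity of g, which differentiability of the inverse presupposes, comes from
    the Lipschitz bound \<open>gn\<close>.\<close>
  have gd: "(g has_derivative k (g y)) (at y)" for y
    by (rule has_derivative_inverse_basic[OF h'(1) kb _ gcont open_UNIV]) (auto simp: kh hg fun_eq_iff)
  have kcont: "\<exists>d>0. \<forall>z. norm (z - y) < d \<longrightarrow> (\<forall>v. norm (k (g z) v - k (g y) v) \<le> e * norm v)" if e: "e > 0" for y e
  proof -
    have "e * (c * c) > 0" using e c by simp
    then obtain d where d: "d > 0" "\<And>x v. norm (x - g y) < d \<Longrightarrow> norm (h' x v - h' (g y) v) \<le> e * (c * c) * norm v"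
      using h'(2)[of "e * (c * c)" "g y"] by blast
    have "norm (k (g z) v - k (g y) v) \<le> e * norm v" if z: "norm (z - y) < c * d" for z v
    proof -
      have "norm (z - y) / c < d" using z c by (simp add: pos_divide_less_eq mult.commute)
      then have "norm (g z - g y) < d" using gn[of z y] by linarith
      then have "norm (h' (g z) (k (g y) v) - h' (g y) (k (g y) v)) \<le> e * (c * c) * norm (k (g y) v)" by (rule d(2))
      also have "\<dots> \<le> e * (c * c) * (norm v / c)" using e c by (intro mult_left_mono kn) auto
      finally have 1: "norm (v - h' (g z) (k (g y) v)) \<le> e * c * norm v" using c by (simp add: hk norm_minus_commute field_simps)
      \<comment> \<open>The identity B^-1 - A^-1 = B^-1 (A - B) A^-1 with A and B the derivatives of
        h at g y and g z. The two inverses cost 1 / c each, whence the factor c c in the choice of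
        d.\<close>
      have "k (g z) v - k (g y) v = k (g z) (v - h' (g z) (k (g y) v))"
        using linear_diff[OF klin] by (simp add: kh)
      also have "norm \<dots> \<le> norm (v - h' (g z) (k (g y) v)) / c" by (rule kn)
      also have "\<dots> \<le> e * c * norm v / c" by (rule divide_right_mono[OF 1]) (use c in simp)
      finally show ?thesis using c by simp
    qed
    then show ?thesis using d(1) c by (intro exI[of _ "c * d"]) auto
  qed
  have "Ck_on std_ns std_ns 1 UNIV g" by (rule Ck1_std[OF gd kcont])
  then show ?thesis using bij h unfolding Diff1_def g_def by simp
qed

text \<open>The derivative of the inverse is bounded: off a large ball because the derivative of \<open>u\<close> vanishes
  at infinity, and on the image of the ball by compactness.\<close>

lemma DiffC0_expanding:
  fixes u :: "(real^'n) \<Rightarrow>\<^sub>C (real^'n)"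
  assumes u: "u \<in> nscar (C0 k)" and k: "k \<ge> 1" and D: "(\<lambda>x. x + apply_bcontfun u x) \<in> Diff1"
  obtains c where "c > 0" "\<And>x y. c * norm (x - y) \<le> norm ((x + apply_bcontfun u x) - (y + apply_bcontfun u y))"
proof -
  let ?f = "\<lambda>x. x + apply_bcontfun u x"
  let ?N = "\<lambda>x. \<Sum>b\<in>Basis. norm (pderivs (apply_bcontfun u) [b] x)"
  define g where "g = inv_into UNIV ?f"
  have bij: "bij ?f" and g: "Ck_on std_ns std_ns 1 UNIV g" using D unfolding Diff1_def g_def by auto
  have fg: "?f (g y) = y" and gf: "g (?f x) = x" for x y
    using surj_f_inv_f[OF bij_is_surj[OF bij], of y] inv_f_f[OF bij_is_inj[OF bij], of x] unfolding g_def by simp_all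
  obtain g' where g': "\<And>x. (g has_derivative g' x) (at x)"
    "\<And>x e. e > 0 \<Longrightarrow> \<exists>d>0. \<forall>y. norm (y - x) < d \<longrightarrow> (\<forall>v. norm (g' y v - g' x v) \<le> e * norm v)"
    using Ck1_std_D[OF g] by blast
  have fd: "(?f has_derivative (\<lambda>v. v + pderivs (apply_bcontfun u) [v] x)) (at x)" for x
    by (intro has_derivative_add has_derivative_ident C0_deriv(1)[OF u k])
  have fcont: "continuous_on UNIV ?f" by (intro continuous_intros continuous_on_apply_bcontfun)
  have "(?N \<longlongrightarrow> (\<Sum>b\<in>(Basis::(real^'n) set). 0)) at_infinity"
  proof (intro tendsto_sum tendsto_norm_zero)
    fix b :: "real^'n" assume "b \<in> Basis"
    then have "[b] \<in> multi_idx k" using k by (simp add: multi_idx_def)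
    then show "(pderivs (apply_bcontfun u) [b] \<longlongrightarrow> 0) at_infinity" by (rule C0_D(2)[OF u])
  qed
  then have "(?N \<longlongrightarrow> 0) at_infinity" by simp
  \<comment> \<open>Beyond R the derivative of u has norm below 1/2, so that of id + u is invertible
    with inverse of norm at most 2.\<close>
  then obtain R where R: "\<And>x. R \<le> norm x \<Longrightarrow> ?N x < 1/2"
    using tendstoD[of ?N 0 at_infinity "1/2"] unfolding eventually_at_infinity by (auto simp: sum_nonneg)
  have far: "norm (g' (?f x) v) \<le> 2 * norm v" if "R \<le> norm x" for x v
  proof -
    \<comment> \<open>Differentiate f (g y) = y at y = f x: the vector w = g'(f x) v satisfies w +
      Du(x) w = v, and |Du(x) w| <= |w| / 2.\<close>
    have "((\<lambda>y. ?f (g y)) has_derivative (\<lambda>v. g' (?f x) v + pderivs (apply_bcontfun u) [g' (?f x) v] (g (?f x)))) (at (?f x))"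
      by (rule has_derivative_compose[OF g'(1) fd])
    moreover have "((\<lambda>y. ?f (g y)) has_derivative (\<lambda>v. v)) (at (?f x))" unfolding fg by (rule has_derivative_ident)
    ultimately have "(\<lambda>v. g' (?f x) v + pderivs (apply_bcontfun u) [g' (?f x) v] (g (?f x))) = (\<lambda>v. v)"
      by (rule has_derivative_unique)
    then have eq: "g' (?f x) v + pderivs (apply_bcontfun u) [g' (?f x) v] x = v" unfolding gf by (rule fun_cong)
    let ?w = "g' (?f x) v"
    have "norm (pderivs (apply_bcontfun u) [?w] x) \<le> ?N x * norm ?w" by (rule C0_deriv(2)[OF u k])
    also have "\<dots> \<le> 1/2 * norm ?w" using R[OF that] by (intro mult_right_mono) auto
    finally have "norm (pderivs (apply_bcontfun u) [?w] x) \<le> 1/2 * norm ?w" .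
    moreover have "norm ?w \<le> norm v + norm (pderivs (apply_bcontfun u) [?w] x)"
      using norm_triangle_ineq4[of v "pderivs (apply_bcontfun u) [?w] x"] eq by (metis add_diff_cancel_right')
    ultimately show ?thesis by linarith
  qed
  have "\<exists>B. \<forall>y\<in>?f ` cball 0 R. \<forall>v. norm (g' y v) \<le> B * norm v"
  proof -
    have comp: "compact (?f ` cball 0 R)" by (intro compact_continuous_image continuous_on_subset[OF fcont]) auto
    \<comment> \<open>\<open>g'\<close> is continuous uniformly over the unit vectors, so its
      operator norm is continuous and therefore bounded on the compact image of the ball.\<close>
    have on: "continuous_on UNIV (\<lambda>y. onorm (g' y))"
      unfolding continuous_on_iff
    proof (intro ballI allI impI)
      fix x and e :: real assume e: "e > 0"
      obtain d where d: "d > 0" "\<And>y v. norm (y - x) < d \<Longrightarrow> norm (g' y v - g' x v) \<le> e/2 * norm v" using g'(2)[of "e/2" x] e by auto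
      have bl: "bounded_linear (g' y)" for y using g'(1) by (rule has_derivative_bounded_linear)
      have "dist (onorm (g' y)) (onorm (g' x)) < e" if "dist y x < d" for y
      proof -
        have n: "norm (g' y v - g' x v) \<le> e/2 * norm v" for v using d(2)[of y v] that by (simp add: dist_norm)
        have "onorm (g' y) \<le> onorm (g' x) + e/2"
        proof (rule onorm_le)
          fix v
          have "norm (g' y v) \<le> norm (g' x v) + norm (g' y v - g' x v)" by (metis add.commute diff_add_cancel norm_triangle_ineq)
          then show "norm (g' y v) \<le> (onorm (g' x) + e/2) * norm v" using n[of v] onorm[OF bl, of x v] by (simp add: distrib_right)
        qed
        moreover have "onorm (g' x) \<le> onorm (g' y) + e/2"
        proof (rule onorm_le)
          fix v
          have "norm (g' x v) \<le> norm (g' y v) + norm (g' y v - g' x v)" by (metis add.commute diff_add_cancel norm_minus_commute norm_triangle_ineq)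
          then show "norm (g' x v) \<le> (onorm (g' y) + e/2) * norm v" using n[of v] onorm[OF bl, of y v] by (simp add: distrib_right)
        qed
        ultimately show ?thesis using e unfolding dist_real_def by linarith
      qed
      then show "\<exists>d>0. \<forall>x'\<in>UNIV. dist x' x < d \<longrightarrow> dist (onorm (g' x')) (onorm (g' x)) < e" using d(1) by blast
    qed
    have "bounded ((\<lambda>y. onorm (g' y)) ` ?f ` cball 0 R)"
      by (intro compact_imp_bounded compact_continuous_image comp continuous_on_subset[OF on]) auto
    then obtain B where B: "\<And>y. y \<in> ?f ` cball 0 R \<Longrightarrow> norm (onorm (g' y)) \<le> B" unfolding bounded_iff by blast
    have "norm (g' y v) \<le> B * norm v" if "y \<in> ?f ` cball 0 R" for y v
    proof -
      have "norm (g' y v) \<le> onorm (g' y) * norm v" by (rule onorm[OF has_derivative_bounded_linear[OF g'(1)]])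
      also have "\<dots> \<le> B * norm v" using B[OF that] by (intro mult_right_mono) auto
      finally show ?thesis .
    qed
    then show ?thesis by blast
  qed
  then obtain B where B: "\<And>x v. norm x \<le> R \<Longrightarrow> norm (g' (?f x) v) \<le> B * norm v" by fastforce
  \<comment> \<open>The maximum with 2 covers the points outside the ball and makes L
    positive.\<close>
  define L where "L = max B 2"
  have gL: "norm (g' y v) \<le> L * norm v" for y v
  proof (cases "R \<le> norm (g y)")
    case True
    have "norm (g' y v) \<le> 2 * norm v" using far[OF True, of v] unfolding fg .
    also have "\<dots> \<le> L * norm v" by (intro mult_right_mono) (auto simp: L_def)
    finally show ?thesis .
  next
    case False
    then have "norm (g' y v) \<le> B * norm v" using B[of "g y" v] unfolding fg by simp
    also have "\<dots> \<le> L * norm v" by (intro mult_right_mono) (auto simp: L_def)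
    finally show ?thesis .
  qed
  have lip: "norm (g y - g z) \<le> L * norm (y - z)" for y z
    by (rule differentiable_bound[of UNIV g g']) (rule convex_UNIV | rule g'(1) | rule onorm_le[OF gL] | simp)+
  show ?thesis
  \<comment> \<open>A Lipschitz constant L of the inverse is an expansion constant 1 / L of the
    map.\<close>
  proof (rule that[of "1 / L"])
    show "1 / L > 0" by (simp add: L_def)
    show "1 / L * norm (x - y) \<le> norm (?f x - ?f y)" for x y
      using lip[of "?f x" "?f y"] unfolding gf by (simp add: L_def field_simps)
  qed
qed

text \<open>A diffeomorphism id + u expands distances by some c > 0. If v - u is small in C^1, it
  has Lipschitz constant c/2, so id + v still expands by c/2 and is a diffeomorphism by
  \<open>expanding_Diff1\<close>.\<close>

lemma DiffC0_open:
  assumes k: "k \<ge> 1"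
  shows "nopen (C0 k) {u \<in> nscar (C0 k). (\<lambda>x. x + apply_bcontfun u x) \<in> (Diff1 :: ((real^'n) \<Rightarrow> (real^'n)) set)}"
  unfolding nopen_def
proof (intro conjI ballI)
  let ?A = "{u \<in> nscar (C0 k). (\<lambda>x. x + apply_bcontfun u x) \<in> (Diff1 :: ((real^'n) \<Rightarrow> (real^'n)) set)}"
  interpret C: normed "C0 k :: ((real^'n) \<Rightarrow>\<^sub>C (real^'n)) nspace" by (rule C0_normed)
  fix u assume "u \<in> ?A"
  then have u: "u \<in> nscar (C0 k)" "(\<lambda>x. x + apply_bcontfun u x) \<in> Diff1" by auto
  obtain c where c: "c > 0" "\<And>x y. c * norm (x - y) \<le> norm ((x + apply_bcontfun u x) - (y + apply_bcontfun u y))"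
    using DiffC0_expanding[OF u(1) k u(2)] by blast
  define m where "m = real CARD('n)"
  have m: "m > 0" by (simp add: m_def)
  show "\<exists>\<delta>>0. \<forall>v\<in>nscar (C0 k). nsnorm (C0 k) (v - u) < \<delta> \<longrightarrow> v \<in> ?A"
  \<comment> \<open>The derivative of v - u is bounded by the sum of its m partial derivatives, each
    below c / (2 m).\<close>
  proof (intro exI[of _ "c / (2 * m)"] conjI ballI impI)
    show "c / (2 * m) > 0" using c m by simp
    fix v :: "(real^'n) \<Rightarrow>\<^sub>C (real^'n)" assume v: "v \<in> nscar (C0 k)" and lt: "nsnorm (C0 k) (v - u) < c / (2 * m)"
    define w0 where "w0 = v - u"
    have w: "w0 \<in> nscar (C0 k)" using v u by (auto simp: w0_def)
    let ?w = "apply_bcontfun w0"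
    have b: "norm (pderivs ?w [z] x) \<le> c / 2 * norm z" for z x
    proof -
      have "(\<Sum>b\<in>Basis. norm (pderivs ?w [b] x)) \<le> (\<Sum>b\<in>(Basis::(real^'n) set). c / (2 * m))"
      proof (rule sum_mono)
        fix b :: "real^'n" assume "b \<in> Basis"
        then have "[b] \<in> multi_idx k" using k by (simp add: multi_idx_def)
        then show "norm (pderivs ?w [b] x) \<le> c / (2 * m)" using C0_norm_ge[OF w, of "[b]" x] lt unfolding w0_def by linarith
      qed
      also have "\<dots> = c / 2" using m by (simp add: m_def)
      finally show ?thesis using C0_deriv(2)[OF w k, of z x] by (smt (verit) mult_right_mono norm_ge_zero)
    qed
    have lip: "norm (?w x - ?w y) \<le> c / 2 * norm (x - y)" for x y
      by (rule differentiable_bound[of UNIV ?w "\<lambda>x z. pderivs ?w [z] x"])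
        (rule convex_UNIV | rule C0_deriv(1)[OF w k] | rule onorm_le[OF b] | simp only: UNIV_I)+
    let ?h = "\<lambda>x. x + apply_bcontfun v x"
    have dec: "apply_bcontfun v x = apply_bcontfun u x + ?w x" for x by (simp add: w0_def minus_bcontfun.rep_eq)
    have "Ck_on std_ns std_ns 1 UNIV (apply_bcontfun v)"
      by (rule Ck_on_le[OF std_normed std_normed _ C0_D(1)[OF v] k]) simp
    from Ck_std_lin[OF Ck_on_id[OF std_normed] this, of 1 1]
    have h: "Ck_on std_ns std_ns 1 UNIV ?h" by simp
    have "c / 2 * norm (x - y) \<le> norm (?h x - ?h y)" for x y
    proof -
      \<comment> \<open>The increment of id + v is that of id + u plus that of v - u, and the latter
        takes away at most half of the expansion.\<close>
      have "?h x - ?h y = ((x + apply_bcontfun u x) - (y + apply_bcontfun u y)) + (?w x - ?w y)" by (simp add: dec)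
      then have "norm ((x + apply_bcontfun u x) - (y + apply_bcontfun u y)) - norm (?w x - ?w y) \<le> norm (?h x - ?h y)"
        by (metis norm_diff_ineq)
      moreover have "c / 2 * norm (x - y) + c / 2 * norm (x - y) = c * norm (x - y)" by (simp add: field_simps)
      ultimately show ?thesis using c(2)[of x y] lip[of x y] by linarith
    qed
    then have "?h \<in> Diff1" using expanding_Diff1[OF h, of "c / 2"] c by auto
    then show "v \<in> ?A" using v by simp
  qed
qed auto

section \<open>The manifold of diffeomorphisms\<close>

lemma DiffM_sel [simp]: "pts (DiffM k) = DiffC0 k" "model (DiffM k) = C0 k" "idx (DiffM k) = UNIV" "cdom (DiffM k) i = DiffC0 k"
  "cmap (DiffM k) i \<phi> = Bcontfun (\<lambda>x. \<phi> x - x)"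
  by (simp_all add: DiffM_def)

lemma DiffC0_chart: assumes "\<phi> \<in> DiffC0 k"
  shows "Bcontfun (\<lambda>x. \<phi> x - x) \<in> nscar (C0 k)" "\<phi> = (\<lambda>x. x + apply_bcontfun (Bcontfun (\<lambda>x. \<phi> x - x)) x)"
proof -
  obtain u where u: "u \<in> nscar (C0 k)" "\<phi> = (\<lambda>x. x + apply_bcontfun u x)" using assms unfolding DiffC0_def by auto
  have "Bcontfun (\<lambda>x. \<phi> x - x) = u" unfolding u(2) by (simp add: apply_bcontfun_inverse)
  then show "Bcontfun (\<lambda>x. \<phi> x - x) \<in> nscar (C0 k)" "\<phi> = (\<lambda>x. x + apply_bcontfun (Bcontfun (\<lambda>x. \<phi> x - x)) x)"
    using u by auto
qed

text \<open>There is one chart, with image open by \<open>DiffC0_open\<close>; the only chart change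
  is the identity of that image.\<close>

lemma DiffM_premfd: assumes k: "k \<ge> 1" shows "premfd (DiffM k :: ((real^'n) \<Rightarrow> (real^'n), unit, (real^'n) \<Rightarrow>\<^sub>C (real^'n)) mfd)"
proof -
  let ?M = "DiffM k :: ((real^'n) \<Rightarrow> (real^'n), unit, (real^'n) \<Rightarrow>\<^sub>C (real^'n)) mfd"
  let ?A = "{u \<in> nscar (C0 k). (\<lambda>x. x + apply_bcontfun u x) \<in> (Diff1 :: ((real^'n) \<Rightarrow> (real^'n)) set)}"
  have inj: "inj_on (cmap ?M i) (DiffC0 k)" for i
  proof (rule inj_onI)
    fix \<phi> \<psi> assume p: "\<phi> \<in> DiffC0 k" "\<psi> \<in> DiffC0 k" and "cmap ?M i \<phi> = cmap ?M i \<psi>"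
    then have eq: "Bcontfun (\<lambda>x. \<phi> x - x) = Bcontfun (\<lambda>x. \<psi> x - x)" by simp
    have "\<phi> = (\<lambda>x. x + apply_bcontfun (Bcontfun (\<lambda>x. \<phi> x - x)) x)" by (rule DiffC0_chart(2)[OF p(1)])
    also have "\<dots> = (\<lambda>x. x + apply_bcontfun (Bcontfun (\<lambda>x. \<psi> x - x)) x)" by (simp only: eq)
    also have "\<dots> = \<psi>" by (rule DiffC0_chart(2)[OF p(2), symmetric])
    finally show "\<phi> = \<psi>" .
  qed
  have im: "cmap ?M i ` DiffC0 k = ?A" for i
  proof (intro subset_antisym subsetI)
    fix u assume "u \<in> cmap ?M i ` DiffC0 k"
    then obtain \<phi> where p: "\<phi> \<in> DiffC0 k" "u = Bcontfun (\<lambda>x. \<phi> x - x)" by auto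
    have "(\<lambda>x. x + apply_bcontfun u x) = \<phi>" unfolding p(2) by (rule DiffC0_chart(2)[OF p(1), symmetric])
    moreover have "\<phi> \<in> Diff1" using p(1) unfolding DiffC0_def by blast
    moreover have "u \<in> nscar (C0 k)" unfolding p(2) by (rule DiffC0_chart(1)[OF p(1)])
    ultimately show "u \<in> ?A" by simp
  next
    fix u assume u: "u \<in> ?A"
    then have "(\<lambda>x. x + apply_bcontfun u x) \<in> DiffC0 k" unfolding DiffC0_def by blast
    moreover have "u = cmap ?M i (\<lambda>x. x + apply_bcontfun u x)" by (simp add: apply_bcontfun_inverse)
    ultimately show "u \<in> cmap ?M i ` DiffC0 k" by blast
  qed
  have cc: "cmap ?M j (cinv ?M i u) = u" if "u \<in> ?A" for i j u
  proof -
    have "u \<in> cmap ?M i ` cdom ?M i" unfolding DiffM_sel(4) im by (rule that)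
    then have "cmap ?M i (cinv ?M i u) = u" unfolding cinv_def by (rule f_inv_into_f)
    then show ?thesis by simp
  qed
  show ?thesis
  proof (rule premfd.intro, goal_cases)
    case 1
    show ?case by (simp add: C0_normed)
  next
    case (4 i j)
    then show ?case using DiffC0_open[OF k] im by simp
  next
    case (5 i j l)
    have "Ck_on (C0 k) (C0 k) l ?A (cmap ?M j \<circ> cinv ?M i)"
      by (rule Ck_on_cong[OF Ck_on_id[OF C0_normed]]) (auto simp only: cc comp_apply)
    then show ?case using im[of i] by simp
  qed (use inj in auto)
qed

section \<open>The semidirect product\<close>

lemma acts_onD:
  assumes "acts_on G S a"
  shows "group G" "\<And>g x. g \<in> carrier G \<Longrightarrow> x \<in> S \<Longrightarrow> a g x \<in> S" "\<And>x. x \<in> S \<Longrightarrow> a \<one>\<^bsub>G\<^esub> x = x"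
    "\<And>g h x. g \<in> carrier G \<Longrightarrow> h \<in> carrier G \<Longrightarrow> x \<in> S \<Longrightarrow> a (g \<otimes>\<^bsub>G\<^esub> h) x = a g (a h x)"
proof -
  interpret A: group_action G S "\<lambda>g. restrict (a g) S" using assms unfolding acts_on_def .
  show "group G" using A.group_hom unfolding group_hom_def by blast
  show in_S: "a g x \<in> S" if "g \<in> carrier G" "x \<in> S" for g x
    using A.element_image[OF that refl] that by simp
  show "a \<one>\<^bsub>G\<^esub> x = x" if "x \<in> S" for x
    using fun_cong[OF A.id_eq_one, of x] that by simp
  show "a (g \<otimes>\<^bsub>G\<^esub> h) x = a g (a h x)" if "g \<in> carrier G" "h \<in> carrier G" "x \<in> S" for g h x
    using A.composition_rule[OF that(3,1,2)] that in_S[OF that(2,3)] by simp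
qed

text \<open>The elements of \<open>BijGroup S\<close> are extensional bijections of S; bijectivity
  of a g is witnessed by the action of the inverse of g.\<close>

lemma acts_onI:
  assumes G: "group G" and cl: "\<And>g x. g \<in> carrier G \<Longrightarrow> x \<in> S \<Longrightarrow> a g x \<in> S" and one: "\<And>x. x \<in> S \<Longrightarrow> a \<one>\<^bsub>G\<^esub> x = x"
    and comp: "\<And>g h x. g \<in> carrier G \<Longrightarrow> h \<in> carrier G \<Longrightarrow> x \<in> S \<Longrightarrow> a (g \<otimes>\<^bsub>G\<^esub> h) x = a g (a h x)"
  shows "acts_on G S a"
proof -
  interpret group G by fact
  have inv: "a (inv\<^bsub>G\<^esub> g) (a g x) = x" "a g (a (inv\<^bsub>G\<^esub> g) x) = x" if "g \<in> carrier G" "x \<in> S" for g x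
    using comp[of "inv\<^bsub>G\<^esub> g" g x] comp[of g "inv\<^bsub>G\<^esub> g" x] one that by auto
  have bij: "restrict (a g) S \<in> Bij S" if g: "g \<in> carrier G" for g
  proof -
    have "bij_betw (a g) S S"
      by (rule bij_betw_byWitness[of S "a (inv\<^bsub>G\<^esub> g)"]) (use inv[OF g] cl g in auto)
    then show ?thesis unfolding Bij_def by simp
  qed
  have "(\<lambda>g. restrict (a g) S) \<in> hom G (BijGroup S)"
  proof (rule homI)
    show "restrict (a g) S \<in> carrier (BijGroup S)" if "g \<in> carrier G" for g using bij[OF that] by (simp add: BijGroup_def)
    show "restrict (a (g \<otimes>\<^bsub>G\<^esub> h)) S = restrict (a g) S \<otimes>\<^bsub>BijGroup S\<^esub> restrict (a h) S" if "g \<in> carrier G" "h \<in> carrier G" for g h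
      using bij[OF that(1)] bij[OF that(2)] comp[OF that] cl[OF that(2)] by (auto simp: BijGroup_def compose_def fun_eq_iff)
  qed
  then show ?thesis unfolding acts_on_def group_action_def group_hom_def group_hom_axioms_def
    using G group_BijGroup by blast
qed

lemma semidirect_group:
  fixes \<rho> :: "'g \<Rightarrow> (real^'n \<Rightarrow> real^'n) \<Rightarrow> (real^'n \<Rightarrow> real^'n)"
  assumes G: "group G" and D: "group (DiffG k :: (real^'n \<Rightarrow> real^'n) monoid)" and cl: "\<And>g \<phi>. g \<in> carrier G \<Longrightarrow> \<phi> \<in> DiffC0 k \<Longrightarrow> \<rho> g \<phi> \<in> DiffC0 k"
    and right: "\<And>g h \<phi>. g \<in> carrier G \<Longrightarrow> h \<in> carrier G \<Longrightarrow> \<phi> \<in> DiffC0 k \<Longrightarrow> \<rho> (g \<otimes>\<^bsub>G\<^esub> h) \<phi> = \<rho> h (\<rho> g \<phi>)"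
    and comp: "\<And>g \<phi> \<psi>. g \<in> carrier G \<Longrightarrow> \<phi> \<in> DiffC0 k \<Longrightarrow> \<psi> \<in> DiffC0 k \<Longrightarrow> \<rho> g (\<phi> \<circ> \<psi>) = \<rho> g \<phi> \<circ> \<rho> g \<psi>"
    and id: "\<And>g. g \<in> carrier G \<Longrightarrow> \<rho> g id = id" and one: "\<And>\<phi>. \<phi> \<in> DiffC0 k \<Longrightarrow> \<rho> \<one>\<^bsub>G\<^esub> \<phi> = \<phi>"
  shows "group (semidirect G \<rho> k)"
proof -
  interpret G: group G by fact
  interpret D: group "DiffG k :: (real^'n \<Rightarrow> real^'n) monoid" by fact
  have car: "carrier (DiffG k) = (DiffC0 k :: (real^'n \<Rightarrow> real^'n) set)"
    "\<And>\<phi> \<psi> :: real^'n \<Rightarrow> real^'n. \<phi> \<otimes>\<^bsub>DiffG k\<^esub> \<psi> = \<phi> \<circ> \<psi>" "\<one>\<^bsub>DiffG k\<^esub> = (id :: real^'n \<Rightarrow> real^'n)" by (simp_all add: DiffG_def)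
  have c: "\<phi> \<circ> \<psi> \<in> DiffC0 k" if "\<phi> \<in> DiffC0 k" "\<psi> \<in> DiffC0 k" for \<phi> \<psi> :: "real^'n \<Rightarrow> real^'n" using D.m_closed that unfolding car by blast
  have i: "(id :: real^'n \<Rightarrow> real^'n) \<in> DiffC0 k" using D.one_closed unfolding car .
  show ?thesis
  proof (rule groupI)
    fix x assume "x \<in> carrier (semidirect G \<rho> k)"
    then obtain g \<phi> where x: "x = (g, \<phi>)" "g \<in> carrier G" "\<phi> \<in> DiffC0 k" by (auto simp: semidirect_def)
    let ?\<psi> = "inv\<^bsub>DiffG k\<^esub> \<phi>"
    have p: "?\<psi> \<in> DiffC0 k" "?\<psi> \<circ> \<phi> = id" using D.inv_closed[of \<phi>] D.l_inv[of \<phi>] x(3) unfolding car by auto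
    \<comment> \<open>The left inverse of (g, phi) is (g^-1, rho_(g^-1) psi) with psi the inverse of
      phi: since rho is a right action, rho_g undoes rho_(g^-1), and psi o phi = id remains.\<close>
    have "\<rho> g (\<rho> (inv\<^bsub>G\<^esub> g) ?\<psi>) = ?\<psi>" using right[of "inv\<^bsub>G\<^esub> g" g ?\<psi>] one[OF p(1)] x p by simp
    then show "\<exists>y\<in>carrier (semidirect G \<rho> k). y \<otimes>\<^bsub>semidirect G \<rho> k\<^esub> x = \<one>\<^bsub>semidirect G \<rho> k\<^esub>"
      using x p cl by (intro bexI[of _ "(inv\<^bsub>G\<^esub> g, \<rho> (inv\<^bsub>G\<^esub> g) ?\<psi>)"]) (auto simp: semidirect_def)
  qed (use c i cl right comp id in \<open>auto simp: semidirect_def G.m_assoc comp_assoc\<close>)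
qed

text \<open>Multiplication in the semidirect product turns phi into rho_g' phi; the compatibility
  condition is exactly what moves phi past the action of g'.\<close>

lemma semidirect_acts:
  assumes grp: "group (semidirect G \<rho> k)" and aG: "acts_on G S aG" and aD: "acts_on (DiffG k) S aD"
    and cl: "\<And>g \<phi>. g \<in> carrier G \<Longrightarrow> \<phi> \<in> DiffC0 k \<Longrightarrow> \<rho> g \<phi> \<in> DiffC0 k"
    and compat: "\<And>g \<phi> q. g \<in> carrier G \<Longrightarrow> \<phi> \<in> DiffC0 k \<Longrightarrow> q \<in> S \<Longrightarrow> aD \<phi> (aG g q) = aG g (aD (\<rho> g \<phi>) q)"
  shows "acts_on (semidirect G \<rho> k) (carrier G \<times> S) (semi_act G aG aD)"
proof (rule acts_onI[OF grp])
  interpret G: group G by (rule acts_onD(1)[OF aG])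
  have id: "aD id q = q" if "q \<in> S" for q using acts_onD(3)[OF aD that] by (simp add: DiffG_def)
  have aDS: "aD \<phi> q \<in> S" if "\<phi> \<in> DiffC0 k" "q \<in> S" for \<phi> q using acts_onD(2)[OF aD] that by (simp add: DiffG_def)
  have aDc: "aD (\<phi> \<circ> \<psi>) q = aD \<phi> (aD \<psi> q)" if "\<phi> \<in> DiffC0 k" "\<psi> \<in> DiffC0 k" "q \<in> S" for \<phi> \<psi> q
    using acts_onD(4)[OF aD, of \<phi> \<psi> q] that by (simp add: DiffG_def)
  fix m p assume m: "m \<in> carrier (semidirect G \<rho> k)" and p: "p \<in> carrier G \<times> S"
  then obtain g \<phi> h q where mp: "m = (g, \<phi>)" "p = (h, q)" "g \<in> carrier G" "\<phi> \<in> DiffC0 k" "h \<in> carrier G" "q \<in> S"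
    by (auto simp: semidirect_def)
  then show "semi_act G aG aD m p \<in> carrier G \<times> S"
    using acts_onD(2)[OF aG] aDS by (auto simp: semi_act_def)
  fix m' assume "m' \<in> carrier (semidirect G \<rho> k)"
  then obtain g' \<phi>' where m': "m' = (g', \<phi>')" "g' \<in> carrier G" "\<phi>' \<in> DiffC0 k" by (auto simp: semidirect_def)
  have "aG (g \<otimes>\<^bsub>G\<^esub> g') (aD (\<rho> g' \<phi> \<circ> \<phi>') q) = aG g (aG g' (aD (\<rho> g' \<phi>) (aD \<phi>' q)))"
    using acts_onD(4)[OF aG mp(3) m'(2)] acts_onD(2)[OF aG] aDc[OF cl[OF m'(2) mp(4)] m'(3) mp(6)] aDS cl[OF m'(2) mp(4)] m' mp by simp
  also have "\<dots> = aG g (aD \<phi> (aG g' (aD \<phi>' q)))" using compat[OF m'(2) mp(4) aDS[OF m'(3) mp(6)]] by simp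
  finally show "semi_act G aG aD (m \<otimes>\<^bsub>semidirect G \<rho> k\<^esub> m') p = semi_act G aG aD m (semi_act G aG aD m' p)"
    using mp m' by (simp add: semi_act_def semidirect_def G.m_assoc)
next
  interpret G: group G by (rule acts_onD(1)[OF aG])
  fix p assume "p \<in> carrier G \<times> S"
  then show "semi_act G aG aD \<one>\<^bsub>semidirect G \<rho> k\<^esub> p = p"
    using acts_onD(3)[OF aD] acts_onD(3)[OF aG] by (auto simp: semi_act_def semidirect_def DiffG_def)
qed

section \<open>Regularity of the action\<close>

text \<open>Serves both continuity (l = 0 on the group of order k) and the C^l statement (on the
  group of order k + l): in each case the action of \<open>D\<close> has the stated regularity
  jointly in both arguments.\<close>

lemma Ck_map_semi_act:
  assumes M: "premfd M" and D: "premfd D" and Q: "premfd Q" and m: "Ck_map l (prodM M M) M (\<lambda>(g, h). g \<otimes>\<^bsub>G\<^esub> h)"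
    and aG: "Ck_map l (prodM M Q) Q (\<lambda>(g, q). aG g q)" and aD: "Ck_map l (prodM D Q) Q (\<lambda>(\<phi>, q). aD \<phi> q)"
  shows "Ck_map l (prodM (prodM M D) (prodM M Q)) (prodM M Q) (\<lambda>(m, p). semi_act G aG aD m p)"
proof -
  let ?MD = "prodM M D" and ?MQ = "prodM M Q"
  let ?P = "prodM ?MD ?MQ"
  note MD = prodM_premfd[OF M D] and MQ = prodM_premfd[OF M Q] and MM = prodM_premfd[OF M M] and DQ = prodM_premfd[OF D Q]
  note P = prodM_premfd[OF MD MQ]
  note s = Ck_map_fst[OF MD MQ, of l] Ck_map_snd[OF MD MQ, of l]
  note g = Ck_map_compose[OF P MD M s(1) Ck_map_fst[OF M D]] and f = Ck_map_compose[OF P MD D s(1) Ck_map_snd[OF M D]]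
    and h = Ck_map_compose[OF P MQ M s(2) Ck_map_fst[OF M Q]] and q = Ck_map_compose[OF P MQ Q s(2) Ck_map_snd[OF M Q]]
  note 1 = Ck_map_compose[OF P MM M Ck_map_pair[OF P M M g h] m, simplified]
  note 2 = Ck_map_compose[OF P DQ Q Ck_map_pair[OF P D Q f q] aD, simplified]
  note 3 = Ck_map_compose[OF P MQ Q Ck_map_pair[OF P M Q g 2] aG, simplified]
  from Ck_map_pair[OF P M Q 1 3] show ?thesis by (simp add: semi_act_def case_prod_beta')
qed

text \<open>For fixed q only the orbit map phi |-> phi q has to be regular. It is smooth on the
  group of order k, where the joint action is assumed merely continuous.\<close>

lemma Ck_map_semi_act_orbit:
  assumes M: "premfd M" and D: "premfd D" and Q: "premfd Q" and m: "Ck_map l (prodM M M) M (\<lambda>(g, h). g \<otimes>\<^bsub>G\<^esub> h)"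
    and aG: "Ck_map l (prodM M Q) Q (\<lambda>(g, q). aG g q)" and aD: "Ck_map l D Q (\<lambda>\<phi>. aD \<phi> q)" and h: "h \<in> pts M"
  shows "Ck_map l (prodM M D) (prodM M Q) (\<lambda>m. semi_act G aG aD m (h, q))"
proof -
  note P = prodM_premfd[OF M D] and MQ = prodM_premfd[OF M Q] and MM = prodM_premfd[OF M M]
  note g = Ck_map_fst[OF M D, of l] and f = Ck_map_snd[OF M D, of l]
  note 1 = Ck_map_compose[OF P MM M Ck_map_pair[OF P M M g Ck_map_const[OF P M h]] m, simplified]
  note 2 = Ck_map_compose[OF P D Q f aD, simplified]
  note 3 = Ck_map_compose[OF P MQ Q Ck_map_pair[OF P M Q g 2] aG, simplified]
  from Ck_map_pair[OF P M Q 1 3] show ?thesis by (simp add: semi_act_def case_prod_beta')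
qed

text \<open>Both sides are tangent vectors at the same point and are compared in one chart. The
  derivative of the second component at (v, u) is the sum of those at (v, 0) and (0, u), taken along
  the slices g |-> (g, d) and phi |-> (e, phi); on these the factor held fixed acts
  trivially.\<close>

lemma tmap_semi_act:
  assumes M: "premfd M" and D: "premfd D" and Q: "premfd Q" and m: "Ck_map (Suc 0) (prodM M M) M (\<lambda>(g, h). g \<otimes>\<^bsub>G\<^esub> h)"
    and aG: "Ck_map (Suc 0) (prodM M Q) Q (\<lambda>(g, q). aG g q)" and aD: "Ck_map (Suc 0) D Q (\<lambda>\<phi>. aD \<phi> q)"
    and h: "h \<in> pts M" and q: "q \<in> pts Q" and e: "e \<in> pts M" and d: "d \<in> pts D"
    and aGe: "\<And>q. q \<in> pts Q \<Longrightarrow> aG e q = q" and aDd: "aD d q = q"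
    and X: "X \<in> tspace M e" and Y: "Y \<in> tspace D d"
  shows "tmap (prodM M D) (prodM M Q) (\<lambda>m. semi_act G aG aD m (h, q)) (tpair M D X Y)
    = tpair M Q (tmap M M (\<lambda>g. g \<otimes>\<^bsub>G\<^esub> h) X) (tadd Q (tmap M Q (\<lambda>g. aG g q) X) (tmap D Q (\<lambda>\<phi>. aD \<phi> q) Y))"
proof -
  let ?P = "prodM M D"
  note P = prodM_premfd[OF M D] and MQ = prodM_premfd[OF M Q] and MM = prodM_premfd[OF M M]
  let ?H = "\<lambda>p. aG (fst p) (aD (snd p) q)"
  let ?F = "\<lambda>m. semi_act G aG aD m (h, q)"
  have Feq: "?F = (\<lambda>p. (fst p \<otimes>\<^bsub>G\<^esub> h, ?H p))" by (auto simp: semi_act_def fun_eq_iff)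
  have F: "Ck_map (Suc 0) ?P (prodM M Q) ?F" by (rule Ck_map_semi_act_orbit[where aD = aD and q = q, OF M D Q m aG aD h])
  have m_h: "Ck_map (Suc 0) M M (\<lambda>g. g \<otimes>\<^bsub>G\<^esub> h)"
    using Ck_map_compose[OF M MM M Ck_map_pair[OF M M M Ck_map_id[OF M] Ck_map_const[OF M M h]] m] by simp
  have aG_q: "Ck_map (Suc 0) M Q (\<lambda>g. aG g q)"
    using Ck_map_compose[OF M MQ Q Ck_map_pair[OF M M Q Ck_map_id[OF M] Ck_map_const[OF M Q q]] aG] by simp
  have mfst: "Ck_map (Suc 0) ?P M (\<lambda>p. fst p \<otimes>\<^bsub>G\<^esub> h)"
    by (rule Ck_map_compose[OF P M M Ck_map_fst[OF M D] m_h])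
  have H: "Ck_map (Suc 0) ?P Q ?H"
    using Ck_map_compose[OF P MQ Q F Ck_map_snd[OF M Q]] by (simp add: semi_act_def case_prod_beta')
  have X1: "tmap M M (\<lambda>g. g \<otimes>\<^bsub>G\<^esub> h) X \<in> tspace M (e \<otimes>\<^bsub>G\<^esub> h)" by (rule tmap_in[OF M M m_h e X])
  have X2: "tmap M Q (\<lambda>g. aG g q) X \<in> tspace Q q" using tmap_in[OF M Q aG_q e X] aGe[OF q] by simp
  have Y2: "tmap D Q (\<lambda>\<phi>. aD \<phi> q) Y \<in> tspace Q q" using tmap_in[OF D Q aD d Y] aDd by simp
  note XY2 = tadd_in[OF Q X2 Y2]
  have XY: "tpair M D X Y \<in> tspace ?P (e, d)" by (rule tpair_in[OF M D X Y])
  have Fed: "?F (e, d) = (e \<otimes>\<^bsub>G\<^esub> h, q)" using aGe[OF q] aDd by (simp add: semi_act_def)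
  have L: "tmap ?P (prodM M Q) ?F (tpair M D X Y) \<in> tspace (prodM M Q) (e \<otimes>\<^bsub>G\<^esub> h, q)"
    using tmap_in[OF P MQ F _ XY] e d unfolding Fed by simp
  have R: "tpair M Q (tmap M M (\<lambda>g. g \<otimes>\<^bsub>G\<^esub> h) X) (tadd Q (tmap M Q (\<lambda>g. aG g q) X) (tmap D Q (\<lambda>\<phi>. aD \<phi> q) Y)) \<in> tspace (prodM M Q) (e \<otimes>\<^bsub>G\<^esub> h, q)"
    by (rule tpair_in[OF M Q X1 XY2])
  have eh: "e \<otimes>\<^bsub>G\<^esub> h \<in> pts M" by (rule Ck_map_in[OF M M m_h e])
  obtain i1 where i1: "i1 \<in> idx_at M e" using premfd.some_idx[OF M e] by blast
  obtain i2 where i2: "i2 \<in> idx_at D d" using premfd.some_idx[OF D d] by blast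
  obtain j1 where j1: "j1 \<in> idx_at M (e \<otimes>\<^bsub>G\<^esub> h)" using premfd.some_idx[OF M eh] by blast
  obtain j2 where j2: "j2 \<in> idx_at Q q" using premfd.some_idx[OF Q q] by blast
  let ?v = "snd X i1" and ?u = "snd Y i2" and ?i = "(i1, i2)"
  have v: "?v \<in> nscar (model M)" by (rule tspace_coord[OF X i1])
  have u: "?u \<in> nscar (model D)" by (rule tspace_coord[OF Y i2])
  have i: "?i \<in> idx_at ?P (e, d)" using i1 i2 by simp
  have 0: "0 \<in> nscar (model M)" "0 \<in> nscar (model D)" using normed.zero_in premfd.mod[OF M] premfd.mod[OF D] by auto
  have vu: "(?v, ?u) \<in> nscar (model ?P)" "(?v, 0) \<in> nscar (model ?P)" "(0, ?u) \<in> nscar (model ?P)" using v u 0 by auto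
  have jH: "j2 \<in> idx_at Q (?H (e, d))" using j2 aGe[OF q] aDd by simp
  have "snd (tmap ?P (prodM M Q) ?F (tpair M D X Y)) (j1, j2) = chart_D ?P (prodM M Q) ?F ?i (j1, j2) (e, d) (?v, ?u)"
    using tmap_coord[OF P MQ F XY i, of "(j1, j2)"] tpair_coord[OF X Y i1 i2] j1 j2 unfolding Fed by simp
  also have "\<dots> = (chart_D ?P M (\<lambda>p. fst p \<otimes>\<^bsub>G\<^esub> h) ?i j1 (e, d) (?v, ?u), chart_D ?P Q ?H ?i j2 (e, d) (?v, ?u))"
    unfolding Feq by (rule chart_D_pair[OF P M Q mfst H i _ jH vu(1)]) (use j1 in simp)
  also have "chart_D ?P M (\<lambda>p. fst p \<otimes>\<^bsub>G\<^esub> h) ?i j1 (e, d) (?v, ?u) = chart_D M M (\<lambda>g. g \<otimes>\<^bsub>G\<^esub> h) i1 j1 e ?v"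
    using chart_D_chain[where f = fst and g = "\<lambda>g. g \<otimes>\<^bsub>G\<^esub> h" and x = "(e, d)", OF P M M Ck_map_fst[OF M D] m_h i, of i1 j1 "(?v, ?u)"] chart_D_fst[OF M D i1 i2 v u] i1 j1 vu by simp
  also have "chart_D ?P Q ?H ?i j2 (e, d) (?v, ?u) = chart_D ?P Q ?H ?i j2 (e, d) (?v, 0) + chart_D ?P Q ?H ?i j2 (e, d) (0, ?u)"
    using chart_D_add[OF P Q H i jH vu(2,3)] by simp
  also have "chart_D ?P Q ?H ?i j2 (e, d) (?v, 0) = chart_D M Q (\<lambda>g. aG g q) i1 j2 e ?v"
  proof -
    have sl: "Ck_map (Suc 0) M ?P (\<lambda>g. (g, d))" by (rule Ck_map_pair[OF M M D Ck_map_id[OF M] Ck_map_const[OF M D d]])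
    have "chart_D M ?P (\<lambda>g. (g, d)) i1 ?i e ?v = (?v, 0)"
      using chart_D_pair[OF M M D Ck_map_id[OF M] Ck_map_const[OF M D d] i1 i1 i2 v] chart_D_id[OF M i1 v] chart_D_const[OF M D i1 i2 v] by simp
    then show ?thesis using chart_D_chain[where f = "\<lambda>g. (g, d)" and g = ?H and x = e, OF M P Q sl H i1 i jH v] aDd by simp
  qed
  also have "chart_D ?P Q ?H ?i j2 (e, d) (0, ?u) = chart_D D Q (\<lambda>\<phi>. aD \<phi> q) i2 j2 d ?u"
  proof -
    have sl: "Ck_map (Suc 0) D ?P (\<lambda>\<phi>. (e, \<phi>))" by (rule Ck_map_pair[OF D M D Ck_map_const[OF D M e] Ck_map_id[OF D]])
    have "chart_D D ?P (\<lambda>\<phi>. (e, \<phi>)) i2 ?i d ?u = (0, ?u)"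
      using chart_D_pair[OF D M D Ck_map_const[OF D M e] Ck_map_id[OF D] i2 i1 i2 u] chart_D_id[OF D i2 u] chart_D_const[OF D M i2 i1 u] by simp
    then have "chart_D ?P Q ?H ?i j2 (e, d) (0, ?u) = chart_D D Q (\<lambda>\<phi>. aG e (aD \<phi> q)) i2 j2 d ?u"
      using chart_D_chain[where f = "\<lambda>\<phi>. (e, \<phi>)" and g = ?H and x = d, OF D P Q sl H i2 i jH u] by simp
    \<comment> \<open>The element e acts trivially on the points of \<open>Q\<close> only, so the
      two maps are known to agree just on the points of \<open>D\<close>; chart derivatives depend
      on no other values.\<close>
    also have "chart_D D Q (\<lambda>\<phi>. aG e (aD \<phi> q)) i2 j2 d = chart_D D Q (\<lambda>\<phi>. aD \<phi> q) i2 j2 d"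
      by (rule chart_D_cong[OF D _ i2]) (use aGe Ck_map_in[OF D Q aD] j2 aDd in auto)
    finally show ?thesis .
  qed
  finally have "snd (tmap ?P (prodM M Q) ?F (tpair M D X Y)) (j1, j2) =
     snd (tpair M Q (tmap M M (\<lambda>g. g \<otimes>\<^bsub>G\<^esub> h) X) (tadd Q (tmap M Q (\<lambda>g. aG g q) X) (tmap D Q (\<lambda>\<phi>. aD \<phi> q) Y))) (j1, j2)"
    using tpair_coord[OF X1 XY2 j1 j2] tadd_coord[OF X2 j2] tmap_coord[OF M M m_h X i1 j1] tmap_coord[OF M Q aG_q X i1, of j2]
      tmap_coord[OF D Q aD Y i2, of j2] j2 aGe[OF q] aDd by simp
  then show ?thesis by (rule tspace_eqI[OF L R, of "(j1, j2)", rotated]) (use j1 j2 in simp)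
qed

text \<open>The two terms from \<open>G\<close> are partial tangents at the fixed point e and use up
  one order of the maps m and aG. The term of u enters with its own regularity; it has base point q
  like the other summand, so the sum makes sense.\<close>

lemma Ck_map_infinitesimal:
  assumes M: "premfd M" and L: "premfd L" and Q: "premfd Q" and m: "Ck_map (Suc l) (prodM M M) M (\<lambda>(g, h). g \<otimes>\<^bsub>G\<^esub> h)"
    and aG: "Ck_map (Suc l) (prodM M Q) Q (\<lambda>(g, q). aG g q)" and x: "Ck_map l (prodM L Q) (TM Q) (\<lambda>(u, q). \<xi> u q)"
    and e: "e \<in> pts M" and aGe: "\<And>q. q \<in> pts Q \<Longrightarrow> aG e q = q"
    and xq: "\<And>u q. u \<in> pts L \<Longrightarrow> q \<in> pts Q \<Longrightarrow> fst (\<xi> u q) = q"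
  shows "Ck_map l (prodM (prodM (tspaceM M e) L) (prodM M Q)) (TM (prodM M Q))
         (\<lambda>((X, u), (h, q)). tpair M Q (rtransl G M X h) (tadd Q (infG M Q aG X q) (\<xi> u q)))"
proof -
  let ?T = "tspaceM M e"
  note T = tspaceM_premfd[OF M e]
  note TL = prodM_premfd[OF T L] and MQ = prodM_premfd[OF M Q] and TM = prodM_premfd[OF T M] and TQ = prodM_premfd[OF T Q] and LQ = prodM_premfd[OF L Q]
  note P = prodM_premfd[OF TL MQ]
  let ?P = "prodM (prodM ?T L) (prodM M Q)"
  note s = Ck_map_fst[OF TL MQ, of l] Ck_map_snd[OF TL MQ, of l]
  note X = Ck_map_compose[OF P TL T s(1) Ck_map_fst[OF T L]] and u = Ck_map_compose[OF P TL L s(1) Ck_map_snd[OF T L]]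
    and h = Ck_map_compose[OF P MQ M s(2) Ck_map_fst[OF M Q]] and q = Ck_map_compose[OF P MQ Q s(2) Ck_map_snd[OF M Q]]
  note 1 = Ck_map_compose[OF P TM TM_premfd[OF M] Ck_map_pair[OF P T M X h] Ck_map_partial_tangent[OF M M M e m], simplified]
  note 2 = Ck_map_compose[OF P TQ TM_premfd[OF Q] Ck_map_pair[OF P T Q X q] Ck_map_partial_tangent[OF M Q Q e aG], simplified]
  note 3 = Ck_map_compose[OF P LQ TM_premfd[OF Q] Ck_map_pair[OF P L Q u q] x, simplified]
  have "Ck_map l ?P (TM (prodM M Q)) (\<lambda>p. tpair M Q (tmap M M (\<lambda>g. g \<otimes>\<^bsub>G\<^esub> fst (snd p)) (fst (fst p)))
     (tadd Q (tmap M Q (\<lambda>g. aG g (snd (snd p))) (fst (fst p))) (\<xi> (snd (fst p)) (snd (snd p)))))"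
    by (rule Ck_map_tpair_tadd[OF P M Q 1 2 3]) (auto simp: xq aGe tspace_iff)
  then show ?thesis by (simp add: rtransl_def infG_def case_prod_beta')
qed

theorem proposition2p13:
  fixes k :: nat
    and G :: "'g monoid"
    and MG :: "('g, 'i, 'a::real_vector) mfd"
    and aE :: "'g \<Rightarrow> real^'n \<Rightarrow> real^'n"
    and \<rho> :: "'g \<Rightarrow> (real^'n \<Rightarrow> real^'n) \<Rightarrow> (real^'n \<Rightarrow> real^'n)"
    and Q :: "('q, 'j, 'e::real_vector) mfd"
    and aD :: "(real^'n \<Rightarrow> real^'n) \<Rightarrow> 'q \<Rightarrow> 'q"
    and aG :: "'g \<Rightarrow> 'q \<Rightarrow> 'q"
  assumes k: "k \<ge> 1"
    and G: "lie_group G MG"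
    \<comment> \<open>(a)\<close>
    and aE: "smooth_action G MG (linM std_ns) aE"
    \<comment> \<open>(b)\<close>
    and rho_cont: "continuous_map (mtop (prodM MG (DiffM k))) (mtop (DiffM k)) (\<lambda>(g, \<phi>). \<rho> g \<phi>)"
    and rho_right: "\<forall>g\<in>carrier G. \<forall>h\<in>carrier G. \<forall>\<phi>\<in>DiffC0 k. \<rho> (g \<otimes>\<^bsub>G\<^esub> h) \<phi> = \<rho> h (\<rho> g \<phi>)"
    and rho_comp: "\<forall>g\<in>carrier G. \<forall>\<phi>\<in>DiffC0 k. \<forall>\<psi>\<in>DiffC0 k. \<rho> g (\<phi> \<circ> \<psi>) = \<rho> g \<phi> \<circ> \<rho> g \<psi>"
    and rho_conj: "\<forall>g\<in>carrier G. \<forall>\<phi>\<in>DiffC0 k. \<forall>x. \<rho> g \<phi> x = aE (inv\<^bsub>G\<^esub> g) (\<phi> (aE g x))"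
    and rho_diffeo: "\<forall>g\<in>carrier G. diffeo (DiffM k) (DiffM k) (\<rho> g)"
    \<comment> \<open>(c)\<close>
    and rho_l_cont: "\<forall>l. continuous_map (mtop (prodM MG (DiffM (k + l)))) (mtop (DiffM (k + l)))
                           (\<lambda>(g, \<phi>). \<rho> g \<phi>)"
    and rho_l_diffeo: "\<forall>l. \<forall>g\<in>carrier G. diffeo (DiffM (k + l)) (DiffM (k + l)) (\<rho> g)"
    and rho_l_Cl: "\<forall>l. Ck_map l (prodM MG (DiffM (k + l))) (DiffM k) (\<lambda>(g, \<phi>). \<rho> g \<phi>)"
    \<comment> \<open>the manifold \<open>Q\<close> and the action of the diffeomorphisms\<close>
    and Q: "banach_manifold Q"
    and aD: "acts_on (DiffG k) (pts Q) aD"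
    and aD_cont: "continuous_map (mtop (prodM (DiffM k) Q)) (mtop Q) (\<lambda>(\<phi>, q). aD \<phi> q)"
    and aD_smooth: "\<forall>q\<in>pts Q. smooth_map (DiffM k) Q (\<lambda>\<phi>. aD \<phi> q)"
    and aD_Cl: "\<forall>l>0. Ck_map l (prodM (DiffM (k + l)) Q) Q (\<lambda>(\<phi>, q). aD \<phi> q)"
    and infD_Cl: "\<forall>l>0. Ck_map l (prodM (linM (C0 (k + l))) Q) (TM Q) (\<lambda>(u, q). infD k Q aD u q)"
    \<comment> \<open>the action of \<open>G\<close> on \<open>Q\<close>\<close>
    and aG: "smooth_action G MG Q aG"
    and compat: "\<forall>g\<in>carrier G. \<forall>\<phi>\<in>DiffC0 k. \<forall>q\<in>pts Q. aD \<phi> (aG g q) = aG g (aD (\<rho> g \<phi>) q)"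
  shows "
    \<comment> \<open>\<open>A\<close> is an action of the semidirect product\<close>
    acts_on (semidirect G \<rho> k) (pts (prodM MG Q)) (semi_act G aG aD) \<and>
    \<comment> \<open>1\<close>
    continuous_map (mtop (prodM (prodM MG (DiffM k)) (prodM MG Q))) (mtop (prodM MG Q))
      (\<lambda>(m, p). semi_act G aG aD m p) \<and>
    \<comment> \<open>2\<close>
    (\<forall>p\<in>pts (prodM MG Q).
       smooth_map (prodM MG (DiffM k)) (prodM MG Q) (\<lambda>m. semi_act G aG aD m p)) \<and>
    \<comment> \<open>the infinitesimal action, i.e. the derivative of \<open>A_(h,q)\<close> at the identity\<close>
    (\<forall>h\<in>carrier G. \<forall>q\<in>pts Q. \<forall>X\<in>tspace MG \<one>\<^bsub>G\<^esub>. \<forall>u\<in>nscar (C0 k).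
       tmap (prodM MG (DiffM k)) (prodM MG Q) (\<lambda>m. semi_act G aG aD m (h, q))
           (tpair MG (DiffM k) X (tid u))
         = tpair MG Q (rtransl G MG X h) (tadd Q (infG MG Q aG X q) (infD k Q aD u q))) \<and>
    \<comment> \<open>3\<close>
    (\<forall>l>0.
       Ck_map l (prodM (prodM MG (DiffM (k + l))) (prodM MG Q)) (prodM MG Q)
         (\<lambda>(m, p). semi_act G aG aD m p) \<and>
       Ck_map l (prodM (prodM (tspaceM MG \<one>\<^bsub>G\<^esub>) (linM (C0 (k + l)))) (prodM MG Q)) (TM (prodM MG Q))
         (\<lambda>((X, u), (h, q)).
            tpair MG Q (rtransl G MG X h) (tadd Q (infG MG Q aG X q) (infD k Q aD u q))))"
proof -
  let ?D = "\<lambda>k. DiffM k :: (real^'n \<Rightarrow> real^'n, unit, (real^'n) \<Rightarrow>\<^sub>C (real^'n)) mfd"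
  have grp: "group G" and ptsM: "pts MG = carrier G" and M: "premfd MG"
    and m: "\<And>l. Ck_map l (prodM MG MG) MG (\<lambda>(g, h). g \<otimes>\<^bsub>G\<^esub> h)"
    using G banach_manifold_premfd unfolding lie_group_def smooth_map_def by auto
  interpret G: group G by (rule grp)
  have Q': "premfd Q" by (rule banach_manifold_premfd[OF Q])
  \<comment> \<open>Since k + l >= 1, the groups of higher order have open charts too.\<close>
  have D: "premfd (?D k)" and Dl: "premfd (?D (k + l))" for l using k by (auto intro: DiffM_premfd)
  have L: "premfd (linM (C0 (k + l)))" for l by (rule linM_premfd[OF C0_normed])
  have aGa: "acts_on G (pts Q) aG" and aGl: "Ck_map l (prodM MG Q) Q (\<lambda>(g, q). aG g q)" for l
    using aG unfolding smooth_action_def smooth_map_def by auto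
  have aEa: "acts_on G UNIV aE" using aE unfolding smooth_action_def by simp
  have DG: "group (DiffG k :: (real^'n \<Rightarrow> real^'n) monoid)" by (rule acts_onD(1)[OF aD])
  have id: "id \<in> (DiffC0 k :: (real^'n \<Rightarrow> real^'n) set)"
    using monoid.one_closed[OF group.is_monoid[OF DG]] by (simp add: DiffG_def)
  have one: "\<one>\<^bsub>G\<^esub> \<in> pts MG" using ptsM by simp
  have aGe: "aG \<one>\<^bsub>G\<^esub> q = q" if "q \<in> pts Q" for q by (rule acts_onD(3)[OF aGa that])
  have aDe: "aD id q = q" if "q \<in> pts Q" for q using acts_onD(3)[OF aD that] by (simp add: DiffG_def)
  have rho_in: "\<rho> g \<phi> \<in> DiffC0 k" if "g \<in> carrier G" "\<phi> \<in> DiffC0 k" for g \<phi>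
    using rho_diffeo that unfolding diffeo_def bij_betw_def by auto
  \<comment> \<open>From the conjugation formula: g^-1 (g x) = x for the action on R^d.\<close>
  have rho_id: "\<rho> g id = id" if g: "g \<in> carrier G" for g
  proof
    fix x
    have "aE (inv\<^bsub>G\<^esub> g) (aE g x) = aE (inv\<^bsub>G\<^esub> g \<otimes>\<^bsub>G\<^esub> g) x" using acts_onD(4)[OF aEa, of "inv\<^bsub>G\<^esub> g" g x] g by simp
    then show "\<rho> g id x = id x" using rho_conj g id acts_onD(3)[OF aEa] by simp
  qed
  have rho_one: "\<rho> \<one>\<^bsub>G\<^esub> \<phi> = \<phi>" if "\<phi> \<in> DiffC0 k" for \<phi>
    using rho_conj that acts_onD(3)[OF aEa] by (simp add: fun_eq_iff)
  have "group (semidirect G \<rho> k)"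
    by (rule semidirect_group[OF grp DG rho_in]) (use rho_right rho_comp rho_id rho_one in auto)
  then have A: "acts_on (semidirect G \<rho> k) (pts (prodM MG Q)) (semi_act G aG aD)"
    unfolding prodM_sel ptsM by (rule semidirect_acts[OF _ aGa aD rho_in]) (use compat in auto)
  have aD0: "Ck_map 0 (prodM (?D k) Q) Q (\<lambda>(\<phi>, q). aD \<phi> q)"
    by (rule continuous_Ck_map_0[OF prodM_premfd[OF D Q'] Q' aD_cont])
  have 1: "continuous_map (mtop (prodM (prodM MG (?D k)) (prodM MG Q))) (mtop (prodM MG Q)) (\<lambda>(m, p). semi_act G aG aD m p)"
    by (rule Ck_map_cont[OF Ck_map_semi_act[OF M D Q' m aGl aD0]])
  have 2: "smooth_map (prodM MG (?D k)) (prodM MG Q) (\<lambda>m. semi_act G aG aD m p)" if "p \<in> pts (prodM MG Q)" for p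
  proof -
    obtain h q where p: "p = (h, q)" "h \<in> pts MG" "q \<in> pts Q" using \<open>p \<in> pts (prodM MG Q)\<close> by auto
    have "Ck_map l (?D k) Q (\<lambda>\<phi>. aD \<phi> q)" for l using aD_smooth p(3) unfolding smooth_map_def by blast
    then show ?thesis unfolding smooth_map_def p(1)
      using Ck_map_semi_act_orbit[where aD = aD and q = q, OF M D Q' m aGl _ p(2)] by blast
  qed
  have tid: "tid u \<in> tspace (?D k) id" if u: "u \<in> nscar (C0 k)" for u
  proof -
    \<comment> \<open>The manifold has the single index (), so the coordinate family of
      \<open>tid u\<close> is constant and its only compatibility condition concerns the identity as
      chart change.\<close>
    have i: "() \<in> idx_at (?D k) id" using id by (simp add: idx_at_iff)
    have "trans_D (?D k) () () id u = u" using chart_D_id[OF D i] u by simp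
    then show ?thesis unfolding tspace_iff tid_def using u i by (auto simp: extensional_def)
  qed
  have inf: "tmap (prodM MG (?D k)) (prodM MG Q) (\<lambda>m. semi_act G aG aD m (h, q)) (tpair MG (?D k) X (tid u))
         = tpair MG Q (rtransl G MG X h) (tadd Q (infG MG Q aG X q) (infD k Q aD u q))"
    if "h \<in> carrier G" "q \<in> pts Q" "X \<in> tspace MG \<one>\<^bsub>G\<^esub>" "u \<in> nscar (C0 k)" for h q X u
    unfolding rtransl_def infG_def infD_def
    by (rule tmap_semi_act[where aD = aD and q = q, OF M D Q' m aGl _ _ that(2) one _ aGe aDe[OF that(2)] that(3) tid[OF that(4)]])
      (use aD_smooth that ptsM id in \<open>auto simp: smooth_map_def\<close>)
  have infD_fst: "fst (infD k Q aD u q) = q" if "q \<in> pts Q" for u q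
    using aDe[OF that] by (simp add: infD_def tid_def)
  have 3: "Ck_map l (prodM (prodM MG (?D (k + l))) (prodM MG Q)) (prodM MG Q) (\<lambda>(m, p). semi_act G aG aD m p)" if "l > 0" for l
    by (rule Ck_map_semi_act[OF M Dl Q' m aGl]) (use aD_Cl that in auto)
  \<comment> \<open>The vectors u come from \<open>C0 (k + l)\<close>, while \<open>infD k\<close>
    differentiates on the group of order k.\<close>
  have 4: "Ck_map l (prodM (prodM (tspaceM MG \<one>\<^bsub>G\<^esub>) (linM (C0 (k + l)))) (prodM MG Q)) (TM (prodM MG Q))
         (\<lambda>((X, u), (h, q)). tpair MG Q (rtransl G MG X h) (tadd Q (infG MG Q aG X q) (infD k Q aD u q)))" if "l > 0" for l
    by (rule Ck_map_infinitesimal[OF M L Q' m aGl _ one aGe infD_fst]) (use infD_Cl that in auto)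
  show ?thesis using A 1 2 inf 3 4 by blast
qed

end
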